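(* Homogeneous Gårding polynomials are Lorentzian. Moreover, for every $d\ge2$, $$\mathrm{S}^{d,\mathfrak h}\subset\mathrm{G}^{d,\mathfrak h}\subset\mathrm{L}^d,$$ where $\mathrm{S}^{d,\mathfrak h}$ is the class of homogeneous degree $d$ real stable polynomials with nonnegative coefficients, $\mathrm{G}^{d,\mathfrak h}$ is the class of homogeneous degree $d$ Gårding polynomials, and $\mathrm{L}^d$ is the class of Lorentzian polynomials of degree $d$.
   Context: Let $\Gamma_n^+=\{x\in\mathbb{R}^n:x_i>0\ \forall i\}$. A set $R\subset\mathbb{R}^n$ passes the positive ray test (PRT) if $R+\overline{\Gamma_n^+}\subset R$. A multi-affine polynomial $g$ (degree at most 1 in each variable) is multi-affine Gårding if $g=0$ or some nonempty connected component of $\{g>0\}$ passes PRT. A polynomial $f\in\mathbb{R}[x_1,\dots,x_n]$ is Gårding if $f=g\circ\mu$ for some multi-affine Gårding polynomial $g$ in $m$ variables (some $m$) and some strictly positive affine map $\mu:\mathbb{R}^n\to\mathbb{R}^m$, $\mu(x)=Ax+b$, where $A$ has nonnegative entries and every row of $A$ has positive sum. A polynomial $f\in\mathbb{R}[x_1,\dots,x_n]$ is real stable if $f=0$ or $f(x)\ne0$ for all $x\in\mathbb{C}^n$ with $\operatorname{Im}x_i>0$ for all $i$. A homogeneous polynomial $f$ of degree $d\ge2$ with nonnegative coefficients is Lorentzian if (i) for all multi-indices $\alpha$ with $|\alpha|=d-2$, $\partial^\alpha f$ is real stable, and (ii) the support $J$ of $f$ (set of exponents with nonzero coefficient) is M-convex: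 for all $\alpha,\beta\in J$ and $i$ with $\alpha_i>\beta_i$ there is $j$ with $\alpha_j<\beta_j$ and $\alpha-e_i+e_j\in J$. Homogeneous polynomials of degree $0$ or $1$ with nonnegative coefficients are Lorentzian by convention. *)

theory Defs
  imports "HOL-Analysis.Analysis" "HOL-Library.Poly_Mapping"
begin

text \<open>Real polynomials are finitely supported maps from exponents to coefficients; the variables
  \<open>x\<^sub>1, \<dots>, x\<^sub>n\<close> are numbered \<open>0, \<dots>, n - 1\<close>.\<close>

type_synonym mpoly = "(nat \<Rightarrow>\<^sub>0 nat) \<Rightarrow>\<^sub>0 real"

definition polys :: "nat \<Rightarrow> mpoly set"
  where "polys n = {f. \<forall>\<alpha>\<in>Poly_Mapping.keys f. Poly_Mapping.keys \<alpha> \<subseteq> {..<n}}"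

definition mdegree :: "(nat \<Rightarrow>\<^sub>0 nat) \<Rightarrow> nat"
  where "mdegree \<alpha> = (\<Sum>i\<in>Poly_Mapping.keys \<alpha>. Poly_Mapping.lookup \<alpha> i)"

definition meval :: "mpoly \<Rightarrow> (nat \<Rightarrow> 'a) \<Rightarrow> 'a :: real_normed_field"
  where "meval f x = (\<Sum>\<alpha>\<in>Poly_Mapping.keys f. of_real (Poly_Mapping.lookup f \<alpha>) *
           (\<Prod>i\<in>Poly_Mapping.keys \<alpha>. x i ^ Poly_Mapping.lookup \<alpha> i))"

definition nonneg_coeffs :: "mpoly \<Rightarrow> bool"
  where "nonneg_coeffs f \<longleftrightarrow> (\<forall>\<alpha>. Poly_Mapping.lookup f \<alpha> \<ge> 0)"

text \<open>The zero polynomial is homogeneous of every degree.\<close>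

definition homog :: "nat \<Rightarrow> mpoly \<Rightarrow> bool"
  where "homog d f \<longleftrightarrow> (\<forall>\<alpha>\<in>Poly_Mapping.keys f. mdegree \<alpha> = d)"

definition multi_affine :: "mpoly \<Rightarrow> bool"
  where "multi_affine f \<longleftrightarrow> (\<forall>\<alpha>\<in>Poly_Mapping.keys f. \<forall>i. Poly_Mapping.lookup \<alpha> i \<le> 1)"

text \<open>The truncated subtraction below is harmless: a monomial not containing the variable \<open>i\<close>
  gets the coefficient \<open>0\<close>.\<close>

definition pderiv_var :: "nat \<Rightarrow> mpoly \<Rightarrow> mpoly"
  where "pderiv_var i f = (\<Sum>\<alpha>\<in>Poly_Mapping.keys f.
           Poly_Mapping.single (\<alpha> - Poly_Mapping.single i 1)
             (of_nat (Poly_Mapping.lookup \<alpha> i) * Poly_Mapping.lookup f \<alpha>))"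

definition pderiv_multi :: "(nat \<Rightarrow>\<^sub>0 nat) \<Rightarrow> mpoly \<Rightarrow> mpoly"
  where "pderiv_multi \<alpha> f = fold (\<lambda>i. pderiv_var i ^^ Poly_Mapping.lookup \<alpha> i)
           (sorted_list_of_set (Poly_Mapping.keys \<alpha>)) f"

text \<open>The topology \<open>Euclidean_space n\<close> of the library represents \<open>\<real>\<^sup>n\<close> by the functions
  \<open>nat \<Rightarrow> real\<close> that vanish at all indices \<open>i \<ge> n\<close>.\<close>

definition pos_orthant :: "nat \<Rightarrow> (nat \<Rightarrow> real) set"
  where "pos_orthant n = {x \<in> topspace (Euclidean_space n). \<forall>i<n. x i > 0}"

definition passes_PRT :: "nat \<Rightarrow> (nat \<Rightarrow> real) set \<Rightarrow> bool"
  where "passes_PRT n R \<longleftrightarrow>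
    {\<lambda>i. x i + y i | x y. x \<in> R \<and> y \<in> Euclidean_space n closure_of pos_orthant n} \<subseteq> R"

definition pos_set :: "nat \<Rightarrow> mpoly \<Rightarrow> (nat \<Rightarrow> real) set"
  where "pos_set n g = {x \<in> topspace (Euclidean_space n). meval g x > 0}"

definition multi_affine_garding :: "nat \<Rightarrow> mpoly \<Rightarrow> bool"
  where "multi_affine_garding n g \<longleftrightarrow> g \<in> polys n \<and> multi_affine g \<and>
    (g = 0 \<or> (\<exists>C\<in>connected_components_of (subtopology (Euclidean_space n) (pos_set n g)).
                 C \<noteq> {} \<and> passes_PRT n C))"

definition strictly_positive_affine :: "nat \<Rightarrow> nat \<Rightarrow> ((nat \<Rightarrow> real) \<Rightarrow> (nat \<Rightarrow> real)) \<Rightarrow> bool"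
  where "strictly_positive_affine n m \<mu> \<longleftrightarrow>
    (\<exists>(A :: nat \<Rightarrow> nat \<Rightarrow> real) (b :: nat \<Rightarrow> real).
       (\<forall>i<m. \<forall>j<n. A i j \<ge> 0) \<and> (\<forall>i<m. (\<Sum>j<n. A i j) > 0) \<and>
       (\<forall>x\<in>topspace (Euclidean_space n).
          \<mu> x = (\<lambda>i. if i < m then (\<Sum>j<n. A i j * x j) + b i else 0)))"

definition garding :: "nat \<Rightarrow> mpoly \<Rightarrow> bool"
  where "garding n f \<longleftrightarrow> f \<in> polys n \<and>
    (\<exists>m g \<mu>. multi_affine_garding m g \<and> strictly_positive_affine n m \<mu> \<and>
       (\<forall>x\<in>topspace (Euclidean_space n). meval f x = meval g (\<mu> x)))"

definition real_stable :: "nat \<Rightarrow> mpoly \<Rightarrow> bool"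
  where "real_stable n f \<longleftrightarrow> f \<in> polys n \<and>
    (f = 0 \<or> (\<forall>z :: nat \<Rightarrow> complex. (\<forall>i<n. Im (z i) > 0) \<longrightarrow> meval f z \<noteq> 0))"

definition M_convex :: "(nat \<Rightarrow>\<^sub>0 nat) set \<Rightarrow> bool"
  where "M_convex J \<longleftrightarrow> (\<forall>\<alpha>\<in>J. \<forall>\<beta>\<in>J. \<forall>i. Poly_Mapping.lookup \<alpha> i > Poly_Mapping.lookup \<beta> i \<longrightarrow>
    (\<exists>j. Poly_Mapping.lookup \<alpha> j < Poly_Mapping.lookup \<beta> j \<and>
         \<alpha> - Poly_Mapping.single i 1 + Poly_Mapping.single j 1 \<in> J))"

definition lorentzian :: "nat \<Rightarrow> nat \<Rightarrow> mpoly \<Rightarrow> bool"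
  where "lorentzian n d f \<longleftrightarrow> f \<in> polys n \<and> homog d f \<and> nonneg_coeffs f \<and>
    (d \<ge> 2 \<longrightarrow>
       (\<forall>\<alpha>. Poly_Mapping.keys \<alpha> \<subseteq> {..<n} \<and> mdegree \<alpha> = d - 2 \<longrightarrow> real_stable n (pderiv_multi \<alpha> f)) \<and>
       M_convex (Poly_Mapping.keys f))"

definition stable_class :: "nat \<Rightarrow> nat \<Rightarrow> mpoly set"
  where "stable_class n d = {f. homog d f \<and> real_stable n f \<and> nonneg_coeffs f}"

definition garding_class :: "nat \<Rightarrow> nat \<Rightarrow> mpoly set"
  where "garding_class n d = {f. homog d f \<and> garding n f}"

definition lorentzian_class :: "nat \<Rightarrow> nat \<Rightarrow> mpoly set"
  where "lorentzian_class n d = {f. lorentzian n d f}"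

end

theory Submission
  imports Defs "HOL-Computational_Algebra.Fundamental_Theorem_Algebra"
begin

text \<open>
  A Garding polynomial is controlled by the Rayleigh inequality, and for homogeneous polynomials this
  inequality is enough to produce the Lorentzian signature.

  \<^item> \<^emph>\<open>Garding implies Lorentzian.\<close> Let \<open>f = g \<circ> \<mu> \<noteq> 0\<close> be homogeneous of degree \<open>d\<close>, with \<open>g\<close> multi-affine and
  \<open>C\<close> a component of \<open>{g > 0}\<close> that passes the positive ray test. Because \<open>g\<close> is affine along
  coordinate lines, \<open>C\<close> is stable under raising a coordinate and under every coordinate move that ends
  where \<open>g > 0\<close> (\<open>garding_region\<close>). This alone makes every derivative \<open>p = \<partial>\<^sup>\<beta>g\<close> nonnegative on \<open>C\<close>
  and forces \<open>p \<partial>\<^sub>i\<partial>\<^sub>jp \<le> \<partial>\<^sub>ip \<partial>\<^sub>jp\<close> there (\<open>region_derivatives\<close>). Growth along rays shows that \<open>f(x) = h(Ax)\<close>,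
  where \<open>h\<close> is the top-degree part of \<open>g\<close>. In the limit the derivatives of \<open>h\<close> satisfy the same
  inequality on the orthant; those of degree \<open>2\<close> satisfy it at every point whenever
  \<open>\<partial>\<^sub>i\<partial>\<^sub>jp \<noteq> 0\<close>, since every point enters \<open>C\<close> after moving far enough along the \<open>d\<close> variables of a
  monomial of \<open>h\<close>. The second statement gives the quadratic derivatives of \<open>h\<close> their signature
  (\<open>lorentz_if_rayleigh_on_edges\<close>), the first prevents the variables from splitting into two
  unrelated groups (\<open>rayleigh_connected\<close>). A Perron-Frobenius argument (\<open>lorentz_trickle_down\<close>) then
  carries the signature from partial derivatives to all forms \<open>D\<^sub>v\<^sub>1 \<dots> D\<^sub>v\<^sub>d\<^sub>-\<^sub>2 h\<close> with nonnegative
  directions. In this strength the property survives the substitution \<open>x \<mapsto> Ax\<close>, gives real stability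
  of the quadratic derivatives of \<open>f\<close>, and implies that the support of \<open>f\<close> is M-convex
  (\<open>M_convex_support\<close>).

  \<^item> \<^emph>\<open>Stable implies Garding.\<close> Replacing \<open>f\<close> by \<open>f + (y - x\<^sub>i) \<partial>\<^sub>if / k\<close>, where \<open>y\<close> is a new variable and
  \<open>k\<close> bounds the degree in \<open>x\<^sub>i\<close>, lowers that bound, keeps stability by Laguerre's theorem, and
  returns \<open>f\<close> on \<open>y = x\<^sub>i\<close>. Repetition yields a stable multi-affine \<open>g\<close> from which \<open>f\<close> arises by
  identifying variables (\<open>stable_polarization\<close>). For a homogeneous stable \<open>g\<close> with nonnegative
  coefficients the set \<open>{x. g(x + te) > 0 for all t \<ge> 0}\<close> is open and closed in \<open>{g > 0}\<close> for every
  positive \<open>e\<close>, hence is the component containing the positive orthant. So it does not depend on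
  \<open>e\<close>, and this independence is the positive ray test.
\<close>

abbreviation (input) keys :: "('a \<Rightarrow>\<^sub>0 'b::zero) \<Rightarrow> 'a set"
  where "keys \<equiv> Poly_Mapping.keys"

abbreviation (input) lookup :: "('a \<Rightarrow>\<^sub>0 'b::zero) \<Rightarrow> 'a \<Rightarrow> 'b"
  where "lookup \<equiv> Poly_Mapping.lookup"

section \<open>Quadratic forms with at most one positive direction\<close>

definition bil :: "nat \<Rightarrow> (nat \<Rightarrow> nat \<Rightarrow> real) \<Rightarrow> (nat \<Rightarrow> real) \<Rightarrow> (nat \<Rightarrow> real) \<Rightarrow> real"
  where "bil n Q x y = (\<Sum>i<n. \<Sum>j<n. x i * y j * Q i j)"

text \<open>The reverse Cauchy-Schwarz inequality says that no plane is positive definite, that is, a symmetric \<open>Q\<close>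
  has at most one positive eigenvalue. In this form it passes to limits and to pullbacks.\<close>
definition lorentz :: "nat \<Rightarrow> (nat \<Rightarrow> nat \<Rightarrow> real) \<Rightarrow> bool"
  where "lorentz n Q \<longleftrightarrow> (\<forall>u w. bil n Q u u > 0 \<longrightarrow> bil n Q u u * bil n Q w w \<le> (bil n Q u w)\<^sup>2)"

lemma bil_row: "bil n Q x y = (\<Sum>i<n. x i * (\<Sum>j<n. y j * Q i j))"
  by (simp add: bil_def sum_distrib_left mult.assoc)

lemma bil_lin_left: "bil n Q (\<lambda>i. a * x i + b * y i) z = a * bil n Q x z + b * bil n Q y z"
  by (simp add: bil_def sum_distrib_left sum.distrib algebra_simps)

lemma bil_lin_right: "bil n Q z (\<lambda>i. a * x i + b * y i) = a * bil n Q z x + b * bil n Q z y"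
  by (simp add: bil_def sum_distrib_left sum.distrib algebra_simps)

lemma bil_sym:
  assumes "\<And>i j. i < n \<Longrightarrow> j < n \<Longrightarrow> Q i j = Q j i"
  shows "bil n Q x y = bil n Q y x"
  unfolding bil_def
  by (subst sum.swap) (auto intro!: sum.cong simp: assms)

lemma bil_quadratic:
  assumes "\<And>i j. i < n \<Longrightarrow> j < n \<Longrightarrow> Q i j = Q j i"
  shows "bil n Q (\<lambda>i. a * x i + b * y i) (\<lambda>i. a * x i + b * y i) =
    a\<^sup>2 * bil n Q x x + 2 * a * b * bil n Q x y + b\<^sup>2 * bil n Q y y"
  using bil_sym[of n Q y x, OF assms]
  by (simp add: bil_lin_left bil_lin_right power2_eq_square algebra_simps)

text \<open>A positive definite plane would meet the kernel of \<open>l\<close> in a nonzero vector.\<close>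
lemma lorentz_if_negative_on_hyperplane:
  assumes sym: "\<And>i j. i < n \<Longrightarrow> j < n \<Longrightarrow> Q i j = Q j i"
    and lin: "\<And>a x b y. l (\<lambda>i. a * x i + b * y i) = a * l x + b * l y"
    and neg: "\<And>y. l y = 0 \<Longrightarrow> bil n Q y y \<le> (0::real)"
  shows "lorentz n Q"
  unfolding lorentz_def
proof (intro allI impI)
  fix u w assume u: "bil n Q u u > 0"
  show "bil n Q u u * bil n Q w w \<le> (bil n Q u w)\<^sup>2"
  proof (rule ccontr)
    assume "\<not> ?thesis"
    then have gap: "bil n Q u u * bil n Q w w - (bil n Q u w)\<^sup>2 > 0" by simp
    (* the combination of u and w that lies in the kernel of l *)
    define a b :: real where "a = l w" and "b = - l u"
    have "l (\<lambda>i. a * u i + b * w i) = 0" by (subst lin) (simp add: a_def b_def)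
    then have le: "bil n Q (\<lambda>i. a * u i + b * w i) (\<lambda>i. a * u i + b * w i) \<le> 0" by (rule neg)
    have "bil n Q u u * bil n Q (\<lambda>i. a * u i + b * w i) (\<lambda>i. a * u i + b * w i) =
      (a * bil n Q u u + b * bil n Q u w)\<^sup>2 + b\<^sup>2 * (bil n Q u u * bil n Q w w - (bil n Q u w)\<^sup>2)"
      using bil_quadratic[of n Q a u b w, OF sym] by (simp add: power2_eq_square algebra_simps)
    moreover have "bil n Q u u * bil n Q (\<lambda>i. a * u i + b * w i) (\<lambda>i. a * u i + b * w i) \<le> 0"
      using u le by (simp add: mult_le_0_iff)
    ultimately have "b\<^sup>2 * (bil n Q u u * bil n Q w w - (bil n Q u w)\<^sup>2) \<le> 0"
      by (smt (verit) zero_le_power2)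
    then have "b = 0" using gap by (simp add: mult_le_0_iff not_le)
    then have "l u = 0" by (simp add: b_def)
    then show False using neg u by fastforce
  qed
qed

text \<open>On the orthogonal complement of \<open>u\<close> the form is negative semidefinite, so an isotropic vector
  there lies in the radical. In this way the vanishing of one mixed derivative forces the
  vanishing of others, which is the source of M-convexity.\<close>
lemma lorentz_radical:
  assumes sym: "\<And>i j. i < n \<Longrightarrow> j < n \<Longrightarrow> Q i j = Q j i"
    and "lorentz n Q" "bil n Q u u > 0" "bil n Q u x = 0" "bil n Q x x \<ge> 0"
  shows "bil n Q x y = 0"
proof -
  have h: "bil n Q u u * bil n Q w w \<le> (bil n Q u w)\<^sup>2" for w
    using assms(2,3) by (auto simp: lorentz_def)
  have xx: "bil n Q x x = 0"
    using h[of x] assms(3-5) by (simp add: mult_le_0_iff)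
  define C where "C = (bil n Q u y)\<^sup>2 - bil n Q u u * bil n Q y y"
  have q: "bil n Q u u * (2 * t * bil n Q x y) \<le> t\<^sup>2 * C" for t
  proof -
    have "bil n Q u u * (2 * t * bil n Q x y + t\<^sup>2 * bil n Q y y) \<le> t\<^sup>2 * (bil n Q u y)\<^sup>2"
      using h[of "\<lambda>i. 1 * x i + t * y i"]
        bil_quadratic[of n Q 1 x t y, OF sym] bil_lin_right[of n Q u 1 x t y]
      by (simp add: assms(4) xx power_mult_distrib)
    then show ?thesis by (simp add: C_def algebra_simps)
  qed
  show ?thesis
  proof (rule ccontr)
    assume ne: "bil n Q x y \<noteq> 0"
    define K where "K = bil n Q u u * bil n Q x y"
    have K: "K \<noteq> 0" using ne assms(3) by (simp add: K_def)
    have "2 * t * K \<le> t\<^sup>2 * C" for t using q[of t] by (simp add: K_def algebra_simps)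
    note this[of "K / (1 + \<bar>C\<bar>)"]
    then have "2 * K\<^sup>2 / (1 + \<bar>C\<bar>) \<le> K\<^sup>2 / (1 + \<bar>C\<bar>) * (C / (1 + \<bar>C\<bar>))"
      by (simp add: power2_eq_square)
    moreover have "C / (1 + \<bar>C\<bar>) \<le> 1" by (simp add: field_simps)
    moreover have "K\<^sup>2 / (1 + \<bar>C\<bar>) > 0" using K by (simp add: add_pos_nonneg)
    moreover from calculation(2,3) have "K\<^sup>2 / (1 + \<bar>C\<bar>) * (C / (1 + \<bar>C\<bar>)) \<le> K\<^sup>2 / (1 + \<bar>C\<bar>) * 1"
      by (intro mult_left_mono) auto
    ultimately show False by linarith
  qed
qed

lemma first_order_maximality:
  fixes a b :: real
  assumes "\<And>t. 2 * t * a + t\<^sup>2 * b \<le> 0"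
  shows "a = 0"
proof (rule ccontr)
  assume "a \<noteq> 0"
  have "2 * (a / (1 + \<bar>b\<bar>)) * a + (a / (1 + \<bar>b\<bar>))\<^sup>2 * b \<le> 0" by (rule assms)
  then have "a\<^sup>2 / (1 + \<bar>b\<bar>) * (2 + b / (1 + \<bar>b\<bar>)) \<le> 0"
    by (simp add: power2_eq_square algebra_simps)
  moreover have "a\<^sup>2 / (1 + \<bar>b\<bar>) > 0" using \<open>a \<noteq> 0\<close> by (simp add: add_pos_nonneg)
  moreover have "b / (1 + \<bar>b\<bar>) \<ge> - 1" by (simp add: field_simps)
  ultimately show False by (smt (verit) mult_pos_pos)
qed

lemma compact_coordinate_box:
  fixes K :: real
  shows "compact {x :: nat \<Rightarrow> real. \<forall>i. (i \<in> L \<longrightarrow> \<bar>x i\<bar> \<le> K) \<and> (i \<notin> L \<longrightarrow> x i = 0)}"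
proof -
  define S where "S i = (if i \<in> L then {-K..K} else {0::real})" for i :: nat
  have "compactin (product_topology (\<lambda>_. euclideanreal) UNIV) (PiE UNIV S)"
    unfolding compactin_PiE by (auto simp: S_def)
  moreover have "PiE UNIV S = {x. \<forall>i. (i \<in> L \<longrightarrow> \<bar>x i\<bar> \<le> K) \<and> (i \<notin> L \<longrightarrow> x i = 0)}"
    by (auto simp: S_def PiE_UNIV_domain Pi_def abs_le_iff minus_le_iff split: if_splits)
  ultimately show ?thesis by (simp add: euclidean_product_topology)
qed

lemma continuous_on_coordinate [continuous_intros]:
  "continuous_on S (\<lambda>x::nat \<Rightarrow> real. x i)"
  by (rule continuous_on_subset[OF continuous_on_product_coordinates]) auto

lemma continuous_on_bil [continuous_intros]:
  "continuous_on S (\<lambda>x. bil n Q x x)"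
  unfolding bil_def by (intro continuous_intros)

text \<open>Let \<open>c\<close> be a cubic form and \<open>M = c(v, \<cdot>, \<cdot>)\<close>. Symmetry of \<open>c\<close> makes the \<open>i\<close>-th entry of \<open>Mx\<close>
  equal to \<open>c(e\<^sub>i, v, x)\<close>, so the hypothesis on the slices reads
  \<open>c(e\<^sub>i, x, x) (Mv)\<^sub>i \<le> (Mx)\<^sub>i\<^sup>2\<close>. With the weights \<open>W\<^sub>i = (Mv)\<^sub>i / v\<^sub>i\<close> the operator \<open>W\<^sup>-\<^sup>1M\<close> is self-adjoint for
  the inner product given by \<open>W\<close> and fixes \<open>v\<close>, and summing the slices shows that its eigenvalues satisfy \<open>\<theta> \<le> \<theta>\<^sup>2\<close>. As \<open>M\<close> has
  nonnegative entries, \<open>1\<close> is the largest eigenvalue, and connectedness makes it simple; so every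
  eigenvalue other than this one is at most \<open>0\<close>. Instead of the spectral theorem, the proof
  uses a maximiser of \<open>x\<^sup>TMx\<close> on the unit sphere of the hyperplane orthogonal to \<open>v\<close>.\<close>
theorem lorentz_trickle_down:
  fixes c :: "nat \<Rightarrow> nat \<Rightarrow> nat \<Rightarrow> real" and v :: "nat \<Rightarrow> real" and n :: nat
  defines "M \<equiv> \<lambda>i j. \<Sum>k<n. v k * c k i j"
  assumes sym1: "\<And>i j k. c i j k = c j i k" and sym2: "\<And>i j k. c i j k = c i k j"
    and nonneg: "\<And>i j k. c i j k \<ge> 0" and v: "\<And>i. v i > 0"
    and lorentz: "\<And>k. k < n \<Longrightarrow> lorentz n (c k)"
    and conn: "\<And>X. X \<subseteq> {..<n} \<Longrightarrow> (\<forall>i\<in>X. \<forall>j\<in>{..<n}-X. M i j = 0) \<Longrightarrow>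
       (\<forall>i\<in>X. \<forall>j<n. M i j = 0) \<or> (\<forall>i\<in>{..<n}-X. \<forall>j<n. M i j = 0)"
  shows "lorentz n M"
proof -
  have Msym: "M i j = M j i" for i j unfolding M_def using sym2 by auto
  have Mnn: "M i j \<ge> 0" for i j
    unfolding M_def using nonneg v by (intro sum_nonneg mult_nonneg_nonneg) (auto intro: less_imp_le)
  define m where "m i = (\<Sum>j<n. v j * M i j)" for i
  define l where "l y = (\<Sum>i<n. m i * y i)" for y
  have m_nn: "m i \<ge> 0" for i unfolding m_def
    using Mnn v by (intro sum_nonneg mult_nonneg_nonneg) (auto intro: less_imp_le)
  have row: "(\<Sum>j<n. x j * M i j) = bil n (c i) v x" for x i
  proof -
    have "(\<Sum>j<n. x j * M i j) = (\<Sum>j<n. \<Sum>k<n. v k * x j * c i k j)"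
      unfolding M_def by (intro sum.cong refl) (simp add: sum_distrib_left sym1[of i] mult_ac)
    then show ?thesis unfolding bil_def by (subst sum.swap) simp
  qed
  have mbil: "m i = bil n (c i) v v" for i by (simp add: m_def row)
  have Mbil: "bil n M x x = (\<Sum>i<n. v i * bil n (c i) x x)" for x
  proof -
    have "bil n M x x = (\<Sum>i<n. \<Sum>j<n. \<Sum>k<n. v k * (x i * x j * c k i j))"
      unfolding bil_def M_def by (simp add: sum_distrib_left mult_ac)
    also have "\<dots> = (\<Sum>i<n. \<Sum>k<n. \<Sum>j<n. v k * (x i * x j * c k i j))"
      by (intro sum.cong refl sum.swap)
    also have "\<dots> = (\<Sum>k<n. \<Sum>i<n. \<Sum>j<n. v k * (x i * x j * c k i j))"
      by (subst sum.swap) simp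
    finally show ?thesis by (simp add: bil_def sum_distrib_left)
  qed
  have lM: "bil n M x v = l x" for x
    by (simp add: bil_row l_def m_def mult.commute)
  (* Variables with (Mv)_i = 0 have zero rows. They are set aside, because W is
     definite only on the remaining ones. *)
  define L where "L = {i. i < n \<and> m i > 0}"
  have fL: "finite L" by (auto simp: L_def)
  have zero: "M i j = 0" if "i < n" "j < n" "i \<notin> L" for i j
  proof -
    have "m i = 0" using that m_nn[of i] by (auto simp: L_def)
    then have "v j * M i j = 0" unfolding m_def
      using that Mnn v by (subst (asm) sum_nonneg_eq_0_iff) (auto simp: less_imp_le)
    then show ?thesis using v[of j] by simp
  qed
  have zero': "M i j = 0" if "i < n" "j < n" "j \<notin> L" for i j
    using zero[OF that(2,1,3)] Msym by simp
  have zero_c: "c i j k = 0" if "i < n" "j < n" "k < n" "i \<notin> L" for i j k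
  proof -
    have "(\<Sum>k<n. v k * c k i j) = 0" using zero[OF that(1,2,4)] by (simp add: M_def)
    then have "v k * c k i j = 0"
      using that nonneg v by (subst (asm) sum_nonneg_eq_0_iff) (auto simp: less_imp_le)
    then show ?thesis using v[of k] sym1 sym2 by (metis less_numeral_extra(3) mult_eq_0_iff)
  qed
  define W where "W i = m i / v i" for i
  have Wpos: "W i > 0" if "i \<in> L" for i using that v[of i] by (auto simp: W_def L_def)
  define G where "G x y = (\<Sum>i\<in>L. W i * x i * y i)" for x y
  show ?thesis
  proof (rule lorentz_if_negative_on_hyperplane[where l = l])
    show "M i j = M j i" for i j by (rule Msym)
    show "l (\<lambda>i. a * x i + b * y i) = a * l x + b * l y" for a x b y
      by (simp add: l_def algebra_simps sum.distrib sum_distrib_left)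
    fix y assume ly: "l y = 0"
    show "bil n M y y \<le> 0"
    proof (rule ccontr)
      assume "\<not> bil n M y y \<le> 0"
      then have ypos: "bil n M y y > 0" by simp
      define R where "R x = (\<lambda>i. if i \<in> L then x i else 0 :: real)" for x
      have RM: "bil n M (R x) (R z) = bil n M x z" for x z
        unfolding bil_def R_def using zero zero' by (intro sum.cong refl) auto
      have RM1: "bil n M x (R z) = bil n M x z" for x z
        unfolding bil_def R_def using zero zero' by (intro sum.cong refl) auto
      have Rl: "l (R x) = l x" for x
        unfolding l_def R_def using m_nn by (intro sum.cong refl) (auto simp: L_def not_less dest: order.antisym)
      define S where "S = {x. (\<forall>i. i \<notin> L \<longrightarrow> x i = 0) \<and> G x x = 1 \<and> l x = 0}"
      have G_zero: "x i = 0" if "G x x = 0" "i \<in> L" for x i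
      proof -
        have "W i * x i * x i = 0" using that fL Wpos unfolding G_def
          by (subst (asm) sum_nonneg_eq_0_iff) (auto simp: less_imp_le mult.assoc)
        then show ?thesis using Wpos[OF that(2)] by simp
      qed
      have Gnn: "G x x \<ge> 0" for x unfolding G_def
        using Wpos by (intro sum_nonneg) (simp add: mult.assoc less_imp_le)
      have scale: "bil n M (\<lambda>i. a * x i) (\<lambda>i. a * x i) = a\<^sup>2 * bil n M x x"
        "G (\<lambda>i. a * x i) (\<lambda>i. a * x i) = a\<^sup>2 * G x x" "l (\<lambda>i. a * x i) = a * l x" for a x
        by (simp_all add: bil_def G_def l_def sum_distrib_left power2_eq_square mult_ac)
      have normalise: "\<exists>a. a\<^sup>2 * G w w = 1 \<and> (\<lambda>i. a * w i) \<in> S"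
        if "\<forall>i. i \<notin> L \<longrightarrow> w i = 0" "l w = 0" "G w w \<noteq> 0" for w
      proof -
        have "(1 / sqrt (G w w))\<^sup>2 * G w w = 1"
          using that(3) Gnn[of w] by (simp add: power_divide)
        then show ?thesis using that scale[of "1 / sqrt (G w w)" w]
          by (intro exI[of _ "1 / sqrt (G w w)"]) (simp add: S_def)
      qed
      have "compact S"
      proof -
        define K where "K = 1 + (\<Sum>i\<in>L. 1 / W i)"
        have "\<bar>x i\<bar> \<le> K" if "x \<in> S" "i \<in> L" for x i
        proof -
          have "W i * x i * x i \<le> G x x" unfolding G_def using that fL Wpos
            by (intro member_le_sum) (auto simp: mult.assoc less_imp_le)
          then have "(x i)\<^sup>2 \<le> 1 / W i" using that Wpos[of i]
            by (simp add: S_def field_simps power2_eq_square)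
          also have "\<dots> \<le> (\<Sum>i\<in>L. 1 / W i)" using that fL Wpos
            by (intro member_le_sum) (auto simp: less_imp_le)
          finally have sq: "(x i)\<^sup>2 \<le> K - 1" by (simp add: K_def)
          have "(\<bar>x i\<bar> - 1)\<^sup>2 \<ge> 0" by simp
          then have "2 * \<bar>x i\<bar> \<le> 1 + (x i)\<^sup>2" by (simp add: power2_eq_square algebra_simps)
          with sq show ?thesis by (smt (verit) zero_le_power2)
        qed
        then have sub: "S = {x. \<forall>i. (i \<in> L \<longrightarrow> \<bar>x i\<bar> \<le> K) \<and> (i \<notin> L \<longrightarrow> x i = 0)} \<inter> {x. G x x = 1 \<and> l x = 0}"
          by (auto simp: S_def)
        have "closed {x. G x x = 1 \<and> l x = 0}"
          unfolding G_def l_def by (intro closed_Collect_conj closed_Collect_eq continuous_intros)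
        then show ?thesis unfolding sub by (intro compact_Int_closed compact_coordinate_box)
      qed
      moreover obtain a where a: "(\<lambda>i. a * R y i) \<in> S" "a\<^sup>2 * G (R y) (R y) = 1"
      proof -
        have "G (R y) (R y) \<noteq> 0"
        proof
          assume "G (R y) (R y) = 0"
          then have "R y i = 0" for i using G_zero[of "R y" i] by (cases "i \<in> L") (auto simp: R_def)
          then have "bil n M (R y) (R y) = 0" by (simp add: bil_def)
          then show False using RM ypos by simp
        qed
        then show ?thesis using normalise[of "R y"] Rl ly that by (auto simp: R_def)
      qed
      ultimately obtain x where x: "x \<in> S" and max: "\<And>z. z \<in> S \<Longrightarrow> bil n M z z \<le> bil n M x x"
        using continuous_attains_sup[of S "\<lambda>x. bil n M x x"] continuous_on_bil by blast
      define \<theta> where "\<theta> = bil n M x x"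
      have Gx: "G x x = 1" and lx: "l x = 0" and xL: "\<And>i. i \<notin> L \<Longrightarrow> x i = 0" using x by (auto simp: S_def)
      have "\<theta> \<ge> a\<^sup>2 * bil n M (R y) (R y)" using max[OF a(1)] scale(1)[of a "R y"] by (simp add: \<theta>_def)
      moreover have "a \<noteq> 0" using a(2) by auto
      ultimately have thpos: "\<theta> > 0" using ypos RM by (smt (verit) mult_pos_pos zero_less_power2)
      have bound: "bil n M w w \<le> \<theta> * G w w" if w: "\<forall>i. i \<notin> L \<longrightarrow> w i = 0" "l w = 0" for w
      proof (cases "G w w = 0")
        case True
        then have "w i = 0" for i using G_zero[of w i] w by (cases "i \<in> L") auto
        then show ?thesis using True by (simp add: bil_def)
      next
        case False
        then obtain a where a: "a\<^sup>2 * G w w = 1" "(\<lambda>i. a * w i) \<in> S" using normalise[OF w] by blast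
        have "a\<^sup>2 * bil n M w w \<le> \<theta> * (a\<^sup>2 * G w w)" using max[OF a(2)] scale(1)[of a w] a(1)
          by (simp add: \<theta>_def)
        moreover have "a\<^sup>2 > 0" using a(1) by (metis mult_zero_left zero_less_power2 zero_neq_one zero_power2)
        ultimately show ?thesis by (simp add: mult.left_commute)
      qed
      have crit: "bil n M x w = \<theta> * G x w" if w: "\<forall>i. i \<notin> L \<longrightarrow> w i = 0" "l w = 0" for w
      proof -
        have "2 * t * (bil n M x w - \<theta> * G x w) + t\<^sup>2 * (bil n M w w - \<theta> * G w w) \<le> 0" for t
        proof -
          have "l (\<lambda>i. 1 * x i + t * w i) = 0" using w lx
            by (simp add: l_def algebra_simps sum.distrib sum_distrib_left[symmetric])
          then have "bil n M (\<lambda>i. 1 * x i + t * w i) (\<lambda>i. 1 * x i + t * w i)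
              \<le> \<theta> * G (\<lambda>i. 1 * x i + t * w i) (\<lambda>i. 1 * x i + t * w i)"
            using w xL by (intro bound) auto
          moreover have "G (\<lambda>i. 1 * x i + t * w i) (\<lambda>i. 1 * x i + t * w i) = G x x + 2 * t * G x w + t\<^sup>2 * G w w"
            by (simp add: G_def sum.distrib sum_distrib_left power2_eq_square algebra_simps)
          ultimately show ?thesis unfolding bil_quadratic[of n M, OF Msym] using Gx
            by (simp add: \<theta>_def algebra_simps)
        qed
        then show ?thesis using first_order_maximality by (metis eq_iff_diff_eq_0)
      qed
      have lv: "l v > 0"
      proof (rule ccontr)
        assume "\<not> l v > 0"
        then have "l v = 0" using m_nn v by (auto simp: l_def not_less less_imp_le intro!: antisym sum_nonneg mult_nonneg_nonneg)
        then have mv: "m i * v i = 0" if "i < n" for i using that m_nn v unfolding l_def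
          by (subst (asm) sum_nonneg_eq_0_iff) (auto simp: less_imp_le)
        have "m i = 0" if "i < n" for i using mv[OF that] v[of i] by simp
        then have "L = {}" by (auto simp: L_def)
        then show False using Gx by (simp add: G_def)
      qed
      have eigen: "(\<Sum>j<n. x j * M i j) = \<theta> * (W i * x i)" if i: "i \<in> L" for i
      proof -
        define e where "e j = (if j = i then 1 else 0 :: real)" for j
        define w where "w j = 1 * e j + (- (m i / l v)) * R v j" for j
        have le: "l e = m i" using i by (simp add: l_def e_def L_def if_distrib cong: if_cong)
        have lR: "l (R v) = l v" by (rule Rl)
        have "l w = l e + (- (m i / l v)) * l (R v)"
          unfolding w_def l_def by (simp add: algebra_simps sum.distrib sum_subtractf sum_distrib_left sum_divide_distrib)
        then have lw: "l w = 0" using le lR lv by simp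
        have "\<forall>j. j \<notin> L \<longrightarrow> w j = 0" using i by (auto simp: w_def e_def R_def)
        from crit[OF this lw] have "bil n M x w = \<theta> * G x w" .
        moreover have "bil n M x w = bil n M x e"
          unfolding w_def[abs_def] bil_lin_right by (simp add: RM1 lM lx)
        moreover have "bil n M x e = (\<Sum>j<n. x j * M i j)"
        proof -
          have "(\<Sum>j<n. e j * M k j) = M k i" for k
          proof -
            have "(\<Sum>j<n. e j * M k j) = (\<Sum>j<n. if j = i then M k j else 0)"
              by (intro sum.cong refl) (simp add: e_def)
            then show ?thesis using i by (simp add: L_def)
          qed
          then show ?thesis by (simp add: bil_row Msym[of _ i])
        qed
        moreover have "G x w = W i * x i"
        proof -
          have "G x (R v) = l x"
          proof -
            have "G x (R v) = (\<Sum>j\<in>L. m j * x j)" unfolding G_def R_def W_def using v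
              by (intro sum.cong refl) (simp add: less_imp_neq[symmetric])
            also have "\<dots> = l x" unfolding l_def using xL by (intro sum.mono_neutral_left) (auto simp: L_def)
            finally show ?thesis .
          qed
          moreover have "G x e = W i * x i" using i fL by (simp add: G_def e_def if_distrib cong: if_cong)
          moreover have "G x w = G x e + (- (m i / l v)) * G x (R v)"
            unfolding w_def G_def by (simp add: algebra_simps sum.distrib sum_subtractf sum_negf sum_distrib_left sum_divide_distrib)
          ultimately show ?thesis by (simp add: lx)
        qed
        ultimately show ?thesis by simp
      qed
      (* the slice inequalities, summed with the weights v_i, give theta \<le> theta^2 *)
      have ge1: "\<theta> \<ge> 1"
      proof -
        have "\<theta> = (\<Sum>i\<in>L. v i * bil n (c i) x x)"
          unfolding \<theta>_def Mbil using zero_c by (intro sum.mono_neutral_right) (auto simp: L_def bil_def)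
        also have "\<dots> \<le> (\<Sum>i\<in>L. \<theta>\<^sup>2 * (W i * x i * x i))"
        proof (rule sum_mono)
          fix i assume i: "i \<in> L"
          then have mi: "m i > 0" and "i < n" by (auto simp: L_def)
          then have "m i * bil n (c i) x x \<le> (bil n (c i) v x)\<^sup>2"
            using lorentz[of i] by (simp add: lorentz_def mbil)
          also have "bil n (c i) v x = \<theta> * (W i * x i)" using eigen[OF i] row by simp
          finally have "v i * bil n (c i) x x \<le> v i * ((\<theta> * (W i * x i))\<^sup>2 / m i)"
            using mi v[of i] by (simp add: field_simps)
          also have "\<dots> = \<theta>\<^sup>2 * (W i * x i * x i)"
            using mi v[of i] by (simp add: W_def power2_eq_square field_simps)
          finally show "v i * bil n (c i) x x \<le> \<theta>\<^sup>2 * (W i * x i * x i)" .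
        qed
        also have "\<dots> = \<theta>\<^sup>2" using Gx by (simp add: G_def sum_distrib_left[symmetric])
        finally show ?thesis using thpos by (simp add: power2_eq_square)
      qed
      (* Since theta \<ge> 1, the Dirichlet form of x/v vanishes, so x/v is constant along the
         edges of M and, by connectedness, x is a multiple of v. *)
      define r where "r i = x i / v i" for i
      have "(\<Sum>i<n. \<Sum>j<n. M i j * v i * v j * (r i - r j)\<^sup>2) = 2 * G x x - 2 * bil n M x x"
      proof -
        have "(\<Sum>i<n. \<Sum>j<n. M i j * v i * v j * (r i)\<^sup>2) = (\<Sum>i<n. m i * (x i / v i) * x i)"
          unfolding m_def sum_distrib_left sum_distrib_right r_def using v
          by (intro sum.cong refl) (simp add: power2_eq_square less_imp_neq[symmetric])
        also have "\<dots> = G x x"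
          unfolding G_def W_def using xL by (intro sum.mono_neutral_cong_right) (auto simp: L_def)
        finally have 1: "(\<Sum>i<n. \<Sum>j<n. M i j * v i * v j * (r i)\<^sup>2) = G x x" .
        have "(\<Sum>i<n. \<Sum>j<n. M i j * v i * v j * (r j)\<^sup>2) = (\<Sum>i<n. \<Sum>j<n. M i j * v i * v j * (r i)\<^sup>2)"
          by (subst sum.swap) (simp add: Msym mult_ac)
        then have 2: "(\<Sum>i<n. \<Sum>j<n. M i j * v i * v j * (r j)\<^sup>2) = G x x" using 1 by simp
        have 3: "bil n M x x = (\<Sum>i<n. \<Sum>j<n. M i j * v i * v j * (r i * r j))"
          unfolding bil_def r_def using v by (intro sum.cong refl) (simp add: less_imp_neq[symmetric])
        have "(\<Sum>i<n. \<Sum>j<n. M i j * v i * v j * (r i - r j)\<^sup>2) =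
           (\<Sum>i<n. \<Sum>j<n. M i j * v i * v j * (r i)\<^sup>2) + (\<Sum>i<n. \<Sum>j<n. M i j * v i * v j * (r j)\<^sup>2)
             - 2 * (\<Sum>i<n. \<Sum>j<n. M i j * v i * v j * (r i * r j))"
          unfolding sum_distrib_left sum.distrib[symmetric] sum_subtractf[symmetric]
          by (intro sum.cong refl) (simp add: power2_eq_square algebra_simps)
        then show ?thesis using 1 2 3 by simp
      qed
      also have "\<dots> \<le> 0" using ge1 Gx by (simp add: \<theta>_def)
      finally have le0: "(\<Sum>i<n. \<Sum>j<n. M i j * v i * v j * (r i - r j)\<^sup>2) \<le> 0" .
      have nn: "M i j * v i * v j * (r i - r j)\<^sup>2 \<ge> 0" for i j
        using Mnn[of i j] v[of i] v[of j] by simp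
      have term0: "M i j * v i * v j * (r i - r j)\<^sup>2 = 0" if "i < n" "j < n" for i j
      proof -
        have "(\<Sum>i<n. \<Sum>j<n. M i j * v i * v j * (r i - r j)\<^sup>2) = 0"
          using le0 nn by (intro antisym sum_nonneg) auto
        then have "(\<Sum>j<n. M i j * v i * v j * (r i - r j)\<^sup>2) = 0"
          using that nn by (subst (asm) sum_nonneg_eq_0_iff) (auto intro!: sum_nonneg)
        then show ?thesis using that nn by (subst (asm) sum_nonneg_eq_0_iff) auto
      qed
      have "L \<noteq> {}" using Gx by (auto simp: G_def)
      then obtain i0 where i0: "i0 \<in> L" by blast
      define X where "X = {i. i < n \<and> i \<in> L \<and> r i = r i0}"
      have "\<forall>i\<in>X. \<forall>j\<in>{..<n}-X. M i j = 0"
      proof (intro ballI)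
        fix i j assume ij: "i \<in> X" "j \<in> {..<n} - X"
        show "M i j = 0"
        proof (cases "j \<in> L")
          case True
          then have "r i \<noteq> r j" using ij by (auto simp: X_def)
          then show ?thesis using term0[of i j] ij v[of i] v[of j] by (auto simp: X_def)
        next
          case False
          then show ?thesis using zero[of j i] ij Msym[of i j] by (auto simp: X_def)
        qed
      qed
      then have "(\<forall>i\<in>X. \<forall>j<n. M i j = 0) \<or> (\<forall>i\<in>{..<n}-X. \<forall>j<n. M i j = 0)"
        by (intro conn) (auto simp: X_def)
      moreover have "\<not> (\<forall>i\<in>X. \<forall>j<n. M i j = 0)"
      proof
        assume "\<forall>i\<in>X. \<forall>j<n. M i j = 0"
        then have "m i0 = 0" using i0 by (auto simp: m_def X_def L_def)
        then show False using i0 by (auto simp: L_def)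
      qed
      ultimately have "\<forall>i\<in>{..<n}-X. \<forall>j<n. M i j = 0" by blast
      then have "m i = 0" if "i < n" "i \<notin> X" for i using that by (simp add: m_def)
      then have "L \<subseteq> X" by (force simp: L_def)
      then have xr: "x i = r i0 * v i" if "i \<in> L" for i
        using that v[of i] by (force simp: X_def r_def field_simps)
      have "l x = r i0 * l v"
      proof -
        have "l x = l (R x)" by (simp add: Rl)
        also have "R x = R (\<lambda>i. r i0 * v i)" using xr by (auto simp: R_def)
        also have "l \<dots> = r i0 * l v" by (simp add: Rl scale(3))
        finally show ?thesis .
      qed
      then have "r i0 = 0" using lx lv by simp
      then have "G x x = 0" using xr by (simp add: G_def)
      then show False using Gx by simp
    qed
  qed
qed

section \<open>Symmetric tensors\<close>

text \<open>A function \<open>T\<close> on exponents stands for the symmetric tensor with entries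
  \<open>T(e\<^sub>i\<^sub>1 + \<dots> + e\<^sub>i\<^sub>k)\<close>. When \<open>T(\<alpha>)\<close> is the derivative of order \<open>\<alpha>\<close> of a polynomial at the origin,
  taking the partial derivative of order \<open>\<beta>\<close> becomes a shift of the argument by \<open>\<beta>\<close>, and the
  derivative in direction \<open>v\<close> becomes contraction with \<open>v\<close>.\<close>

type_synonym tensor = "(nat \<Rightarrow>\<^sub>0 nat) \<Rightarrow> real"

definition unit_exp :: "nat \<Rightarrow> nat \<Rightarrow>\<^sub>0 nat"
  where "unit_exp i = Poly_Mapping.single i 1"

definition contract :: "nat \<Rightarrow> (nat \<Rightarrow> real) \<Rightarrow> tensor \<Rightarrow> tensor"
  where "contract n v T = (\<lambda>M. \<Sum>i<n. v i * T (M + unit_exp i))"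

abbreviation contracts :: "nat \<Rightarrow> (nat \<Rightarrow> real) list \<Rightarrow> tensor \<Rightarrow> tensor"
  where "contracts n vs \<equiv> fold (contract n) vs"

definition shift :: "(nat \<Rightarrow>\<^sub>0 nat) \<Rightarrow> tensor \<Rightarrow> tensor"
  where "shift \<beta> T = (\<lambda>M. T (M + \<beta>))"

definition hess :: "tensor \<Rightarrow> nat \<Rightarrow> nat \<Rightarrow> real"
  where "hess T = (\<lambda>i j. T (unit_exp i + unit_exp j))"

text \<open>The tensors of homogeneous polynomials of degree \<open>d\<close> in \<open>n\<close> variables with nonnegative
  coefficients.\<close>
definition nonneg_form :: "nat \<Rightarrow> nat \<Rightarrow> tensor \<Rightarrow> bool"
  where "nonneg_form n d T \<longleftrightarrow> (\<forall>M. T M \<ge> 0) \<and>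
    (\<forall>M. T M \<noteq> 0 \<longrightarrow> keys M \<subseteq> {..<n} \<and> mdegree M = d)"

lemma keys_add_nat: "keys (\<alpha> + \<beta> :: nat \<Rightarrow>\<^sub>0 nat) = keys \<alpha> \<union> keys \<beta>"
  by (auto simp: in_keys_iff lookup_add)

lemma keys_unit_exp [simp]: "keys (unit_exp i) = {i}"
  by (simp add: unit_exp_def)

lemma lookup_unit_exp: "lookup (unit_exp i) j = (if i = j then 1 else 0)"
  by (simp add: unit_exp_def lookup_single when_def)

lemma mdegree_superset:
  assumes "finite A" "keys \<alpha> \<subseteq> A"
  shows "mdegree \<alpha> = (\<Sum>i\<in>A. lookup \<alpha> i)"
  unfolding mdegree_def using assms by (intro sum.mono_neutral_left) (auto simp: in_keys_iff)

lemma mdegree_0 [simp]: "mdegree 0 = 0"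
  by (simp add: mdegree_def)

lemma mdegree_unit_exp [simp]: "mdegree (unit_exp i) = 1"
  by (simp add: mdegree_def lookup_unit_exp)

lemma mdegree_add: "mdegree (\<alpha> + \<beta>) = mdegree \<alpha> + mdegree \<beta>"
  using mdegree_superset[of "keys \<alpha> \<union> keys \<beta>" \<alpha>]
    mdegree_superset[of "keys \<alpha> \<union> keys \<beta>" \<beta>]
    mdegree_superset[of "keys \<alpha> \<union> keys \<beta>" "\<alpha> + \<beta>"]
  by (simp add: keys_add_nat lookup_add sum.distrib)

lemma minus_plus_unit_exp: "lookup \<alpha> i > 0 \<Longrightarrow> \<alpha> - unit_exp i + unit_exp i = \<alpha>"
  by (rule poly_mapping_eqI) (auto simp: lookup_add lookup_minus lookup_unit_exp)

lemma mdegree_eq_0_iff: "mdegree \<alpha> = 0 \<longleftrightarrow> \<alpha> = 0"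
  by (auto simp: mdegree_def in_keys_iff poly_mapping_eq_iff fun_eq_iff)

lemma exponent_Suc_obtain:
  assumes "mdegree \<alpha> = Suc k"
  obtains i \<beta> where "\<alpha> = \<beta> + unit_exp i" "mdegree \<beta> = k"
proof -
  have "\<alpha> \<noteq> 0" using assms by auto
  then obtain i where "lookup \<alpha> i > 0"
    by (metis gr0I poly_mapping_eqI lookup_zero)
  then have e: "\<alpha> = (\<alpha> - unit_exp i) + unit_exp i" by (rule minus_plus_unit_exp[symmetric])
  then have "mdegree \<alpha> = mdegree (\<alpha> - unit_exp i) + 1" by (metis mdegree_add mdegree_unit_exp)
  then show ?thesis using assms e by (intro that[of "\<alpha> - unit_exp i" i]) auto
qed

lemma contract_commute: "contract n u (contract n v T) = contract n v (contract n u T)"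
  unfolding contract_def sum_distrib_left
  by (rule ext, subst sum.swap) (simp add: add_ac mult_ac)

lemma contracts_contract: "contracts n vs (contract n v T) = contract n v (contracts n vs T)"
proof (induction vs arbitrary: T)
  case (Cons w vs)
  then show ?case by (simp add: contract_commute[of n w v])
qed simp

lemma contract_pow_contract: "(contract n x ^^ k) (contract n v T) = contract n v ((contract n x ^^ k) T)"
proof (induction k)
  case (Suc k)
  have "(contract n x ^^ Suc k) (contract n v T) = contract n x (contract n v ((contract n x ^^ k) T))"
    using Suc by simp
  also have "\<dots> = contract n v (contract n x ((contract n x ^^ k) T))" by (rule contract_commute)
  finally show ?case by simp
qed simp

lemma contracts_replicate: "contracts n (replicate k x) T = (contract n x ^^ k) T"
  by (induction k) (simp_all add: contract_pow_contract)

lemma contract_shift: "contract n v (shift \<beta> T) = shift \<beta> (contract n v T)"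
  by (simp add: contract_def shift_def add_ac)

lemma contracts_shift: "contracts n vs (shift \<beta> T) = shift \<beta> (contracts n vs T)"
  by (induction vs arbitrary: T) (simp_all add: contract_shift)

lemma shift_shift: "shift \<alpha> (shift \<beta> T) = shift (\<alpha> + \<beta>) T"
  by (simp add: shift_def add_ac)

lemma contract_scale: "contract n v (\<lambda>M. a * T M) = (\<lambda>M. a * contract n v T M)"
  by (simp add: contract_def sum_distrib_left mult_ac)

lemma contract_pow_scale: "(contract n x ^^ k) (\<lambda>M. a * T M) = (\<lambda>M. a * (contract n x ^^ k) T M)"
  by (induction k) (simp_all add: contract_scale)

lemma bil_hess: "bil n (hess T) x y = contract n x (contract n y T) 0"
  by (simp add: bil_def hess_def contract_def sum_distrib_left mult_ac)

lemma hess_sym: "hess T i j = hess T j i"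
  by (simp add: hess_def add.commute)

lemma contracts_nonneg:
  assumes "\<And>M. T M \<ge> 0" "\<forall>v\<in>set vs. \<forall>i. v i \<ge> 0"
  shows "contracts n vs T M \<ge> 0"
  using assms
proof (induction vs arbitrary: T)
  case (Cons v vs)
  have "contract n v T M \<ge> 0" for M
    unfolding contract_def using Cons.prems by (intro sum_nonneg mult_nonneg_nonneg) auto
  then show ?case using Cons by simp
qed auto

lemma contracts_mono:
  assumes "\<And>M. T M \<ge> 0" "\<And>M. T M \<le> S M" "list_all2 (\<lambda>v w. \<forall>i. 0 \<le> v i \<and> v i \<le> w i) vs ws"
  shows "contracts n vs T M \<le> contracts n ws S M"
  using assms(3,1,2)
proof (induction arbitrary: T S rule: list_all2_induct)
  case (Cons v vs w ws)
  have "contract n v T M \<ge> 0" for M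
    unfolding contract_def using Cons by (intro sum_nonneg mult_nonneg_nonneg) auto
  moreover have "contract n v T M \<le> contract n w S M" for M
    unfolding contract_def using Cons by (intro sum_mono mult_mono) (auto intro: order_trans)
  ultimately show ?case using Cons.IH[of "contract n v T" "contract n w S"] by simp
qed auto

text \<open>Contraction of a nonnegative tensor is a sum without cancellation, in which the entry at
  \<open>M + \<gamma>\<close> occurs with a positive factor.\<close>
lemma contracts_eq_0D:
  assumes "\<And>M. T M \<ge> 0" "\<forall>v\<in>set vs. (\<forall>i. v i \<ge> 0) \<and> (\<forall>i\<in>keys \<gamma>. v i > 0)"
    "contracts n vs T M = 0" "keys \<gamma> \<subseteq> {..<n}" "mdegree \<gamma> = length vs"
  shows "T (M + \<gamma>) = 0"
  using assms
proof (induction vs arbitrary: T \<gamma>)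
  case Nil
  then show ?case by (simp add: mdegree_eq_0_iff)
next
  case (Cons v vs)
  have "mdegree \<gamma> = Suc (length vs)" using Cons.prems(5) by simp
  then obtain i \<beta> where \<beta>: "\<gamma> = \<beta> + unit_exp i" "mdegree \<beta> = length vs"
    by (rule exponent_Suc_obtain)
  have nn: "contract n v T M \<ge> 0" for M
    unfolding contract_def using Cons.prems by (intro sum_nonneg mult_nonneg_nonneg) auto
  have i: "i < n" "v i > 0" using Cons.prems \<beta> by (auto simp: keys_add_nat)
  have "contract n v T (M + \<beta>) = 0"
  proof (rule Cons.IH)
    show "\<forall>v\<in>set vs. (\<forall>i. v i \<ge> 0) \<and> (\<forall>i\<in>keys \<beta>. v i > 0)"
      using Cons.prems(2) unfolding \<beta>(1) keys_add_nat by simp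
    show "keys \<beta> \<subseteq> {..<n}"
      using Cons.prems(4) unfolding \<beta>(1) keys_add_nat by simp
  qed (use nn \<beta>(2) Cons.prems(3) in simp_all)
  then have "v i * T (M + \<beta> + unit_exp i) = 0" unfolding contract_def
    using Cons.prems(1,2) i(1) by (subst (asm) sum_nonneg_eq_0_iff) auto
  then show ?case using i \<beta> by (simp add: add_ac)
qed

lemma contracts_eq_0I:
  assumes "\<And>\<gamma>. T (M + \<gamma>) = 0"
  shows "contracts n vs T M = 0"
  using assms
proof (induction vs arbitrary: T)
  case Nil
  then show ?case using Nil[of 0] by simp
next
  case (Cons v vs)
  have "contract n v T (M + \<gamma>) = 0" for \<gamma>
    using Cons.prems[of "\<gamma> + unit_exp i" for i] by (simp add: contract_def add_ac)
  then show ?case using Cons.IH by simp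
qed

lemma nonneg_form_shift:
  assumes "nonneg_form n (mdegree \<beta> + r) T"
  shows "nonneg_form n r (shift \<beta> T)"
  using assms by (force simp: nonneg_form_def shift_def mdegree_add keys_add_nat)

section \<open>From the Rayleigh inequality to Lorentzian contractions\<close>

text \<open>For the homogeneous polynomial \<open>p\<close> of degree \<open>r\<close> with tensor \<open>P\<close> this is
  \<open>p \<partial>\<^sub>i\<partial>\<^sub>jp \<le> \<partial>\<^sub>ip \<partial>\<^sub>jp\<close> on the closed orthant: a \<open>k\<close>-fold contraction with \<open>x\<close> is \<open>k!\<close> times
  the value at \<open>x\<close> of the corresponding derivative, and \<open>(r - 1) r! (r - 2)! = r ((r - 1)!)\<^sup>2\<close>.\<close>

definition rayleigh :: "nat \<Rightarrow> nat \<Rightarrow> tensor \<Rightarrow> bool"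
  where "rayleigh n r P \<longleftrightarrow> (\<forall>x i j. (\<forall>k. x k \<ge> 0) \<longrightarrow> i < n \<longrightarrow> j < n \<longrightarrow>
    (real r - 1) * (contract n x ^^ r) P 0 * (contract n x ^^ (r - 2)) P (unit_exp i + unit_exp j) \<le>
      r * ((contract n x ^^ (r - 1)) P (unit_exp i) * (contract n x ^^ (r - 1)) P (unit_exp j)))"

text \<open>If no monomial mixes \<open>X\<close> and \<open>Y\<close>, the polynomial is \<open>p\<^sub>X + p\<^sub>Y\<close> with separate variables. At
  \<open>x = a 1\<^sub>X + 1\<^sub>Y\<close> the summed Rayleigh inequality has a left side of order \<open>a\<^sup>r\<^sup>-\<^sup>2\<close> and a right side of
  order \<open>a\<^sup>2\<^sup>r\<^sup>-\<^sup>2\<close>; as \<open>a\<close> tends to \<open>0\<close>, one of the two parts must vanish.\<close>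
lemma rayleigh_connected:
  assumes P: "nonneg_form n r P" and r: "r \<ge> 2" and R: "rayleigh n r P"
    and X: "X \<subseteq> {..<n}" and Y: "Y = {..<n} - X"
    and sep: "\<And>i j \<gamma>. i \<in> X \<Longrightarrow> j \<in> Y \<Longrightarrow> P (unit_exp i + unit_exp j + \<gamma>) = 0"
  shows "(\<forall>i\<in>X. \<forall>\<gamma>. P (unit_exp i + \<gamma>) = 0) \<or> (\<forall>i\<in>Y. \<forall>\<gamma>. P (unit_exp i + \<gamma>) = 0)"
proof -
  define u w where "u i = (if i \<in> X then 1 else 0 :: real)" and "w i = (if i \<in> Y then 1 else 0 :: real)" for i
  define Fu Fw where "Fu = (contract n u ^^ r) P 0" and "Fw = (contract n w ^^ r) P 0"
  have Pnn: "P M \<ge> 0" for M using P by (simp add: nonneg_form_def)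
  have nn: "Fu \<ge> 0" "Fw \<ge> 0" unfolding Fu_def Fw_def contracts_replicate[symmetric]
    by (rule contracts_nonneg, rule Pnn, simp add: u_def w_def)+
  obtain q where q: "r = Suc (Suc q)" using r by (metis add_2_eq_Suc le_Suc_ex)
  have bound: "(real r - 1) * Fw * Fu \<le> r * a * Fu\<^sup>2" if a: "0 < a" "a \<le> 1" for a :: real
  proof -
    define x where "x i = a * u i + w i" for i
    have x: "x k \<ge> 0" for k using a by (simp add: x_def u_def w_def)
    (* U is the derivative in direction 1_X. It does not involve the variables in Y, so
       contracting it with x amounts to contracting it with a 1_X. *)
    define U where "U = contract n u P"
    have "contract n w U = (\<lambda>M. 0)"
    proof
      fix M
      have "w i * (u j * P (M + unit_exp i + unit_exp j)) = 0" for i j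
        using sep[of j i M] by (auto simp: u_def w_def add_ac)
      then show "contract n w U M = 0"
        unfolding U_def contract_def sum_distrib_left by (intro sum.neutral ballI)
    qed
    then have xU: "contract n x U = (\<lambda>M. a * contract n u U M)"
      by (simp add: contract_def x_def distrib_right sum.distrib fun_eq_iff sum_distrib_left mult.assoc)
    have pow: "(contract n x ^^ k) U = (\<lambda>M. a ^ k * (contract n u ^^ k) U M)" for k
    proof (induction k)
      case (Suc k)
      have "(contract n x ^^ Suc k) U = contract n x (\<lambda>M. a ^ k * (contract n u ^^ k) U M)" using Suc by simp
      also have "\<dots> = (\<lambda>M. a ^ k * (contract n u ^^ k) (contract n x U) M)"
        by (simp add: contract_scale contract_pow_contract)
      also have "\<dots> = (\<lambda>M. a ^ Suc k * (contract n u ^^ Suc k) U M)"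
        by (simp add: xU contract_pow_scale contract_pow_contract mult_ac)
      finally show ?case .
    qed simp
    have sum1: "(\<Sum>i<n. u i * (contract n x ^^ (r - 1)) P (unit_exp i)) = a ^ Suc q * Fu"
    proof -
      have "(\<Sum>i<n. u i * (contract n x ^^ (r - 1)) P (unit_exp i)) = contract n u ((contract n x ^^ (r - 1)) P) 0"
        by (simp add: contract_def)
      also have "\<dots> = (contract n x ^^ (r - 1)) U 0" by (simp add: U_def contract_pow_contract)
      also have "\<dots> = a ^ Suc q * (contract n u ^^ Suc q) U 0"
      proof -
        have "r - 1 = Suc q" using q by simp
        then show ?thesis by (simp only: pow)
      qed
      also have "(contract n u ^^ Suc q) U 0 = Fu" by (simp add: Fu_def U_def q contract_pow_contract)
      finally show ?thesis .
    qed
    have sum2: "(\<Sum>i<n. \<Sum>j<n. u i * u j * (contract n x ^^ (r - 2)) P (unit_exp i + unit_exp j)) = a ^ q * Fu"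
    proof -
      have "(\<Sum>i<n. \<Sum>j<n. u i * u j * (contract n x ^^ (r - 2)) P (unit_exp i + unit_exp j))
          = contract n u (contract n u ((contract n x ^^ q) P)) 0"
        by (simp add: contract_def q sum_distrib_left mult_ac)
      also have "\<dots> = contract n u ((contract n x ^^ q) U) 0" by (simp add: U_def contract_pow_contract)
      also have "\<dots> = a ^ q * contract n u ((contract n u ^^ q) U) 0" by (simp add: pow contract_scale)
      also have "contract n u ((contract n u ^^ q) U) 0 = Fu" by (simp add: Fu_def U_def q contract_pow_contract)
      finally show ?thesis .
    qed
    define Fx where "Fx = (contract n x ^^ r) P 0"
    have "Fw \<le> Fx" unfolding Fx_def Fw_def contracts_replicate[symmetric]
      using a by (intro contracts_mono Pnn order_refl) (auto simp: list_all2_conv_all_nth x_def u_def w_def)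
    have "(real r - 1) * Fx * (a ^ q * Fu) =
       (\<Sum>i<n. \<Sum>j<n. u i * u j * ((real r - 1) * Fx * (contract n x ^^ (r - 2)) P (unit_exp i + unit_exp j)))"
      unfolding sum2[symmetric] by (simp add: sum_distrib_left mult_ac)
    also have "\<dots> \<le> (\<Sum>i<n. \<Sum>j<n. u i * u j *
        (r * ((contract n x ^^ (r - 1)) P (unit_exp i) * (contract n x ^^ (r - 1)) P (unit_exp j))))"
      using R x unfolding rayleigh_def Fx_def
      by (intro sum_mono mult_left_mono) (auto simp: u_def)
    also have "\<dots> = r * ((\<Sum>i<n. u i * (contract n x ^^ (r - 1)) P (unit_exp i)) * (\<Sum>j<n. u j * (contract n x ^^ (r - 1)) P (unit_exp j)))"
      unfolding sum_product by (simp add: sum_distrib_left mult_ac)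
    also have "\<dots> = a ^ q * (r * (a ^ r * Fu\<^sup>2))"
      unfolding sum1 by (simp add: q power2_eq_square mult_ac)
    finally have "a ^ q * ((real r - 1) * Fx * Fu) \<le> a ^ q * (r * (a ^ r * Fu\<^sup>2))"
      by (simp add: mult_ac)
    then have "(real r - 1) * Fx * Fu \<le> r * (a ^ r * Fu\<^sup>2)" using a by simp
    moreover have "(real r - 1) * Fw * Fu \<le> (real r - 1) * Fx * Fu"
      using \<open>Fw \<le> Fx\<close> nn r by (intro mult_right_mono mult_left_mono) auto
    moreover have "a ^ r \<le> a" using a q by (simp add: mult_left_le mult_le_one power_le_one)
    then have "r * (a ^ r * Fu\<^sup>2) \<le> r * (a * Fu\<^sup>2)" by (intro mult_left_mono mult_right_mono) auto
    ultimately show ?thesis by (simp add: mult_ac)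
  qed
  have "Fu = 0 \<or> Fw = 0"
  proof (rule ccontr)
    assume "\<not> ?thesis"
    then have p: "Fu > 0" "Fw > 0" using nn by auto
    define a where "a = min 1 (Fw * (real r - 1) / (2 * r * Fu))"
    have a: "0 < a" "a \<le> 1" using p r by (auto simp: a_def)
    have "a \<le> Fw * (real r - 1) / (2 * r * Fu)" by (simp add: a_def)
    then have "2 * (r * a * Fu) \<le> (real r - 1) * Fw" using p r by (simp add: field_simps)
    moreover have "(real r - 1) * Fw * Fu \<le> (r * a * Fu) * Fu"
      using bound[OF a] by (simp add: power2_eq_square mult_ac)
    then have "(real r - 1) * Fw \<le> r * a * Fu" using p by simp
    moreover have "r * a * Fu > 0" using a p r by simp
    ultimately show False by linarith
  qed
  moreover have *: "P (unit_exp i + \<gamma>) = 0" if Z: "(contract n z ^^ r) P 0 = 0" "z = (\<lambda>i. if i \<in> Z then 1 else 0)" "i \<in> Z"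
    and sepZ: "\<And>i j \<gamma>. i \<in> Z \<Longrightarrow> j \<in> {..<n} - Z \<Longrightarrow> P (unit_exp i + unit_exp j + \<gamma>) = 0" for z Z i \<gamma>
  proof (rule ccontr)
    assume ne: "P (unit_exp i + \<gamma>) \<noteq> 0"
    then have k: "keys (unit_exp i + \<gamma>) \<subseteq> {..<n}" "mdegree (unit_exp i + \<gamma>) = r"
      using P by (auto simp: nonneg_form_def)
    have "keys (unit_exp i + \<gamma>) \<subseteq> Z"
    proof (rule ccontr)
      assume "\<not> ?thesis"
      then obtain j where j: "j \<in> keys \<gamma>" "j \<notin> Z" using Z by (auto simp: keys_add_nat)
      then have "\<gamma> = unit_exp j + (\<gamma> - unit_exp j)"
        using minus_plus_unit_exp[of \<gamma> j] by (simp add: in_keys_iff add.commute)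
      then have "unit_exp i + \<gamma> = unit_exp i + unit_exp j + (\<gamma> - unit_exp j)" by (metis add.assoc)
      then show False using ne sepZ[of i j "\<gamma> - unit_exp j"] Z j k by (auto simp: keys_add_nat)
    qed
    then have "P (0 + (unit_exp i + \<gamma>)) = 0"
      using Z k Pnn by (intro contracts_eq_0D[where vs = "replicate r z" and n = n and T = P]) (auto simp: contracts_replicate)
    then show False using ne by simp
  qed
  have "(\<forall>i\<in>X. \<forall>\<gamma>. P (unit_exp i + \<gamma>) = 0)" if "Fu = 0"
    using *[of u X] that sep Y by (auto simp: Fu_def u_def[abs_def])
  moreover have "(\<forall>i\<in>Y. \<forall>\<gamma>. P (unit_exp i + \<gamma>) = 0)" if "Fw = 0"
  proof -
    have "P (unit_exp i + unit_exp j + \<gamma>) = 0" if "i \<in> Y" "j \<in> {..<n} - Y" for i j \<gamma>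
      using sep[of j i \<gamma>] that X Y by (auto simp: add_ac)
    then show ?thesis using *[of w Y] that by (auto simp: Fw_def w_def[abs_def])
  qed
  ultimately show ?thesis by blast
qed

text \<open>If \<open>Q\<^sub>i\<^sub>j > 0\<close> and \<open>x\<^sup>TQx > 0\<close>, the inequality forbids \<open>(Qx)\<^sub>i = 0\<close>; hence \<open>Q\<close> is nonpositive on
  the hyperplane \<open>(Qx)\<^sub>i = 0\<close>.\<close>
lemma lorentz_if_rayleigh_on_edges:
  assumes sym: "\<And>i j. Q i j = Q j i" and nn: "\<And>i j. Q i j \<ge> 0"
    and R: "\<And>x i j. i < n \<Longrightarrow> j < n \<Longrightarrow> Q i j > 0 \<Longrightarrow>
      bil n Q x x * Q i j \<le> 2 * ((\<Sum>k<n. x k * Q i k) * (\<Sum>k<n. x k * Q j k))"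
  shows "lorentz n Q"
proof (cases "\<exists>i<n. \<exists>j<n. Q i j > 0")
  case True
  then obtain i j where ij: "i < n" "j < n" "Q i j > 0" by blast
  show ?thesis
  proof (rule lorentz_if_negative_on_hyperplane[where l = "\<lambda>x. \<Sum>k<n. x k * Q i k"])
    show "Q i j = Q j i" for i j by (rule sym)
    show "(\<Sum>k<n. (a * x k + b * y k) * Q i k) = a * (\<Sum>k<n. x k * Q i k) + b * (\<Sum>k<n. y k * Q i k)"
      for a b x y by (simp add: sum_distrib_left sum.distrib algebra_simps)
    fix y assume "(\<Sum>k<n. y k * Q i k) = 0"
    then have "bil n Q y y * Q i j \<le> 0" using R[OF ij, of y] by simp
    then show "bil n Q y y \<le> 0" using ij by (simp add: mult_le_0_iff)
  qed
next
  case False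
  then have "Q i j = 0" if "i < n" "j < n" for i j using nn[of i j] that by force
  then have "bil n Q u u = 0" for u by (simp add: bil_def)
  then show ?thesis by (simp add: lorentz_def)
qed

lemma lorentz_limit:
  assumes "\<And>\<epsilon>. \<epsilon> > 0 \<Longrightarrow> lorentz n (Q \<epsilon>)" "\<And>i j. ((\<lambda>\<epsilon>. Q \<epsilon> i j) \<longlongrightarrow> Q0 i j) (at_right (0::real))"
  shows "lorentz n Q0"
  unfolding lorentz_def
proof (intro allI impI)
  fix u w assume u: "bil n Q0 u u > 0"
  have lim: "((\<lambda>\<epsilon>. bil n (Q \<epsilon>) x y) \<longlongrightarrow> bil n Q0 x y) (at_right 0)" for x y
    unfolding bil_def by (intro tendsto_intros assms)
  have ev: "eventually (\<lambda>\<epsilon>. bil n (Q \<epsilon>) u u > 0) (at_right 0)"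
    using order_tendstoD(1)[OF lim u] .
  have pos: "eventually (\<lambda>\<epsilon>::real. \<epsilon> > 0) (at_right 0)" by (simp add: eventually_at_right_less)
  have "eventually (\<lambda>\<epsilon>. bil n (Q \<epsilon>) u u * bil n (Q \<epsilon>) w w \<le> (bil n (Q \<epsilon>) u w)\<^sup>2) (at_right 0)"
    using ev pos by eventually_elim (use assms(1) in \<open>auto simp: lorentz_def\<close>)
  then show "bil n Q0 u u * bil n Q0 w w \<le> (bil n Q0 u w)\<^sup>2"
    by (intro tendsto_le[OF _ tendsto_power[OF lim] tendsto_mult[OF lim lim]]) auto
qed

lemma contracts_perturb_tendsto:
  assumes "\<And>M. ((\<lambda>\<epsilon>. T \<epsilon> M) \<longlongrightarrow> T0 M) (at_right (0::real))"
  shows "((\<lambda>\<epsilon>. contracts n (map (\<lambda>v i. v i + \<epsilon>) vs) (T \<epsilon>) M) \<longlongrightarrow> contracts n vs T0 M) (at_right 0)"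
  using assms
proof (induction vs arbitrary: T T0)
  case (Cons v vs)
  have "((\<lambda>\<epsilon>. contract n (\<lambda>i. v i + \<epsilon>) (T \<epsilon>) M) \<longlongrightarrow> contract n (\<lambda>i. v i) T0 M) (at_right 0)" for M
    unfolding contract_def by (rule tendsto_eq_intros Cons.prems refl | simp)+
  then show ?case using Cons.IH by simp
qed simp

text \<open>Induction on the number of directions that are not coordinate directions. Converting one
  coordinate direction into a positive direction \<open>v\<close> is the trickle-down step; as all
  directions in use are positive, the contracted matrix has a zero entry at \<open>(i, j)\<close> only if \<open>\<partial>\<^sub>i\<partial>\<^sub>j\<close>
  kills the polynomial before contraction, for which connectedness is known. Nonnegative directions are limits of
  positive ones.\<close>
theorem lorentz_contracts:
  assumes T: "nonneg_form n d T"
    and R: "\<And>\<beta> r. keys \<beta> \<subseteq> {..<n} \<Longrightarrow> mdegree \<beta> + r = d \<Longrightarrow> r \<ge> 2 \<Longrightarrow> rayleigh n r (shift \<beta> T)"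
    and Q: "\<And>\<beta> x i j. keys \<beta> \<subseteq> {..<n} \<Longrightarrow> mdegree \<beta> + 2 = d \<Longrightarrow> i < n \<Longrightarrow> j < n \<Longrightarrow>
       hess (shift \<beta> T) i j > 0 \<Longrightarrow> bil n (hess (shift \<beta> T)) x x * hess (shift \<beta> T) i j \<le>
         2 * ((\<Sum>k<n. x k * hess (shift \<beta> T) i k) * (\<Sum>k<n. x k * hess (shift \<beta> T) j k))"
    and vs: "\<forall>v\<in>set vs. \<forall>i. v i \<ge> 0"
    and \<beta>: "keys \<beta> \<subseteq> {..<n}" "mdegree \<beta> + length vs + 2 = d"
  shows "lorentz n (hess (contracts n vs (shift \<beta> T)))"
  using vs \<beta>
proof (induction "length vs" arbitrary: vs \<beta>)
  case 0
  then have "nonneg_form n 2 (shift \<beta> T)" using T by (intro nonneg_form_shift) simp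
  then have "hess (shift \<beta> T) i j \<ge> 0" for i j by (simp add: hess_def nonneg_form_def)
  then show ?case using Q 0 by (auto intro!: lorentz_if_rayleigh_on_edges hess_sym)
next
  case (Suc k)
  define P where "P = shift \<beta> T"
  define r where "r = k + 3"
  have P: "nonneg_form n r P" 
  proof -
    have "d = mdegree \<beta> + r" using Suc.prems Suc.hyps(2) by (simp add: r_def)
    then show ?thesis unfolding P_def using T by (intro nonneg_form_shift) simp
  qed
  then have Pnn: "P M \<ge> 0" for M by (simp add: nonneg_form_def)
  have strict: "lorentz n (hess (contracts n (v # vs) P))"
    if pos: "\<forall>v\<in>set (v # vs). \<forall>i. v i > 0" and len: "length vs = k" for v vs
  proof -
    define c where "c i j k = contracts n vs P (unit_exp i + unit_exp j + unit_exp k)" for i j k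
    have M: "hess (contracts n (v # vs) P) = (\<lambda>i j. \<Sum>k<n. v k * c k i j)"
    proof -
      have "contracts n (v # vs) P = contract n v (contracts n vs P)" by (simp add: contracts_contract)
      then show ?thesis by (simp add: hess_def c_def contract_def add_ac)
    qed
    show ?thesis unfolding M
    proof (rule lorentz_trickle_down)
      show "c i j k = c j i k" "c i j k = c i k j" for i j k by (simp_all add: c_def add_ac)
      show "c i j k \<ge> 0" for i j k unfolding c_def using pos
        by (intro contracts_nonneg Pnn) (auto simp: less_imp_le)
      show "v i > 0" for i using pos by simp
      show "lorentz n (c k)" if "k < n" for k
      proof -
        have "lorentz n (hess (contracts n vs (shift (unit_exp k + \<beta>) T)))"
          using that Suc.prems Suc.hyps(2) len pos
          by (intro Suc.hyps(1)) (auto simp: keys_add_nat mdegree_add less_imp_le)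
        also have "hess (contracts n vs (shift (unit_exp k + \<beta>) T)) = c k"
          by (intro ext) (simp add: hess_def c_def P_def shift_shift[symmetric] contracts_shift, simp add: shift_def add_ac)
        finally show ?thesis .
      qed
      fix X assume X: "X \<subseteq> {..<n}" "\<forall>i\<in>X. \<forall>j\<in>{..<n} - X. (\<Sum>k<n. v k * c k i j) = 0"
      have eqM: "(\<Sum>k<n. v k * c k i j) = contracts n (v # vs) P (unit_exp i + unit_exp j)" for i j
        using M by (metis hess_def)
      have "P (unit_exp i + unit_exp j + \<gamma>) = 0" if ij: "i \<in> X" "j \<in> {..<n} - X" for i j \<gamma>
      proof (rule ccontr)
        assume ne: "P (unit_exp i + unit_exp j + \<gamma>) \<noteq> 0"
        then have "keys (unit_exp i + unit_exp j + \<gamma>) \<subseteq> {..<n}" "mdegree (unit_exp i + unit_exp j + \<gamma>) = r"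
          using P unfolding nonneg_form_def by blast+
        then have "keys \<gamma> \<subseteq> {..<n}" "mdegree \<gamma> = length (v # vs)"
          using len by (simp_all add: keys_add_nat mdegree_add r_def)
        moreover have "contracts n (v # vs) P (unit_exp i + unit_exp j) = 0" using X ij eqM by metis
        ultimately have "P (unit_exp i + unit_exp j + \<gamma>) = 0"
          using pos Pnn by (intro contracts_eq_0D[where vs = "v # vs" and n = n and T = P]) (auto simp: less_imp_le)
        then show False using ne by simp
      qed
      moreover have "rayleigh n r P" unfolding P_def using Suc.prems Suc.hyps(2) by (intro R) (auto simp: r_def)
      ultimately have "(\<forall>i\<in>X. \<forall>\<gamma>. P (unit_exp i + \<gamma>) = 0) \<or> (\<forall>i\<in>{..<n} - X. \<forall>\<gamma>. P (unit_exp i + \<gamma>) = 0)"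
        using X P by (intro rayleigh_connected) (auto simp: r_def)
      moreover have "contracts n (v # vs) P (unit_exp i + unit_exp j) = 0" if "\<forall>\<gamma>. P (unit_exp i + \<gamma>) = 0" for i j
        using that by (intro contracts_eq_0I) (simp add: add.assoc)
      ultimately show "(\<forall>i\<in>X. \<forall>j<n. (\<Sum>k<n. v k * c k i j) = 0) \<or>
          (\<forall>i\<in>{..<n} - X. \<forall>j<n. (\<Sum>k<n. v k * c k i j) = 0)"
        unfolding eqM by blast
    qed
  qed
  have "lorentz n (hess (contracts n (map (\<lambda>v i. v i + \<epsilon>) vs) P))" if "\<epsilon> > 0" for \<epsilon>
  proof -
    obtain v ws where vs: "vs = v # ws" "length ws = k" using Suc.hyps(2) by (metis length_Suc_conv)
    show ?thesis unfolding vs list.map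
      using Suc.prems(1) that vs by (intro strict) (auto intro: add_nonneg_pos)
  qed
  then show ?case unfolding P_def
    by (rule lorentz_limit) (auto simp: hess_def intro!: contracts_perturb_tendsto)
qed

section \<open>M-convexity of the support\<close>

definition basis_vec :: "nat \<Rightarrow> nat \<Rightarrow> real"
  where "basis_vec i = (\<lambda>j. if j = i then 1 else 0)"

lemma contract_basis_vec: "i < n \<Longrightarrow> contract n (basis_vec i) T = shift (unit_exp i) T"
proof (rule ext)
  fix M assume "i < n"
  have "(\<Sum>j<n. basis_vec i j * T (M + unit_exp j)) = (\<Sum>j<n. if j = i then T (M + unit_exp j) else 0)"
    by (intro sum.cong refl) (simp add: basis_vec_def)
  then show "contract n (basis_vec i) T M = shift (unit_exp i) T M"
    using \<open>i < n\<close> by (simp add: contract_def shift_def)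
qed

lemma contract_pow_shift: "(contract n x ^^ k) (shift \<beta> T) M = (contract n x ^^ k) T (M + \<beta>)"
  unfolding contracts_replicate[symmetric] contracts_shift by (simp add: shift_def)

lemma shift_as_contracts:
  assumes "keys \<gamma> \<subseteq> {..<n}"
  obtains us where "\<forall>u\<in>set us. \<forall>i. u i \<ge> 0" "length us = mdegree \<gamma>" "\<And>T. contracts n us T = shift \<gamma> T"
proof -
  have "\<exists>us. (\<forall>u\<in>set us. \<forall>i. u i \<ge> 0) \<and> length us = mdegree \<gamma> \<and> (\<forall>T. contracts n us T = shift \<gamma> T)"
    using assms
  proof (induction "mdegree \<gamma>" arbitrary: \<gamma>)
    case 0
    then have "\<gamma> = 0" by (simp add: mdegree_eq_0_iff)
    then show ?case by (intro exI[of _ "[]"]) (simp add: shift_def)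
  next
    case (Suc k)
    obtain i \<beta> where \<beta>: "\<gamma> = \<beta> + unit_exp i" "mdegree \<beta> = k" using Suc.hyps(2) exponent_Suc_obtain by metis
    then have i: "i < n" "keys \<beta> \<subseteq> {..<n}" using Suc.prems by (auto simp: keys_add_nat)
    then obtain us where us: "\<forall>u\<in>set us. \<forall>i. u i \<ge> 0" "length us = mdegree \<beta>" "\<forall>T. contracts n us T = shift \<beta> T"
      using Suc.hyps(1)[of \<beta>] \<beta> by auto
    then show ?case using \<beta> i
      by (intro exI[of _ "basis_vec i # us"])
        (auto simp: contract_basis_vec shift_shift mdegree_add, simp add: basis_vec_def)
  qed
  then show ?thesis using that by blast
qed

text \<open>After contracting with the common part \<open>\<gamma>\<close> of \<open>\<alpha>\<close> and \<open>\<beta>\<close> the two exponents have disjoint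
  supports. Let \<open>P\<close> be this contraction, let \<open>u\<close> be the indicator of the variables \<open>j\<close> with
  \<open>\<beta>\<^sub>j > \<alpha>\<^sub>j\<close>, and write \<open>\<alpha> = \<gamma> + \<delta> + e\<^sub>i\<close>. The exchange property for \<open>i\<close> says that
  contracting \<open>\<partial>\<^sup>\<delta>P\<close> with \<open>u\<close> gives a positive number. More generally, contracting \<open>\<partial>\<^sup>\<epsilon>P\<close> completely
  with copies of \<open>u\<close> gives a positive number for every \<open>\<epsilon> \<le> \<delta>\<close>, by induction on \<open>\<epsilon>\<close>: it holds for \<open>\<epsilon> = 0\<close> because of \<open>\<beta>\<close>, and if it failed on adding a variable \<open>k\<close>, then
  \<open>e\<^sub>k\<close> would lie in the radical of the forms obtained by replacing the vectors \<open>u\<close> one after the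
  other by the all-ones vector. Then no monomial could contain \<open>\<epsilon> + e\<^sub>k\<close>, in contradiction to \<open>\<alpha>\<close>.\<close>
theorem M_convex_support:
  assumes T: "nonneg_form n d T"
    and H: "\<And>vs. \<forall>v\<in>set vs. \<forall>i. v i \<ge> 0 \<Longrightarrow> length vs + 2 = d \<Longrightarrow> lorentz n (hess (contracts n vs T))"
  shows "M_convex {\<alpha>. T \<alpha> \<noteq> 0}"
  unfolding M_convex_def
proof (intro ballI allI impI)
  fix \<alpha> \<beta> i
  assume \<alpha>: "\<alpha> \<in> {\<alpha>. T \<alpha> \<noteq> 0}" and \<beta>: "\<beta> \<in> {\<alpha>. T \<alpha> \<noteq> 0}"
    and gt: "lookup \<beta> i < lookup \<alpha> i"
  (* with truncated subtraction this is the componentwise minimum of \<alpha> and \<beta> *)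
  define \<gamma> where "\<gamma> = \<alpha> - (\<alpha> - \<beta>)"
  have ag: "\<alpha> = (\<alpha> - \<beta>) + \<gamma>" and bg: "\<beta> = (\<beta> - \<alpha>) + \<gamma>"
    by (rule poly_mapping_eqI; simp add: \<gamma>_def lookup_add lookup_minus)+
  define \<delta> where "\<delta> = \<alpha> - \<beta> - unit_exp i"
  have di: "\<alpha> - \<beta> = \<delta> + unit_exp i"
    unfolding \<delta>_def using gt by (intro minus_plus_unit_exp[symmetric]) (simp add: lookup_minus)
  define P where "P = shift \<gamma> T"
  define r where "r = Suc (mdegree \<delta>)"
  have da: "keys \<alpha> \<subseteq> {..<n}" "mdegree \<alpha> = d" and db: "keys \<beta> \<subseteq> {..<n}" "mdegree \<beta> = d"
    using T \<alpha> \<beta> by (auto simp: nonneg_form_def)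
  have "mdegree \<alpha> = mdegree (\<alpha> - \<beta>) + mdegree \<gamma>" by (metis ag mdegree_add)
  then have dr: "d = mdegree \<gamma> + r" using da(2) unfolding di r_def mdegree_add by simp
  have gn: "keys \<gamma> \<subseteq> {..<n}"
  proof -
    have "keys \<alpha> = keys (\<alpha> - \<beta>) \<union> keys \<gamma>"
      by (metis ag keys_add_nat)
    then show ?thesis using da by auto
  qed
  have P: "nonneg_form n r P" unfolding P_def using T dr by (intro nonneg_form_shift) simp
  have Pnn: "P M \<ge> 0" for M using P by (simp add: nonneg_form_def)
  have Pa: "P (\<delta> + unit_exp i) \<noteq> 0" 
    using \<alpha> unfolding P_def shift_def di[symmetric] ag[symmetric] by simp
  have Pb: "P (\<beta> - \<alpha>) \<noteq> 0" 
    using \<beta> unfolding P_def shift_def bg[symmetric] by simp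
  obtain us where us: "\<forall>u\<in>set us. \<forall>i. u i \<ge> 0" "length us = mdegree \<gamma>" "\<And>T. contracts n us T = shift \<gamma> T"
    using shift_as_contracts[OF gn] by metis
  have lorentzP: "lorentz n (hess (contracts n vs (shift \<epsilon> P)))"
    if vs: "\<forall>v\<in>set vs. \<forall>i. v i \<ge> 0" "mdegree \<epsilon> + length vs + 2 = r" "keys \<epsilon> \<subseteq> {..<n}" for vs \<epsilon>
  proof -
    obtain ws where ws: "\<forall>u\<in>set ws. \<forall>i. u i \<ge> 0" "length ws = mdegree \<epsilon>" "\<And>T. contracts n ws T = shift \<epsilon> T"
      using shift_as_contracts[OF vs(3)] by metis
    have "lorentz n (hess (contracts n (us @ ws @ vs) T))" using us ws vs dr by (intro H) auto
    then show ?thesis by (simp add: us(3) ws(3) P_def)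
  qed
  define K where "K = keys (\<beta> - \<alpha>)"
  define u where "u j = (if j \<in> K then 1 else 0 :: real)" for j
  define one where "one = (\<lambda>j::nat. 1 :: real)"
  have unn: "u j \<ge> 0" "one j \<ge> 0" for j by (simp_all add: u_def one_def)
  have main: "(contract n u ^^ (r - mdegree \<epsilon>)) P \<epsilon> > 0" if "\<delta> = \<epsilon> + \<epsilon>'" for \<epsilon> \<epsilon>'
    using that
  proof (induction "mdegree \<epsilon>" arbitrary: \<epsilon> \<epsilon>')
    case 0
    then have e: "\<epsilon> = 0" by (simp add: mdegree_eq_0_iff)
    show ?case
    proof (rule ccontr)
      assume "\<not> ?thesis"
      moreover have "(contract n u ^^ r) P 0 \<ge> 0" unfolding contracts_replicate[symmetric]
        by (rule contracts_nonneg) (auto simp: unn Pnn)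
      ultimately have z: "contracts n (replicate r u) P 0 = 0" by (simp add: e contracts_replicate)
      have "keys (\<beta> - \<alpha>) \<subseteq> {..<n}" "mdegree (\<beta> - \<alpha>) = r"
        using P Pb by (auto simp: nonneg_form_def)
      then have "P (0 + (\<beta> - \<alpha>)) = 0" using z
        by (intro contracts_eq_0D[where vs = "replicate r u" and n = n and T = P]) (auto simp: Pnn u_def K_def)
      then show False using Pb by simp
    qed
  next
    case (Suc p)
    obtain k \<epsilon>0 where e0: "\<epsilon> = \<epsilon>0 + unit_exp k" "mdegree \<epsilon>0 = p" using Suc.hyps(2) exponent_Suc_obtain by metis
    define G where "G = shift \<epsilon>0 P"
    have "Suc p \<le> mdegree \<delta>" using Suc.prems Suc.hyps(2) by (simp add: mdegree_add)
    then obtain q where q: "r = p + Suc (Suc q)" unfolding r_def by (metis add_Suc_right le_Suc_ex add_Suc)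
    have kn: "keys (\<delta> + unit_exp i) \<subseteq> {..<n}" "mdegree (\<delta> + unit_exp i) = r"
      using P Pa by (auto simp: nonneg_form_def)
    then have k: "k < n" "keys \<epsilon>0 \<subseteq> {..<n}" using Suc.prems e0 by (auto simp: keys_add_nat)
    have G: "nonneg_form n (Suc (Suc q)) G" unfolding G_def using P q e0 by (intro nonneg_form_shift) simp
    have Gnn: "G M \<ge> 0" for M using G by (simp add: nonneg_form_def)
    have "(contract n u ^^ (r - mdegree \<epsilon>0)) P \<epsilon>0 > 0"
      using Suc.hyps(1)[of \<epsilon>0 "unit_exp k + \<epsilon>'"] e0 Suc.prems by (simp add: add_ac)
    moreover have "r - mdegree \<epsilon>0 = Suc (Suc q)" using q e0 by simp
    ultimately have Gu: "(contract n u ^^ Suc (Suc q)) G 0 > 0"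
      unfolding G_def contract_pow_shift by simp
    have goal: "(contract n u ^^ (r - mdegree \<epsilon>)) P \<epsilon> = (contract n u ^^ Suc q) G (unit_exp k)"
    proof -
      have "r - mdegree \<epsilon> = Suc q" using q e0 by (simp add: mdegree_add)
      then show ?thesis unfolding G_def contract_pow_shift by (simp only: e0(1) add.commute)
    qed
    show ?case
    proof (rule ccontr)
      assume "\<not> ?case"
      moreover have "(contract n u ^^ Suc q) G (unit_exp k) \<ge> 0" unfolding contracts_replicate[symmetric]
        by (rule contracts_nonneg) (auto simp: unn Gnn)
      ultimately have z: "(contract n u ^^ Suc q) G (unit_exp k) = 0" unfolding goal by simp
      have rad: "contracts n (replicate l one @ replicate (Suc q - l) u) G (unit_exp k) = 0" if "l \<le> Suc q" for l
        using that
      proof (induction l)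
        case 0
        then show ?case using z unfolding contracts_replicate[symmetric] by simp
      next
        case (Suc l)
        then obtain q' where q': "q = l + q'" using le_Suc_ex by auto
        define vs where "vs = replicate l one @ replicate q' u"
        define B where "B = contracts n vs G"
        have vs: "\<forall>v\<in>set vs. \<forall>i. v i \<ge> 0" "length vs = q" by (auto simp: vs_def unn q')
        have lorentzB: "lorentz n (hess B)" unfolding B_def G_def
          using vs q e0 k by (intro lorentzP) auto
        have Bnn: "B M \<ge> 0" for M unfolding B_def using vs by (intro contracts_nonneg Gnn) auto
        have a1: "bil n (hess B) u (basis_vec k) = 0"
        proof -
          have "contract n u B (unit_exp k) = contracts n (replicate l one @ replicate (Suc q - l) u) G (unit_exp k)"
            by (simp add: B_def vs_def q' Suc_diff_le contracts_contract contract_pow_contract)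
          also have "\<dots> = 0" using Suc by simp
          finally have "contract n u B (unit_exp k) = 0" .
          then show ?thesis using k by (simp add: bil_hess contract_basis_vec contract_shift) (simp add: shift_def)
        qed
        have a2: "bil n (hess B) u u > 0"
        proof -
          have "contracts n (replicate (Suc (Suc q)) u) G 0 \<le> contracts n (vs @ [u, u]) G 0"
            by (intro contracts_mono) (auto simp: Gnn vs_def q' list_all2_conv_all_nth nth_append nth_Cons u_def one_def split: nat.splits)
          also have "\<dots> = bil n (hess B) u u" by (simp add: bil_hess B_def)
          finally show ?thesis using Gu unfolding contracts_replicate by simp
        qed
        have a3: "bil n (hess B) (basis_vec k) (basis_vec k) \<ge> 0"
          using k Bnn by (simp add: bil_hess contract_basis_vec contract_shift) (simp add: shift_def)
        have "bil n (hess B) (basis_vec k) one = 0"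
          using lorentz_radical[of n "hess B" u "basis_vec k" one, OF hess_sym lorentzB a2 a1 a3] .
        then have "contract n one B (unit_exp k) = 0" using k by (simp add: bil_hess contract_basis_vec contract_shift) (simp add: shift_def)
        moreover have "contracts n (replicate (Suc l) one @ replicate (Suc q - Suc l) u) G = contract n one B"
          by (simp add: B_def vs_def q' contracts_contract contract_pow_contract)
        ultimately show ?case by simp
      qed
      have "contracts n (replicate (Suc q) one) G (unit_exp k) = 0" using rad[of "Suc q"] by simp
      moreover have "\<delta> + unit_exp i = unit_exp k + (\<epsilon>' + unit_exp i) + \<epsilon>0" using Suc.prems e0 by (simp add: add_ac)
      moreover have "mdegree (\<epsilon>' + unit_exp i) = Suc q"
      proof -
        have "mdegree (\<delta> + unit_exp i) = r" by (rule kn)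
        then show ?thesis using Suc.prems e0 q by (simp add: mdegree_add)
      qed
      moreover have "keys (\<epsilon>' + unit_exp i) \<subseteq> {..<n}" using kn Suc.prems by (auto simp: keys_add_nat)
      ultimately have "G (unit_exp k + (\<epsilon>' + unit_exp i)) = 0"
        by (intro contracts_eq_0D[where vs = "replicate (Suc q) one" and n = n and T = G]) (auto simp: Gnn one_def)
      then show False using Pa \<open>\<delta> + unit_exp i = unit_exp k + (\<epsilon>' + unit_exp i) + \<epsilon>0\<close> by (simp add: G_def shift_def)
    qed
  qed
  have "contract n u P \<delta> > 0" using main[of \<delta> 0] by (simp add: r_def)
  then have "(\<Sum>j<n. u j * P (\<delta> + unit_exp j)) \<noteq> 0" by (simp add: contract_def)
  then obtain j where j: "j < n" "u j * P (\<delta> + unit_exp j) \<noteq> 0"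
    using sum.not_neutral_contains_not_neutral by blast
  then have jK: "j \<in> K" "P (\<delta> + unit_exp j) \<noteq> 0" by (auto simp: u_def split: if_splits)
  have "\<alpha> - unit_exp i + unit_exp j = \<delta> + unit_exp j + \<gamma>"
  proof -
    have "\<alpha> = \<delta> + \<gamma> + unit_exp i" using ag di by (metis add.assoc add.commute)
    then have "\<alpha> - unit_exp i = \<delta> + \<gamma>" by (metis add_diff_cancel_right')
    then show ?thesis by (simp add: add_ac)
  qed
  then have "\<alpha> - unit_exp i + unit_exp j \<in> {\<alpha>. T \<alpha> \<noteq> 0}" using jK by (simp add: P_def shift_def)
  moreover have "lookup \<alpha> j < lookup \<beta> j"
    using jK by (simp add: K_def in_keys_iff lookup_minus)
  ultimately show "\<exists>j. lookup \<alpha> j < lookup \<beta> j \<and>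
      \<alpha> - Poly_Mapping.single i 1 + Poly_Mapping.single j 1 \<in> {\<alpha>. T \<alpha> \<noteq> 0}"
    by (auto simp: unit_exp_def)
qed

section \<open>Polynomials and their derivatives at the origin\<close>

definition mfact :: "(nat \<Rightarrow>\<^sub>0 nat) \<Rightarrow> real"
  where "mfact \<alpha> = (\<Prod>i\<in>keys \<alpha>. fact (lookup \<alpha> i))"

text \<open>The factor \<open>\<alpha>!\<close> turns coefficients into derivatives, so that \<open>pderiv_var\<close> acts as a shift.\<close>
definition taylor :: "mpoly \<Rightarrow> tensor"
  where "taylor f = (\<lambda>M. mfact M * lookup f M)"

definition monom_eval :: "(nat \<Rightarrow>\<^sub>0 nat) \<Rightarrow> (nat \<Rightarrow> 'a) \<Rightarrow> 'a :: real_normed_field"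
  where "monom_eval \<alpha> x = (\<Prod>i\<in>keys \<alpha>. x i ^ lookup \<alpha> i)"

lemma mfact_pos: "mfact \<alpha> > 0"
  by (simp add: mfact_def prod_pos)

lemma mfact_superset:
  assumes "finite A" "keys \<alpha> \<subseteq> A"
  shows "mfact \<alpha> = (\<Prod>i\<in>A. fact (lookup \<alpha> i))"
  unfolding mfact_def using assms by (intro prod.mono_neutral_left) (auto simp: in_keys_iff)

lemma mfact_add_unit_exp: "mfact (\<alpha> + unit_exp i) = (lookup \<alpha> i + 1) * mfact \<alpha>"
proof -
  define A where "A = insert i (keys \<alpha>)"
  have A: "finite A" "i \<in> A" by (auto simp: A_def)
  have 1: "mfact (\<alpha> + unit_exp i) = (\<Prod>j\<in>A. fact (lookup (\<alpha> + unit_exp i) j))"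
    by (rule mfact_superset) (auto simp: A_def keys_add_nat)
  have 2: "mfact \<alpha> = (\<Prod>j\<in>A. fact (lookup \<alpha> j))"
    by (rule mfact_superset) (auto simp: A_def)
  have "(\<Prod>j\<in>A - {i}. fact (lookup (\<alpha> + unit_exp i) j) :: real) = (\<Prod>j\<in>A - {i}. fact (lookup \<alpha> j))"
    by (intro prod.cong refl) (auto simp: lookup_add lookup_unit_exp)
  then show ?thesis unfolding 1 2 prod.remove[OF A]
    by (simp add: lookup_add lookup_unit_exp algebra_simps)
qed

lemma monom_eval_superset:
  assumes "finite A" "keys \<alpha> \<subseteq> A"
  shows "monom_eval \<alpha> x = (\<Prod>i\<in>A. x i ^ lookup \<alpha> i)"
  unfolding monom_eval_def using assms by (intro prod.mono_neutral_left) (auto simp: in_keys_iff)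

lemma monom_eval_0 [simp]: "monom_eval 0 x = 1"
  by (simp add: monom_eval_def)

lemma monom_eval_add: "monom_eval (\<alpha> + \<beta>) x = monom_eval \<alpha> x * monom_eval \<beta> x"
  using monom_eval_superset[of "keys \<alpha> \<union> keys \<beta>" \<alpha> x]
    monom_eval_superset[of "keys \<alpha> \<union> keys \<beta>" \<beta> x]
    monom_eval_superset[of "keys \<alpha> \<union> keys \<beta>" "\<alpha> + \<beta>" x]
  by (simp add: keys_add_nat lookup_add power_add prod.distrib)

lemma monom_eval_unit_exp [simp]: "monom_eval (unit_exp i) x = x i"
  by (simp add: monom_eval_def lookup_unit_exp)

lemma meval_monom: "meval f x = (\<Sum>\<alpha>\<in>keys f. of_real (lookup f \<alpha>) * monom_eval \<alpha> x)"
  by (simp add: meval_def monom_eval_def)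

lemma meval_superset:
  assumes "finite A" "keys f \<subseteq> A"
  shows "meval f x = (\<Sum>\<alpha>\<in>A. of_real (lookup f \<alpha>) * monom_eval \<alpha> x)"
  unfolding meval_monom using assms by (intro sum.mono_neutral_left) (auto simp: in_keys_iff)

lemma meval_0 [simp]: "meval 0 x = 0"
  by (simp add: meval_def)

lemma meval_add: "meval (f + g) x = meval f x + meval g x"
proof -
  define A where "A = keys f \<union> keys g"
  have "finite A" "keys f \<subseteq> A" "keys g \<subseteq> A" "keys (f + g) \<subseteq> A"
    using Poly_Mapping.keys_add[of f g] by (auto simp: A_def)
  then show ?thesis by (simp add: meval_superset[of A] lookup_add sum.distrib algebra_simps)
qed

lemma meval_single [simp]: "meval (Poly_Mapping.single \<alpha> c) x = of_real c * monom_eval \<alpha> x"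
  by (subst meval_superset[of "{\<alpha>}"]) auto

lemma meval_sum: "meval (\<Sum>a\<in>A. f a) x = (\<Sum>a\<in>A. meval (f a) x)"
  by (induction A rule: infinite_finite_induct) (auto simp: meval_add)

lemma meval_pderiv_var:
  "meval (pderiv_var i f) x = (\<Sum>\<alpha>\<in>keys f.
     of_real (lookup f \<alpha>) * (of_nat (lookup \<alpha> i) * monom_eval (\<alpha> - unit_exp i) x))"
  by (simp add: pderiv_var_def meval_sum unit_exp_def[symmetric] del: One_nat_def) (simp add: mult_ac)

lemma lookup_pderiv_var:
  "lookup (pderiv_var i f) \<beta> = (lookup \<beta> i + 1) * lookup f (\<beta> + unit_exp i)"
proof -
  have "lookup (pderiv_var i f) \<beta> = (\<Sum>\<alpha>\<in>keys f.
      if \<alpha> - unit_exp i = \<beta> then lookup \<alpha> i * lookup f \<alpha> else 0)"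
    by (simp add: pderiv_var_def lookup_sum lookup_single when_def unit_exp_def)
  also have "\<dots> = (\<Sum>\<alpha>\<in>keys f.
      if \<alpha> = \<beta> + unit_exp i then lookup \<alpha> i * lookup f \<alpha> else 0)"
  proof (intro sum.cong refl)
    fix \<alpha>
    show "(if \<alpha> - unit_exp i = \<beta> then lookup \<alpha> i * lookup f \<alpha> else 0) =
       (if \<alpha> = \<beta> + unit_exp i then lookup \<alpha> i * lookup f \<alpha> else 0)"
      using minus_plus_unit_exp[of \<alpha> i] by (cases "lookup \<alpha> i = 0") auto
  qed
  also have "\<dots> = (lookup \<beta> i + 1) * lookup f (\<beta> + unit_exp i)"
    by (auto simp: sum.delta in_keys_iff lookup_add lookup_unit_exp)
  finally show ?thesis .
qed

lemma taylor_pderiv_var: "taylor (pderiv_var i f) = shift (unit_exp i) (taylor f)"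
  by (rule ext) (simp add: taylor_def shift_def lookup_pderiv_var mfact_add_unit_exp)

lemma taylor_pderiv_funpow: "taylor ((pderiv_var i ^^ k) f) = shift (Poly_Mapping.single i k) (taylor f)"
proof (induction k)
  case (Suc k)
  have "unit_exp i + Poly_Mapping.single i k = Poly_Mapping.single i (Suc k)"
    by (simp add: unit_exp_def single_add[symmetric])
  then show ?case using Suc by (simp add: taylor_pderiv_var shift_shift)
qed (simp add: shift_def)

lemma taylor_pderiv_multi: "taylor (pderiv_multi \<alpha> f) = shift \<alpha> (taylor f)"
proof -
  have "taylor (fold (\<lambda>i. pderiv_var i ^^ lookup \<alpha> i) is f) =
     shift (\<Sum>i\<leftarrow>is. Poly_Mapping.single i (lookup \<alpha> i)) (taylor f)" for "is"
  proof (induction "is" arbitrary: f)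
    case (Cons i "is")
    then show ?case by (simp add: taylor_pderiv_funpow shift_shift add.commute)
  qed (simp add: shift_def)
  moreover have "(\<Sum>i\<leftarrow>sorted_list_of_set (keys \<alpha>). Poly_Mapping.single i (lookup \<alpha> i)) = \<alpha>"
  proof -
    have "(\<Sum>i\<leftarrow>sorted_list_of_set (keys \<alpha>). Poly_Mapping.single i (lookup \<alpha> i)) =
      (\<Sum>i\<in>keys \<alpha>. Poly_Mapping.single i (lookup \<alpha> i))"
      by (subst sum_list_distinct_conv_sum_set) auto
    also have "\<dots> = \<alpha>"
      by (rule poly_mapping_eqI) (auto simp: lookup_sum lookup_single when_def in_keys_iff sum.delta)
    finally show ?thesis .
  qed
  ultimately show ?thesis by (simp add: pderiv_multi_def)
qed

lemma taylor_eq_0_iff: "taylor f \<alpha> = 0 \<longleftrightarrow> lookup f \<alpha> = 0"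
  using mfact_pos[of \<alpha>] by (simp add: taylor_def)

lemma taylor_at_0: "taylor f 0 = lookup f 0"
  by (simp add: taylor_def mfact_def)

lemma polys_iff_taylor: "f \<in> polys n \<longleftrightarrow> (\<forall>\<alpha>. taylor f \<alpha> \<noteq> 0 \<longrightarrow> keys \<alpha> \<subseteq> {..<n})"
  by (auto simp: polys_def taylor_eq_0_iff in_keys_iff)

lemma homog_iff_taylor: "homog d f \<longleftrightarrow> (\<forall>\<alpha>. taylor f \<alpha> \<noteq> 0 \<longrightarrow> mdegree \<alpha> = d)"
  by (auto simp: homog_def taylor_eq_0_iff in_keys_iff)

lemma polys_pderiv_var: "f \<in> polys n \<Longrightarrow> pderiv_var i f \<in> polys n"
  by (fastforce simp: polys_iff_taylor taylor_pderiv_var shift_def keys_add_nat)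

lemma homog_pderiv_var: "homog (Suc d) f \<Longrightarrow> homog d (pderiv_var i f)"
  by (auto simp: homog_iff_taylor taylor_pderiv_var shift_def mdegree_add)

lemma polys_pderiv_multi: "f \<in> polys n \<Longrightarrow> pderiv_multi \<alpha> f \<in> polys n"
  by (fastforce simp: polys_iff_taylor taylor_pderiv_multi shift_def keys_add_nat)

lemma homog_pderiv_multi: "homog (mdegree \<alpha> + d) f \<Longrightarrow> homog d (pderiv_multi \<alpha> f)"
  by (auto simp: homog_iff_taylor taylor_pderiv_multi shift_def mdegree_add)

lemma nonneg_form_taylor:
  assumes "f \<in> polys n" "homog d f" "nonneg_coeffs f"
  shows "nonneg_form n d (taylor f)"
  using assms mfact_pos unfolding nonneg_form_def polys_iff_taylor homog_iff_taylor
  by (auto simp: taylor_def nonneg_coeffs_def less_imp_le)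

lemma meval_homog_0:
  assumes "homog 0 f"
  shows "meval f x = of_real (lookup f 0)"
  by (subst meval_superset[of "{0}"]) (use assms in \<open>auto simp: homog_def mdegree_eq_0_iff\<close>)

lemma euler_identity:
  assumes f: "f \<in> polys n" "homog d f"
  shows "of_nat d * meval f x = (\<Sum>i<n. x i * meval (pderiv_var i f) x)"
proof -
  have "(\<Sum>i<n. x i * meval (pderiv_var i f) x) = (\<Sum>\<alpha>\<in>keys f. \<Sum>i<n.
      of_real (lookup f \<alpha>) * (of_nat (lookup \<alpha> i) * (x i * monom_eval (\<alpha> - unit_exp i) x)))"
    unfolding meval_pderiv_var sum_distrib_left by (subst sum.swap) (simp add: mult_ac)
  also have "\<dots> = (\<Sum>\<alpha>\<in>keys f. \<Sum>i<n.
      of_real (lookup f \<alpha>) * (of_nat (lookup \<alpha> i) * monom_eval \<alpha> x))"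
  proof (intro sum.cong refl)
    fix \<alpha> i
    show "of_real (lookup f \<alpha>) * (of_nat (lookup \<alpha> i) * (x i * monom_eval (\<alpha> - unit_exp i) x)) =
      of_real (lookup f \<alpha>) * (of_nat (lookup \<alpha> i) * monom_eval \<alpha> x)"
    proof (cases "lookup \<alpha> i = 0")
      case False
      then have "monom_eval \<alpha> x = monom_eval (\<alpha> - unit_exp i) x * x i"
        using minus_plus_unit_exp[of \<alpha> i] monom_eval_add[of "\<alpha> - unit_exp i" "unit_exp i" x] by simp
      then show ?thesis by (simp add: mult_ac)
    qed simp
  qed
  also have "\<dots> = (\<Sum>\<alpha>\<in>keys f. of_nat d * (of_real (lookup f \<alpha>) * monom_eval \<alpha> x))"
  proof (intro sum.cong refl)
    fix \<alpha> assume \<alpha>: "\<alpha> \<in> keys f"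
    have "d = (\<Sum>i<n. lookup \<alpha> i)"
      using f \<alpha> mdegree_superset[of "{..<n}" \<alpha>] by (auto simp: homog_def polys_def)
    then have "of_nat d = (\<Sum>i<n. of_nat (lookup \<alpha> i) :: 'a)" by simp
    then show "(\<Sum>i<n. of_real (lookup f \<alpha>) * (of_nat (lookup \<alpha> i) * monom_eval \<alpha> x)) =
      of_nat d * (of_real (lookup f \<alpha>) * monom_eval \<alpha> x)"
      by (simp add: sum_distrib_left sum_distrib_right mult_ac)
  qed
  finally show ?thesis by (simp add: meval_monom sum_distrib_left)
qed

text \<open>Euler's identity, iterated \<open>d\<close> times.\<close>
lemma meval_contract_pow:
  assumes "f \<in> polys n" "homog d f"
  shows "fact d * meval f x = (contract n x ^^ d) (taylor f) 0"
  using assms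
proof (induction d arbitrary: f)
  case 0
  then show ?case by (simp add: meval_homog_0 taylor_at_0)
next
  case (Suc d)
  have "fact (Suc d) * meval f x = fact d * (of_nat (Suc d) * meval f x)" by simp
  also have "\<dots> = (\<Sum>i<n. x i * (fact d * meval (pderiv_var i f) x))"
    unfolding euler_identity[OF Suc.prems] by (simp add: sum_distrib_left mult_ac)
  also have "\<dots> = (\<Sum>i<n. x i * (contract n x ^^ d) (taylor f) (unit_exp i))"
    using Suc by (intro sum.cong refl) (simp add: polys_pderiv_var homog_pderiv_var taylor_pderiv_var contract_pow_shift)
  also have "\<dots> = (contract n x ^^ Suc d) (taylor f) 0" by (simp add: contract_def)
  finally show ?case .
qed

section \<open>Linear substitution preserves the Lorentzian property\<close>

lemma contract_pow_has_derivative: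
  "((\<lambda>t. (contract n (\<lambda>i. x i + t * v i) ^^ k) T M) has_real_derivative
     k * (contract n (\<lambda>i. x i + t * v i) ^^ (k - 1)) (contract n v T) M) (at t)"
proof (induction k arbitrary: M)
  case 0
  then show ?case by simp
next
  case (Suc k)
  define y where "y t = (\<lambda>i. x i + t * v i)" for t
  have IH: "((\<lambda>t. (contract n (y t) ^^ k) T M) has_real_derivative
     k * (contract n (y t) ^^ (k - 1)) (contract n v T) M) (at t)" for M
    using Suc unfolding y_def .
  have step: "(contract n (y t) ^^ Suc k) T M = (\<Sum>i<n. (x i + t * v i) * (contract n (y t) ^^ k) T (M + unit_exp i))" for t
    unfolding funpow.simps o_apply contract_def[of n "y t" "(contract n (y t) ^^ k) T"] by (simp add: y_def)
  have "((\<lambda>t. \<Sum>i<n. (x i + t * v i) * (contract n (y t) ^^ k) T (M + unit_exp i)) has_real_derivative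
     (\<Sum>i<n. (x i + t * v i) * (k * (contract n (y t) ^^ (k - 1)) (contract n v T) (M + unit_exp i))
        + v i * (contract n (y t) ^^ k) T (M + unit_exp i))) (at t)"
    by ((rule derivative_eq_intros IH refl | simp)+, simp add: mult_ac add_ac)
  also have "(\<lambda>t. \<Sum>i<n. (x i + t * v i) * (contract n (y t) ^^ k) T (M + unit_exp i)) = (\<lambda>t. (contract n (y t) ^^ Suc k) T M)"
    unfolding step ..
  also have "(\<Sum>i<n. (x i + t * v i) * (k * (contract n (y t) ^^ (k - 1)) (contract n v T) (M + unit_exp i))
        + v i * (contract n (y t) ^^ k) T (M + unit_exp i)) =
      k * contract n (y t) ((contract n (y t) ^^ (k - 1)) (contract n v T)) M + contract n v ((contract n (y t) ^^ k) T) M"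
    unfolding sum.distrib contract_def[of n "y t" "(contract n (y t) ^^ (k - 1)) (contract n v T)"]
      contract_def[of n v "(contract n (y t) ^^ k) T"]
    by (simp add: y_def sum_distrib_left mult_ac)
  also have "\<dots> = Suc k * (contract n (y t) ^^ (Suc k - 1)) (contract n v T) M"
    by (cases k) (simp_all add: contract_pow_contract contract_commute[of n "y t" v] algebra_simps)
  finally show ?case unfolding y_def .
qed

definition lin_map :: "nat \<Rightarrow> (nat \<Rightarrow> nat \<Rightarrow> real) \<Rightarrow> (nat \<Rightarrow> real) \<Rightarrow> nat \<Rightarrow> real"
  where "lin_map n A x = (\<lambda>i. \<Sum>j<n. A i j * x j)"

text \<open>The derivative of \<open>F((x + tv)\<^sup>d)\<close> at \<open>t = 0\<close> is \<open>d F(x\<^sup>d\<^sup>-\<^sup>1, v)\<close>, so equality on the diagonal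
  allows replacing one argument at a time.\<close>
lemma polar_form_determined_by_diagonal:
  assumes "\<And>x. (contract n x ^^ d) T 0 = (contract m (lin_map n A x) ^^ d) S 0"
    and "length vs = d"
  shows "contracts n vs T 0 = contracts m (map (lin_map n A) vs) S 0"
  using assms
proof (induction d arbitrary: T S vs)
  case 0
  then show ?case by simp
next
  case (Suc d)
  obtain v ws where vs: "vs = v # ws" "length ws = d" using Suc.prems(2) by (metis length_Suc_conv)
  have "(contract n x ^^ d) (contract n v T) 0 = (contract m (lin_map n A x) ^^ d) (contract m (lin_map n A v) S) 0" for x
  proof -
    have lin: "lin_map n A (\<lambda>i. x i + t * v i) = (\<lambda>i. lin_map n A x i + t * lin_map n A v i)" for t
      by (simp add: lin_map_def algebra_simps sum.distrib sum_distrib_left)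
    have 1: "((\<lambda>t. (contract n (\<lambda>i. x i + t * v i) ^^ Suc d) T 0) has_real_derivative
       Suc d * (contract n x ^^ d) (contract n v T) 0) (at 0)"
      using contract_pow_has_derivative[where n = n and x = x and v = v and k = "Suc d" and T = T and M = 0 and t = 0] by (simp del: funpow.simps)
    have "((\<lambda>t. (contract m (\<lambda>i. lin_map n A x i + t * lin_map n A v i) ^^ Suc d) S 0) has_real_derivative
       Suc d * (contract m (lin_map n A x) ^^ d) (contract m (lin_map n A v) S) 0) (at 0)"
      using contract_pow_has_derivative[where n = m and x = "lin_map n A x" and v = "lin_map n A v" and k = "Suc d" and T = S
          and M = 0 and t = 0] by (simp del: funpow.simps)
    then have "((\<lambda>t. (contract n (\<lambda>i. x i + t * v i) ^^ Suc d) T 0) has_real_derivative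
       Suc d * (contract m (lin_map n A x) ^^ d) (contract m (lin_map n A v) S) 0) (at 0)"
      unfolding Suc.prems(1) lin .
    from DERIV_unique[OF 1 this] show ?thesis by simp
  qed
  from Suc.IH[OF this vs(2)] show ?case by (simp add: vs)
qed

text \<open>At \<open>z = x + iy\<close> a zero of \<open>q\<close> means \<open>q(x) = q(y)\<close> and \<open>B(x, y) = 0\<close> for the polar form \<open>B\<close>. For
  positive \<open>y\<close> this contradicts \<open>q(x) q(y) \<le> B(x, y)\<^sup>2\<close>, since \<open>q(y) > 0\<close>.\<close>
lemma real_stable_quadratic:
  assumes q: "q \<in> polys n" "homog 2 q" "nonneg_coeffs q" and h: "lorentz n (hess (taylor q))"
  shows "real_stable n q"
  unfolding real_stable_def
proof (intro conjI q(1), rule disjCI, rule ccontr)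
  assume "\<not> (q = 0)" and "\<not> (\<forall>z :: nat \<Rightarrow> complex. (\<forall>i<n. Im (z i) > 0) \<longrightarrow> meval q z \<noteq> 0)"
  then obtain z :: "nat \<Rightarrow> complex" where z: "\<And>i. i < n \<Longrightarrow> Im (z i) > 0" "meval q z = 0" by blast
  define x y where "x i = Re (z i)" and "y i = Im (z i)" for i
  define B where "B = hess (taylor q)"
  have Bnn: "B i j \<ge> 0" for i j using q mfact_pos
    by (auto simp: B_def hess_def taylor_def nonneg_coeffs_def less_imp_le)
  have sym: "B i j = B j i" for i j unfolding B_def by (rule hess_sym)
  have "2 * meval q z = (\<Sum>i<n. \<Sum>j<n. z i * (z j * of_real (B i j)))"
  proof -
    have inner: "meval (pderiv_var i q) z = (\<Sum>j<n. z j * of_real (B i j))" for i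
    proof -
      have "homog (Suc (Suc 0)) q" using q(2) by (simp add: numeral_2_eq_2)
      then have h1: "homog (Suc 0) (pderiv_var i q)" by (rule homog_pderiv_var)
      then have "homog 0 (pderiv_var j (pderiv_var i q))" for j by (rule homog_pderiv_var)
      then have "meval (pderiv_var j (pderiv_var i q)) z = of_real (B i j)" for j
        by (simp add: meval_homog_0 taylor_at_0[symmetric] taylor_pderiv_var)
           (simp add: shift_def B_def hess_def add.commute)
      then show ?thesis using euler_identity[OF polys_pderiv_var[OF q(1)] h1, of z] by simp
    qed
    show ?thesis using euler_identity[OF q(1,2), of z] by (simp add: inner sum_distrib_left)
  qed
  then have z0: "(\<Sum>i<n. \<Sum>j<n. z i * (z j * of_real (B i j))) = 0" using z by simp
  have "Re (\<Sum>i<n. \<Sum>j<n. z i * (z j * of_real (B i j))) = bil n B x x - bil n B y y"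
    by (simp add: bil_def x_def y_def sum_subtractf algebra_simps)
  then have re: "bil n B x x = bil n B y y" using z0 by simp
  have "Im (\<Sum>i<n. \<Sum>j<n. z i * (z j * of_real (B i j))) = bil n B x y + bil n B y x"
    by (simp add: bil_def x_def y_def sum.distrib algebra_simps)
  then have im: "bil n B y x = 0" using z0 bil_sym[of n B x y, OF sym] by simp
  obtain \<alpha> where \<alpha>: "lookup q \<alpha> \<noteq> 0" using \<open>q \<noteq> 0\<close> by (metis poly_mapping_eqI lookup_zero)
  then have k: "keys \<alpha> \<subseteq> {..<n}" "mdegree \<alpha> = Suc (Suc 0)"
    using q by (auto simp: polys_def homog_def in_keys_iff numeral_2_eq_2)
  obtain i \<beta> where i: "\<alpha> = \<beta> + unit_exp i" "mdegree \<beta> = Suc 0" using exponent_Suc_obtain[OF k(2)] .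
  obtain j \<gamma> where j: "\<beta> = \<gamma> + unit_exp j" "mdegree \<gamma> = 0" using exponent_Suc_obtain[OF i(2)] .
  have a: "\<alpha> = unit_exp i + unit_exp j" using i j by (simp add: mdegree_eq_0_iff add.commute)
  have ij: "i < n" "j < n" using k(1) unfolding a keys_add_nat by auto
  have "B i j \<noteq> 0" using \<alpha> a by (simp add: B_def hess_def taylor_eq_0_iff)
  then have "y i * y j * B i j > 0" using ij z Bnn[of i j] by (simp add: y_def less_le)
  also have "\<dots> \<le> (\<Sum>j<n. y i * y j * B i j)"
    using ij z Bnn by (intro member_le_sum[of j]) (auto simp: y_def less_imp_le)
  also have "\<dots> \<le> bil n B y y" unfolding bil_def
    using ij z Bnn by (intro member_le_sum[of i "{..<n}" "\<lambda>i. \<Sum>j<n. y i * y j * B i j"] sum_nonneg)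
      (auto simp: y_def less_imp_le intro!: sum_nonneg)
  finally have pos: "bil n B y y > 0" .
  then have "bil n B y y * bil n B x x \<le> (bil n B y x)\<^sup>2" using h by (simp add: lorentz_def B_def)
  then have "bil n B y y * bil n B y y \<le> 0" using re im by simp
  then show False using pos by (simp add: mult_le_0_iff)
qed

text \<open>The hypothesis concerns arbitrary nonnegative directions, not only coordinate directions,
  because a coordinate direction of \<open>x\<close> becomes a column of \<open>A\<close>. For the same reason all
  contractions of \<open>f\<close> inherit the signature, which is what M-convexity requires.\<close>
theorem lorentzian_substitution:
  assumes f: "f \<in> polys n" "homog d f" and h: "h \<in> polys m" "homog d h" "nonneg_coeffs h"
    and A: "\<And>i j. A i j \<ge> 0"
    and eq: "\<And>x :: nat \<Rightarrow> real. meval f x = meval h (lin_map n A x)"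
    and H: "\<And>vs. \<forall>v\<in>set vs. \<forall>i. v i \<ge> 0 \<Longrightarrow> length vs + 2 = d \<Longrightarrow> lorentz m (hess (contracts m vs (taylor h)))"
  shows "lorentzian n d f"
proof -
  have pol: "contracts n vs (taylor f) 0 = contracts m (map (lin_map n A) vs) (taylor h) 0" if "length vs = d" for vs
  proof (rule polar_form_determined_by_diagonal[OF _ that])
    fix x show "(contract n x ^^ d) (taylor f) 0 = (contract m (lin_map n A x) ^^ d) (taylor h) 0"
      using eq[of x] meval_contract_pow[OF f, where x = x] meval_contract_pow[OF h(1,2), where x = "lin_map n A x"] by simp
  qed
  have Ann: "lin_map n A v i \<ge> 0" if "\<forall>i. v i \<ge> 0" for v i
    unfolding lin_map_def using A that by (intro sum_nonneg) auto
  have hnn: "taylor h M \<ge> 0" for M using h mfact_pos by (auto simp: taylor_def nonneg_coeffs_def less_imp_le)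
  have nn: "nonneg_coeffs f"
    unfolding nonneg_coeffs_def
  proof
    fix \<alpha>
    show "lookup f \<alpha> \<ge> 0"
    proof (cases "lookup f \<alpha> = 0")
      case False
      then have k: "keys \<alpha> \<subseteq> {..<n}" "mdegree \<alpha> = d"
        using f by (auto simp: polys_def homog_def in_keys_iff)
      obtain us where us: "\<forall>u\<in>set us. \<forall>i. u i \<ge> 0" "length us = mdegree \<alpha>" "\<And>T. contracts n us T = shift \<alpha> T"
        using shift_as_contracts[OF k(1)] by metis
      have "taylor f \<alpha> = contracts m (map (lin_map n A) us) (taylor h) 0"
        using pol[of us] us k by (simp add: shift_def)
      also have "\<dots> \<ge> 0" using us Ann by (intro contracts_nonneg hnn) auto
      finally show ?thesis using mfact_pos[of \<alpha>] by (simp add: taylor_def zero_le_mult_iff)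
    qed simp
  qed
  have T: "nonneg_form n d (taylor f)" using f nn by (rule nonneg_form_taylor)
  have lorentzf: "lorentz n (hess (contracts n vs (taylor f)))" if vs: "\<forall>v\<in>set vs. \<forall>i. v i \<ge> 0" "length vs + 2 = d" for vs
  proof -
    define ws where "ws = map (lin_map n A) vs"
    have "bil n (hess (contracts n vs (taylor f))) x y = bil m (hess (contracts m ws (taylor h))) (lin_map n A x) (lin_map n A y)" for x y
      using pol[of "vs @ [y, x]"] vs by (simp add: bil_hess ws_def)
    moreover have "lorentz m (hess (contracts m ws (taylor h)))" using vs Ann by (intro H) (auto simp: ws_def)
    ultimately show ?thesis by (simp add: lorentz_def)
  qed
  have "real_stable n (pderiv_multi \<alpha> f)"
    if \<alpha>: "keys \<alpha> \<subseteq> {..<n}" "mdegree \<alpha> + 2 = d" for \<alpha>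
  proof (rule real_stable_quadratic)
    show "pderiv_multi \<alpha> f \<in> polys n" using f by (intro polys_pderiv_multi)
    show "homog 2 (pderiv_multi \<alpha> f)" using f \<alpha> by (intro homog_pderiv_multi) simp
    have t: "taylor (pderiv_multi \<alpha> f) = shift \<alpha> (taylor f)" by (rule taylor_pderiv_multi)
    show "nonneg_coeffs (pderiv_multi \<alpha> f)"
      unfolding nonneg_coeffs_def
    proof
      fix \<beta>
      have "taylor (pderiv_multi \<alpha> f) \<beta> \<ge> 0" using T unfolding t by (simp add: nonneg_form_def shift_def)
      then show "lookup (pderiv_multi \<alpha> f) \<beta> \<ge> 0"
        using mfact_pos[of \<beta>] by (simp add: taylor_def zero_le_mult_iff)
    qed
    obtain us where us: "\<forall>u\<in>set us. \<forall>i. u i \<ge> 0" "length us = mdegree \<alpha>" "\<And>T. contracts n us T = shift \<alpha> T"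
      using shift_as_contracts[OF \<alpha>(1)] by metis
    show "lorentz n (hess (taylor (pderiv_multi \<alpha> f)))"
      unfolding t us(3)[symmetric] using us \<alpha> by (intro lorentzf) auto
  qed
  moreover have "M_convex (keys f)"
  proof -
    have "keys f = {\<alpha>. taylor f \<alpha> \<noteq> 0}" by (auto simp: taylor_eq_0_iff in_keys_iff)
    then show ?thesis using M_convex_support[OF T lorentzf] by simp
  qed
  ultimately show ?thesis using f nn by (auto simp: lorentzian_def)
qed

section \<open>Multi-affine Garding polynomials\<close>

lemma taylor_inject: "taylor f = taylor g \<Longrightarrow> f = g"
proof (rule poly_mapping_eqI)
  fix \<alpha> assume "taylor f = taylor g"
  then have "mfact \<alpha> * lookup f \<alpha> = mfact \<alpha> * lookup g \<alpha>"
    unfolding taylor_def by metis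
  then show "lookup f \<alpha> = lookup g \<alpha>" using mfact_pos[of \<alpha>] by simp
qed

lemma pderiv_var_commute: "pderiv_var i (pderiv_var j f) = pderiv_var j (pderiv_var i f)"
  by (rule taylor_inject) (simp add: taylor_pderiv_var shift_shift add.commute)

lemma pderiv_multi_0: "pderiv_multi 0 f = f"
  by (simp add: pderiv_multi_def)

lemma pderiv_multi_add_unit_exp: "pderiv_multi (\<beta> + unit_exp k) f = pderiv_var k (pderiv_multi \<beta> f)"
  by (rule taylor_inject) (simp add: taylor_pderiv_multi taylor_pderiv_var shift_shift add.commute)

lemma pderiv_var_0 [simp]: "pderiv_var i 0 = 0"
  by (simp add: pderiv_var_def)

lemma multi_affine_iff_taylor: "multi_affine f \<longleftrightarrow> (\<forall>\<alpha> i. taylor f \<alpha> \<noteq> 0 \<longrightarrow> lookup \<alpha> i \<le> 1)"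
  by (auto simp: multi_affine_def taylor_eq_0_iff in_keys_iff)

lemma multi_affine_pderiv_var:
  assumes "multi_affine f"
  shows "multi_affine (pderiv_var k f)"
  unfolding multi_affine_iff_taylor
proof (intro allI impI)
  fix \<alpha> i assume "taylor (pderiv_var k f) \<alpha> \<noteq> 0"
  then have "lookup (\<alpha> + unit_exp k) i \<le> 1"
    using assms unfolding multi_affine_iff_taylor taylor_pderiv_var shift_def by blast
  then show "lookup \<alpha> i \<le> 1" by (simp add: lookup_add)
qed

lemma multi_affine_pderiv_multi:
  assumes "multi_affine f"
  shows "multi_affine (pderiv_multi \<beta> f)"
proof (induction "mdegree \<beta>" arbitrary: \<beta>)
  case 0
  then show ?case using assms by (simp add: mdegree_eq_0_iff pderiv_multi_0)
next
  case (Suc k)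
  obtain i \<gamma> where "\<beta> = \<gamma> + unit_exp i" "mdegree \<gamma> = k" using Suc.hyps(2) exponent_Suc_obtain by metis
  then show ?case using Suc.hyps(1) by (simp add: pderiv_multi_add_unit_exp multi_affine_pderiv_var)
qed

lemma multi_affine_pderiv_twice:
  assumes "multi_affine f" "lookup \<beta> k > 0"
  shows "pderiv_var k (pderiv_multi \<beta> f) = 0"
proof (rule taylor_inject, rule ext)
  fix \<alpha>
  have "\<not> lookup (\<alpha> + unit_exp k + \<beta>) k \<le> 1" using assms(2) by (simp add: lookup_add lookup_unit_exp)
  then have "taylor f (\<alpha> + unit_exp k + \<beta>) = 0" using assms(1) unfolding multi_affine_iff_taylor by blast
  then show "taylor (pderiv_var k (pderiv_multi \<beta> f)) \<alpha> = taylor 0 \<alpha>"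
    unfolding taylor_pderiv_var taylor_pderiv_multi shift_shift by (simp add: shift_def taylor_def add_ac)
qed

lemma multi_affine_pderiv_var_twice: "multi_affine f \<Longrightarrow> pderiv_var k (pderiv_var k f) = 0"
  using multi_affine_pderiv_twice[of f "unit_exp k" k] pderiv_multi_add_unit_exp[of 0 k f]
  by (simp add: pderiv_multi_0 lookup_unit_exp)

lemma monom_eval_cong: "(\<And>i. i \<in> keys \<alpha> \<Longrightarrow> x i = y i) \<Longrightarrow> monom_eval \<alpha> x = monom_eval \<alpha> y"
  unfolding monom_eval_def by (intro prod.cong) auto

lemma meval_cong: "f \<in> polys n \<Longrightarrow> (\<And>i. i < n \<Longrightarrow> x i = y i) \<Longrightarrow> meval f x = meval f y"
  unfolding meval_monom polys_def
  by (intro sum.cong refl arg_cong2[where f = "(*)"] monom_eval_cong) auto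

lemma multi_affine_meval_update:
  assumes "multi_affine g"
  shows "meval g (x(k := x k + t)) = meval g x + t * meval (pderiv_var k g) x"
proof -
  have "monom_eval \<alpha> (x(k := x k + t)) =
      monom_eval \<alpha> x + t * (of_nat (lookup \<alpha> k) * monom_eval (\<alpha> - unit_exp k) x)"
    if \<alpha>: "\<alpha> \<in> keys g" for \<alpha>
  proof (cases "lookup \<alpha> k = 0")
    case True
    then have "monom_eval \<alpha> (x(k := x k + t)) = monom_eval \<alpha> x"
      by (intro monom_eval_cong) (auto simp: in_keys_iff)
    then show ?thesis using True by simp
  next
    case False
    moreover have "lookup \<alpha> k \<le> 1" using assms \<alpha> by (simp add: multi_affine_def)
    ultimately have one: "lookup \<alpha> k = 1" by simp
    define \<beta> where "\<beta> = \<alpha> - unit_exp k"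
    have b: "\<alpha> = \<beta> + unit_exp k" unfolding \<beta>_def using one by (simp add: minus_plus_unit_exp)
    have "monom_eval \<beta> (x(k := x k + t)) = monom_eval \<beta> x"
      using one by (intro monom_eval_cong) (auto simp: \<beta>_def in_keys_iff lookup_minus lookup_unit_exp)
    then have "monom_eval \<alpha> (x(k := x k + t)) = monom_eval \<alpha> x + t * monom_eval \<beta> x"
      by (simp add: b monom_eval_add algebra_simps)
    then show ?thesis by (simp add: one \<beta>_def)
  qed
  then have "meval g (x(k := x k + t)) = (\<Sum>\<alpha>\<in>keys g. of_real (lookup g \<alpha>) *
      (monom_eval \<alpha> x + t * (of_nat (lookup \<alpha> k) * monom_eval (\<alpha> - unit_exp k) x)))"
    unfolding meval_monom by (intro sum.cong refl) simp
  then show ?thesis unfolding meval_pderiv_var meval_monom[of g x]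
    by (simp add: sum.distrib sum_distrib_left algebra_simps)
qed

definition rayleigh_diff :: "nat \<Rightarrow> nat \<Rightarrow> mpoly \<Rightarrow> (nat \<Rightarrow> real) \<Rightarrow> real"
  where "rayleigh_diff i j p x = meval (pderiv_var i p) x * meval (pderiv_var j p) x -
     meval p x * meval (pderiv_var i (pderiv_var j p)) x"

lemma rayleigh_diff_update:
  assumes p: "multi_affine p"
  shows "rayleigh_diff i j p (x(k := x k + t)) = rayleigh_diff i j p x +
    (meval (pderiv_var i p) x * meval (pderiv_var j (pderiv_var k p)) x +
     meval (pderiv_var i (pderiv_var k p)) x * meval (pderiv_var j p) x -
     meval p x * meval (pderiv_var i (pderiv_var j (pderiv_var k p))) x -
     meval (pderiv_var k p) x * meval (pderiv_var i (pderiv_var j p)) x) * t +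
    rayleigh_diff i j (pderiv_var k p) x * t\<^sup>2"
proof -
  have c: "pderiv_var k (pderiv_var i (pderiv_var j p)) = pderiv_var i (pderiv_var j (pderiv_var k p))"
    "pderiv_var k (pderiv_var i p) = pderiv_var i (pderiv_var k p)"
    "pderiv_var k (pderiv_var j p) = pderiv_var j (pderiv_var k p)"
    using pderiv_var_commute by metis+
  show ?thesis
    unfolding rayleigh_diff_def multi_affine_meval_update[OF p]
      multi_affine_meval_update[OF multi_affine_pderiv_var[OF p]]
      multi_affine_meval_update[OF multi_affine_pderiv_var[OF multi_affine_pderiv_var[OF p]]] c
    by (simp add: power2_eq_square algebra_simps)
qed

text \<open>What remains of a component of \<open>{g > 0}\<close> with the positive ray test when only moves along
  coordinate lines are considered. The Rayleigh inequalities need no more, so that one-variable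
  arguments replace topology.\<close>
definition garding_region :: "nat \<Rightarrow> mpoly \<Rightarrow> (nat \<Rightarrow> real) set \<Rightarrow> bool"
  where "garding_region m g C \<longleftrightarrow> C \<noteq> {} \<and> (\<forall>x\<in>C. meval g x > 0) \<and>
    (\<forall>x\<in>C. \<forall>k<m. \<forall>t\<ge>0. x(k := x k + t) \<in> C) \<and>
    (\<forall>x\<in>C. \<forall>k<m. \<forall>t. meval g (x(k := x k + t)) > 0 \<longrightarrow> x(k := x k + t) \<in> C)"

lemma nonneg_leading_coeff:
  fixes a b c :: real
  assumes "\<And>t. t \<ge> 0 \<Longrightarrow> a + b * t + c * t\<^sup>2 \<ge> 0"
  shows "c \<ge> 0"
proof (rule ccontr)
  assume c: "\<not> c \<ge> 0"
  define t where "t = (\<bar>a\<bar> + \<bar>b\<bar> + 1) / (- c) + 1"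
  have t1: "t \<ge> 1" using c by (simp add: t_def field_simps)
  have "(- c) * t = \<bar>a\<bar> + \<bar>b\<bar> + 1 - c" using c by (simp add: t_def field_simps)
  then have "(- c) * t > \<bar>a\<bar> + \<bar>b\<bar>" using c by simp
  then have "(- c) * t * t > (\<bar>a\<bar> + \<bar>b\<bar>) * t" using t1 by (intro mult_strict_right_mono) auto
  moreover have "(\<bar>a\<bar> + \<bar>b\<bar>) * t \<ge> a + b * t"
  proof -
    have "\<bar>a\<bar> * 1 \<le> \<bar>a\<bar> * t" using t1 by (intro mult_left_mono) auto
    moreover have "b * t \<le> \<bar>b\<bar> * t" using t1 by (intro mult_right_mono) auto
    ultimately show ?thesis by (simp add: distrib_right)
  qed
  ultimately have "a + b * t + c * t\<^sup>2 < 0" by (simp add: power2_eq_square)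
  then show False using assms[of t] t1 by simp
qed

lemma nonneg_slope:
  fixes a b :: real
  assumes "\<And>t. t \<ge> 0 \<Longrightarrow> a + b * t \<ge> 0"
  shows "b \<ge> 0"
proof (rule ccontr)
  assume b: "\<not> b \<ge> 0"
  have "a + b * ((\<bar>a\<bar> + 1) / (- b)) \<ge> 0" using b by (intro assms) (simp add: field_simps)
  moreover have "b * ((\<bar>a\<bar> + 1) / (- b)) = - (\<bar>a\<bar> + 1)" using b by simp
  ultimately show False by linarith
qed

context
  fixes m :: nat and g :: mpoly and C :: "(nat \<Rightarrow> real) set"
  assumes g: "g \<in> polys m" "multi_affine g" and region: "garding_region m g C"
begin

lemma region_pos: "x \<in> C \<Longrightarrow> meval g x > 0"
  and region_raise: "x \<in> C \<Longrightarrow> k < m \<Longrightarrow> t \<ge> 0 \<Longrightarrow> x(k := x k + t) \<in> C"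
  and region_move: "x \<in> C \<Longrightarrow> k < m \<Longrightarrow> meval g (x(k := x k + t)) > 0 \<Longrightarrow> x(k := x k + t) \<in> C"
  using region by (auto simp: garding_region_def)

lemma region_pderiv_nonneg:
  assumes p: "multi_affine p" "\<And>x. x \<in> C \<Longrightarrow> meval p x \<ge> 0" and x: "x \<in> C" and k: "k < m"
  shows "meval (pderiv_var k p) x \<ge> 0"
proof (rule nonneg_slope)
  fix t :: real assume "t \<ge> 0"
  then have "meval p (x(k := x k + t)) \<ge> 0" using region_raise x k p by blast
  then show "meval p x + meval (pderiv_var k p) x * t \<ge> 0"
    by (simp add: multi_affine_meval_update[OF p(1)] mult.commute)
qed

text \<open>On the plane through \<open>x\<close> in the directions \<open>i\<close> and \<open>j\<close> write \<open>g = a + bt + cs + dst\<close>. If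
  \<open>bc < ad\<close>, then \<open>d > 0\<close>, and \<open>dg = (dt + c)(ds + b) + (ad - bc)\<close> is positive wherever \<open>ds + b = 0\<close>.
  So \<open>s\<close> can be lowered until \<open>ds + b = 0\<close>, and then \<open>t\<close> until \<open>dt + c = -1\<close>, without leaving \<open>C\<close>. From
  there \<open>g\<close> decreases without bound as \<open>s\<close> grows, against the positive ray test.\<close>
lemma region_rayleigh_diff:
  assumes x: "x \<in> C" and ij: "i < m" "j < m"
  shows "rayleigh_diff i j g x \<ge> 0"
proof (cases "i = j")
  case True
  then show ?thesis using multi_affine_pderiv_var_twice[OF g(2)] by (simp add: rayleigh_diff_def)
next
  case False
  define a b c d where "a = meval g x" and "b = meval (pderiv_var i g) x" and "c = meval (pderiv_var j g) x"
    and "d = meval (pderiv_var i (pderiv_var j g)) x"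
  have a: "a > 0" using region_pos[OF x] by (simp add: a_def)
  have nn: "meval g y \<ge> 0" if "y \<in> C" for y using region_pos[OF that] by simp
  have b: "b \<ge> 0" and c: "c \<ge> 0"
    unfolding b_def c_def using region_pderiv_nonneg[OF g(2) nn x] ij by auto
  have d: "d \<ge> 0" unfolding d_def
    by (rule region_pderiv_nonneg[OF multi_affine_pderiv_var[OF g(2)] _ x ij(1)])
      (rule region_pderiv_nonneg[OF g(2) nn _ ij(2)])
  define y where "y s t = (x(j := x j + s))(i := (x(j := x j + s)) i + t)" for s t
  have gs: "meval g (x(j := x j + s)) = a + s * c" for s
    by (simp add: multi_affine_meval_update[OF g(2)] a_def c_def)
  have gy: "meval g (y s t) = a + s * c + t * (b + s * d)" for s t
    unfolding y_def multi_affine_meval_update[OF g(2)] multi_affine_meval_update[OF multi_affine_pderiv_var[OF g(2)]]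
    by (simp add: a_def b_def c_def d_def pderiv_var_commute[of j i])
  show ?thesis
  proof (rule ccontr)
    assume "\<not> ?thesis"
    then have neg: "b * c < a * d" by (simp add: rayleigh_diff_def a_def b_def c_def d_def)
    have dpos: "d > 0"
    proof (rule ccontr)
      assume "\<not> d > 0"
      then have "d = 0" using d by simp
      then show False using neg mult_nonneg_nonneg[OF b c] by simp
    qed
    (* s0 makes d s + b vanish, t0 makes d t + c equal to -1 *)
    define s0 t0 where "s0 = - b / d" and "t0 = - (c + 1) / d"
    have base: "a + s0 * c > 0" using neg dpos by (simp add: s0_def field_simps)
    have in1: "x(j := x j + s0) \<in> C" using base gs by (intro region_move x ij) simp
    have "b + s0 * d = 0" using dpos by (simp add: s0_def)
    then have "meval g (y s0 t0) > 0" using base by (simp add: gy)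
    then have in2: "y s0 t0 \<in> C" unfolding y_def by (intro region_move in1 ij) simp
    have "y (s0 + s) t0 = (y s0 t0)(j := y s0 t0 j + s)" for s
      using False by (auto simp: y_def fun_eq_iff)
    then have "y (s0 + s) t0 \<in> C" if "s \<ge> 0" for s using region_raise[OF in2 ij(2) that] by simp
    then have p: "meval g (y (s0 + s) t0) > 0" if "s \<ge> 0" for s using region_pos that by blast
    have "meval g (y (s0 + s) t0) = (a + s0 * c) - s" for s
    proof -
      have "t0 * d = - (c + 1)" using dpos by (simp add: t0_def)
      then have "t0 * (b + (s0 + s) * d) = s * (- (c + 1))"
        using \<open>b + s0 * d = 0\<close> by (metis (no_types, opaque_lifting) add.assoc add_0 distrib_right mult.assoc mult.commute)
      then show ?thesis by (simp add: gy algebra_simps)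
    qed
    then show False using p[of "a + s0 * c"] base by simp
  qed
qed

text \<open>The value and the Rayleigh difference of \<open>\<partial>\<^sub>kp\<close> at \<open>x\<close> are the leading coefficients of those of \<open>p\<close>
  along the ray in direction \<open>k\<close>, which stays in \<open>C\<close>. So nonnegativity passes to derivatives with
  the same region \<open>C\<close>.\<close>
lemma region_derivatives:
  assumes "keys \<beta> \<subseteq> {..<m}" "x \<in> C"
  shows "meval (pderiv_multi \<beta> g) x \<ge> 0"
    and "i < m \<Longrightarrow> j < m \<Longrightarrow> rayleigh_diff i j (pderiv_multi \<beta> g) x \<ge> 0"
proof -
  have "\<forall>x\<in>C. meval (pderiv_multi \<beta> g) x \<ge> 0 \<and> (\<forall>i<m. \<forall>j<m. rayleigh_diff i j (pderiv_multi \<beta> g) x \<ge> 0)"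
    using assms(1)
  proof (induction "mdegree \<beta>" arbitrary: \<beta>)
    case 0
    then show ?case using region_pos region_rayleigh_diff
      by (auto simp: mdegree_eq_0_iff pderiv_multi_0 less_imp_le)
  next
    case (Suc n)
    obtain k \<gamma> where gam: "\<beta> = \<gamma> + unit_exp k" "mdegree \<gamma> = n" using Suc.hyps(2) exponent_Suc_obtain by metis
    then have k: "k < m" "keys \<gamma> \<subseteq> {..<m}" using Suc.prems by (auto simp: keys_add_nat)
    define p where "p = pderiv_multi \<gamma> g"
    have IH: "\<And>x. x \<in> C \<Longrightarrow> meval p x \<ge> 0" "\<And>x i j. x \<in> C \<Longrightarrow> i < m \<Longrightarrow> j < m \<Longrightarrow> rayleigh_diff i j p x \<ge> 0"
      using Suc.hyps(1)[of \<gamma>] gam k by (auto simp: p_def)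
    have pa: "multi_affine p" unfolding p_def by (rule multi_affine_pderiv_multi[OF g(2)])
    have "rayleigh_diff i j (pderiv_var k p) x \<ge> 0" if "x \<in> C" "i < m" "j < m" for x i j
    proof (rule nonneg_leading_coeff)
      fix t :: real assume "t \<ge> 0"
      then have "rayleigh_diff i j p (x(k := x k + t)) \<ge> 0" using IH(2) region_raise that k by blast
      then show "rayleigh_diff i j p x +
        (meval (pderiv_var i p) x * meval (pderiv_var j (pderiv_var k p)) x +
         meval (pderiv_var i (pderiv_var k p)) x * meval (pderiv_var j p) x -
         meval p x * meval (pderiv_var i (pderiv_var j (pderiv_var k p))) x -
         meval (pderiv_var k p) x * meval (pderiv_var i (pderiv_var j p)) x) * t +
        rayleigh_diff i j (pderiv_var k p) x * t\<^sup>2 \<ge> 0" using rayleigh_diff_update[OF pa] by simp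
    qed
    moreover have "meval (pderiv_var k p) x \<ge> 0" if "x \<in> C" for x
      using region_pderiv_nonneg[OF pa IH(1) that k(1)] .
    ultimately show ?case by (simp add: gam(1) pderiv_multi_add_unit_exp p_def[symmetric])
  qed
  then show "meval (pderiv_multi \<beta> g) x \<ge> 0" "i < m \<Longrightarrow> j < m \<Longrightarrow> rayleigh_diff i j (pderiv_multi \<beta> g) x \<ge> 0"
    using assms(2) by auto
qed

text \<open>Coordinates are changed one at a time; only the corners of the walk need to be checked.\<close>
lemma region_walk:
  assumes x: "x \<in> C" and pos: "\<And>k. k \<le> m \<Longrightarrow> meval g (\<lambda>l. if l < k then y l else x l) > 0"
  shows "(\<lambda>l. if l < m then y l else x l) \<in> C"
proof -
  have "(\<lambda>l. if l < k then y l else x l) \<in> C" if "k \<le> m" for k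
    using that
  proof (induction k)
    case (Suc k)
    define z where "z = (\<lambda>l. if l < k then y l else x l)"
    have e: "(\<lambda>l. if l < Suc k then y l else x l) = z(k := z k + (y k - x k))"
      by (auto simp: z_def fun_eq_iff less_Suc_eq)
    have "z \<in> C" using Suc by (simp add: z_def)
    then show ?case using pos[OF Suc.prems] Suc.prems unfolding e by (intro region_move) auto
  qed (use x in simp)
  then show ?thesis by simp
qed

lemma region_add:
  assumes x: "x \<in> C" and y: "\<And>i. i < m \<Longrightarrow> y i \<ge> 0"
  shows "(\<lambda>l. if l < m then x l + y l else x l) \<in> C"
proof -
  have "(\<lambda>l. if l < k then x l + y l else x l) \<in> C" if "k \<le> m" for k
    using that
  proof (induction k)
    case (Suc k)
    define z where "z = (\<lambda>l. if l < k then x l + y l else x l)"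
    have "(\<lambda>l. if l < Suc k then x l + y l else x l) = z(k := z k + y k)"
      by (auto simp: z_def fun_eq_iff less_Suc_eq)
    moreover have "z \<in> C" using Suc by (simp add: z_def)
    ultimately show ?case using region_raise[of z k "y k"] y Suc.prems by simp
  qed (use x in simp)
  then show ?thesis by simp
qed

end

section \<open>The top-degree part of a multi-affine Garding polynomial\<close>

definition hom_part :: "nat \<Rightarrow> mpoly \<Rightarrow> mpoly"
  where "hom_part r p = (\<Sum>\<alpha>\<in>{\<alpha> \<in> keys p. mdegree \<alpha> = r}. Poly_Mapping.single \<alpha> (lookup p \<alpha>))"

lemma lookup_hom_part: "lookup (hom_part r p) \<alpha> = (if mdegree \<alpha> = r then lookup p \<alpha> else 0)"
  by (auto simp: hom_part_def lookup_sum lookup_single when_def in_keys_iff sum.delta)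

lemma taylor_hom_part: "taylor (hom_part r p) \<alpha> = (if mdegree \<alpha> = r then taylor p \<alpha> else 0)"
  by (simp add: taylor_def lookup_hom_part)

lemma pderiv_multi_hom_part: "pderiv_multi \<beta> (hom_part (mdegree \<beta> + r) p) = hom_part r (pderiv_multi \<beta> p)"
  by (rule taylor_inject, rule ext) (simp add: taylor_pderiv_multi shift_def taylor_hom_part mdegree_add)

lemma pderiv_var_hom_part: "pderiv_var i (hom_part (Suc r) p) = hom_part r (pderiv_var i p)"
  by (rule taylor_inject, rule ext) (simp add: taylor_pderiv_var shift_def taylor_hom_part mdegree_add)

lemma homog_hom_part: "homog r (hom_part r p)"
  by (simp add: homog_iff_taylor taylor_hom_part)

lemma polys_hom_part: "p \<in> polys n \<Longrightarrow> hom_part r p \<in> polys n"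
  by (simp add: polys_iff_taylor taylor_hom_part)

lemma monom_eval_scale: "monom_eval \<alpha> (\<lambda>i. s * x i) = s ^ mdegree \<alpha> * monom_eval \<alpha> x"
  by (simp add: monom_eval_def power_mult_distrib prod.distrib mdegree_def power_sum)

lemma meval_homog_scale: "homog d f \<Longrightarrow> meval f (\<lambda>i. s * x i) = s ^ d * meval f x"
  by (simp add: meval_monom monom_eval_scale homog_def sum_distrib_left mult_ac)

text \<open>Along a line with direction \<open>y\<close>, a monomial of degree \<open>k\<close> grows like \<open>s\<^sup>k\<close> times its value
  at \<open>y\<close>.\<close>
lemma meval_hom_part_limit:
  fixes y b :: "nat \<Rightarrow> real"
  assumes "\<And>\<alpha>. \<alpha> \<in> keys p \<Longrightarrow> mdegree \<alpha> \<le> r"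
  shows "((\<lambda>s. meval p (\<lambda>i. s * y i + b i) / s ^ r) \<longlongrightarrow> meval (hom_part r p) y) at_top"
proof -
  have mono: "((\<lambda>s. monom_eval \<alpha> (\<lambda>i. s * y i + b i) / s ^ r) \<longlongrightarrow>
      (if mdegree \<alpha> = r then monom_eval \<alpha> y else 0)) at_top"
    if "mdegree \<alpha> \<le> r" for \<alpha>
  proof -
    have lim0: "((\<lambda>s::real. c / s) \<longlongrightarrow> 0) at_top" for c :: real
      by (intro tendsto_divide_0[OF tendsto_const] filterlim_at_top_imp_at_infinity filterlim_ident)
    have "((\<lambda>s. y i + b i / s) \<longlongrightarrow> y i) at_top" for i
      using tendsto_add[OF tendsto_const[of "y i"] lim0[of "b i"]] by simp
    then have l1: "((\<lambda>s. monom_eval \<alpha> (\<lambda>i. y i + b i / s)) \<longlongrightarrow> monom_eval \<alpha> y) at_top"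
      unfolding monom_eval_def by (intro tendsto_intros)
    have l2: "((\<lambda>s::real. s ^ mdegree \<alpha> / s ^ r) \<longlongrightarrow> (if mdegree \<alpha> = r then 1 else 0)) at_top"
    proof (cases "mdegree \<alpha> = r")
      case True
      have "eventually (\<lambda>s::real. s ^ mdegree \<alpha> / s ^ r = 1) at_top"
        using eventually_gt_at_top[of 0] by eventually_elim (simp add: True)
      then show ?thesis using True by (simp add: tendsto_eventually)
    next
      case False
      then have "r = Suc (r - mdegree \<alpha> - 1) + mdegree \<alpha>" using that by simp
      then obtain e where e: "r = Suc e + mdegree \<alpha>" ..
      have "((\<lambda>s::real. (1 / s) ^ Suc e) \<longlongrightarrow> 0 ^ Suc e) at_top" by (intro tendsto_power lim0)
      moreover have "eventually (\<lambda>s::real. (1 / s) ^ Suc e = s ^ mdegree \<alpha> / s ^ r) at_top"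
        using eventually_gt_at_top[of 0] by eventually_elim (simp add: e power_add power_divide field_simps)
      ultimately show ?thesis using False by (auto intro: Lim_transform_eventually)
    qed
    have "eventually (\<lambda>s::real. monom_eval \<alpha> (\<lambda>i. y i + b i / s) * (s ^ mdegree \<alpha> / s ^ r) =
        monom_eval \<alpha> (\<lambda>i. s * y i + b i) / s ^ r) at_top"
      using eventually_gt_at_top[of 0]
    proof eventually_elim
      case (elim s)
      have "(\<lambda>i. s * y i + b i) = (\<lambda>i. s * (y i + b i / s))" using elim by (simp add: distrib_left)
      then show ?case by (simp add: monom_eval_scale)
    qed
    from Lim_transform_eventually[OF tendsto_mult[OF l1 l2] this] show ?thesis by (simp split: if_splits)
  qed
  have "((\<lambda>s. \<Sum>\<alpha>\<in>keys p. lookup p \<alpha> * (monom_eval \<alpha> (\<lambda>i. s * y i + b i) / s ^ r)) \<longlongrightarrow>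
     (\<Sum>\<alpha>\<in>keys p. lookup p \<alpha> * (if mdegree \<alpha> = r then monom_eval \<alpha> y else 0))) at_top"
    by (intro tendsto_intros mono assms)
  also have "(\<Sum>\<alpha>\<in>keys p. lookup p \<alpha> * (if mdegree \<alpha> = r then monom_eval \<alpha> y else 0)) = meval (hom_part r p) y"
    by (subst meval_superset[of "keys p" "hom_part r p"])
      (auto simp: in_keys_iff lookup_hom_part intro!: sum.cong split: if_splits)
  finally show ?thesis by (simp add: meval_monom sum_divide_distrib)
qed

definition degree_le :: "nat \<Rightarrow> mpoly \<Rightarrow> bool"
  where "degree_le r p \<longleftrightarrow> (\<forall>\<alpha>. taylor p \<alpha> \<noteq> 0 \<longrightarrow> mdegree \<alpha> \<le> r)"

lemma degree_le_keys: "degree_le r p \<longleftrightarrow> (\<forall>\<alpha>\<in>keys p. mdegree \<alpha> \<le> r)"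
  by (auto simp: degree_le_def taylor_eq_0_iff in_keys_iff)

lemma degree_le_pderiv_var: "degree_le (Suc r) p \<Longrightarrow> degree_le r (pderiv_var i p)"
  unfolding degree_le_def taylor_pderiv_var shift_def by (fastforce simp: mdegree_add)

lemma degree_le_pderiv_multi: "degree_le (mdegree \<beta> + r) p \<Longrightarrow> degree_le r (pderiv_multi \<beta> p)"
  unfolding degree_le_def taylor_pderiv_multi shift_def by (fastforce simp: mdegree_add)

text \<open>The Rayleigh difference of the degree \<open>r\<close> part is the limit of that of \<open>p\<close> along the line,
  divided by \<open>s\<^sup>2\<^sup>r\<^sup>-\<^sup>2\<close>.\<close>
lemma rayleigh_diff_hom_part_nonneg:
  assumes deg: "degree_le r p" and r: "r \<ge> 2"
    and nn: "eventually (\<lambda>s. rayleigh_diff i j p (\<lambda>l. s * y l + b l) \<ge> 0) at_top"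
  shows "rayleigh_diff i j (hom_part r p) y \<ge> 0"
proof -
  obtain q where q: "r = Suc (Suc q)" using r by (metis add_2_eq_Suc le_Suc_ex)
  have d1: "degree_le (Suc q) (pderiv_var k p)" for k using deg q by (intro degree_le_pderiv_var) simp
  then have d2: "degree_le q (pderiv_var k (pderiv_var l p))" for k l by (rule degree_le_pderiv_var)
  have lim: "((\<lambda>s. meval p (\<lambda>l. s * y l + b l) / s ^ r) \<longlongrightarrow> meval (hom_part r p) y) at_top" if "degree_le r p" for p r
    using that by (intro meval_hom_part_limit) (auto simp: degree_le_keys)
  define Q where "Q f k s = meval f (\<lambda>l. s * y l + b l) / s ^ k" for f k and s :: real
  define R where "R s = Q (pderiv_var i p) (Suc q) s * Q (pderiv_var j p) (Suc q) s -
    Q p r s * Q (pderiv_var i (pderiv_var j p)) q s" for s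
  have "(R \<longlongrightarrow> meval (hom_part (Suc q) (pderiv_var i p)) y * meval (hom_part (Suc q) (pderiv_var j p)) y
      - meval (hom_part r p) y * meval (hom_part q (pderiv_var i (pderiv_var j p))) y) at_top"
    unfolding R_def Q_def by (intro tendsto_intros lim d1 d2 deg)
  then have l: "(R \<longlongrightarrow> rayleigh_diff i j (hom_part r p) y) at_top"
    by (simp add: rayleigh_diff_def q pderiv_var_hom_part)
  have "eventually (\<lambda>s. 0 \<le> R s) at_top"
    using nn eventually_gt_at_top[of 0]
  proof eventually_elim
    case (elim s)
    have "s ^ r * s ^ q = s ^ Suc q * s ^ Suc q" by (simp add: q)
    then have "R s = rayleigh_diff i j p (\<lambda>l. s * y l + b l) / (s ^ Suc q * s ^ Suc q)"
      unfolding R_def Q_def rayleigh_diff_def times_divide_times_eq by (simp only: diff_divide_distrib)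
    also have "\<dots> \<ge> 0" using elim by (intro divide_nonneg_nonneg) auto
    finally show ?case .
  qed
  then show ?thesis by (rule tendsto_lowerbound[OF l]) simp
qed

context
  fixes m d :: nat and g h :: mpoly and C :: "(nat \<Rightarrow> real) set"
  assumes g: "g \<in> polys m" "multi_affine g" and region: "garding_region m g C"
    and deg: "degree_le d g" and h: "h = hom_part d g"
begin

lemma region_nonempty: "C \<noteq> {}"
  using region by (simp add: garding_region_def)

text \<open>A coefficient of \<open>h\<close> is a derivative of \<open>g\<close> of the top order, hence a constant that is
  nonnegative on \<open>C\<close>.\<close>
lemma top_part_nonneg: "nonneg_coeffs h"
  unfolding nonneg_coeffs_def
proof
  fix \<sigma>
  obtain x0 where x0: "x0 \<in> C" using region_nonempty by blast
  show "lookup h \<sigma> \<ge> 0"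
  proof (cases "taylor h \<sigma> = 0")
    case False
    then have s: "mdegree \<sigma> = d" "taylor g \<sigma> \<noteq> 0" "taylor h \<sigma> = taylor g \<sigma>" by (auto simp: h taylor_hom_part split: if_splits)
    then have k: "keys \<sigma> \<subseteq> {..<m}" using g by (simp add: polys_iff_taylor)
    have "degree_le 0 (pderiv_multi \<sigma> g)" using deg s by (intro degree_le_pderiv_multi) simp
    then have "homog 0 (pderiv_multi \<sigma> g)" by (simp add: degree_le_def homog_iff_taylor)
    then have "meval (pderiv_multi \<sigma> g) x0 = taylor g \<sigma>"
      by (simp add: meval_homog_0 taylor_at_0[symmetric] taylor_pderiv_multi) (simp add: shift_def)
    then have "taylor h \<sigma> \<ge> 0" using region_derivatives(1)[OF g region k x0] s by simp
    then show ?thesis using mfact_pos[of \<sigma>] by (simp add: taylor_def zero_le_mult_iff)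
  qed (simp add: taylor_eq_0_iff)
qed

lemma top_part_polys: "h \<in> polys m" "homog d h"
  using g by (simp_all add: h polys_hom_part homog_hom_part)

lemma top_part_nonneg_form: "nonneg_form m d (taylor h)"
  using top_part_polys top_part_nonneg by (intro nonneg_form_taylor)

lemma top_part_derivative:
  assumes "mdegree \<beta> + r = d"
  shows "shift \<beta> (taylor h) = taylor (hom_part r (pderiv_multi \<beta> g))"
    "hom_part r (pderiv_multi \<beta> g) \<in> polys m" "homog r (hom_part r (pderiv_multi \<beta> g))"
    "degree_le r (pderiv_multi \<beta> g)"
proof -
  show "shift \<beta> (taylor h) = taylor (hom_part r (pderiv_multi \<beta> g))"
    unfolding pderiv_multi_hom_part[symmetric] taylor_pderiv_multi using assms by (simp add: h)
  show "hom_part r (pderiv_multi \<beta> g) \<in> polys m" using g by (intro polys_hom_part polys_pderiv_multi)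
  show "homog r (hom_part r (pderiv_multi \<beta> g))" by (rule homog_hom_part)
  show "degree_le r (pderiv_multi \<beta> g)" using deg assms by (intro degree_le_pderiv_multi) simp
qed

lemma top_part_rayleigh:
  assumes \<beta>: "keys \<beta> \<subseteq> {..<m}" and r: "mdegree \<beta> + r = d" "r \<ge> 2"
  shows "rayleigh m r (shift \<beta> (taylor h))"
  unfolding rayleigh_def
proof (intro allI impI)
  fix x :: "nat \<Rightarrow> real" and i j assume x: "\<forall>k. 0 \<le> x k" and ij: "i < m" "j < m"
  obtain x0 where x0: "x0 \<in> C" using region_nonempty by blast
  define p where "p = pderiv_multi \<beta> g"
  define q where "q = hom_part r p"
  note tp = top_part_derivative[OF r(1), folded p_def, folded q_def]
  have pm: "p \<in> polys m" unfolding p_def using g by (intro polys_pderiv_multi)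
  have "eventually (\<lambda>s. rayleigh_diff i j p (\<lambda>l. s * x l + x0 l) \<ge> 0) at_top"
    using eventually_ge_at_top[of 0]
  proof eventually_elim
    case (elim s)
    define z where "z = (\<lambda>l. if l < m then x0 l + s * x l else x0 l)"
    have "z \<in> C" unfolding z_def using elim x by (intro region_add[OF g region x0]) simp
    then have "rayleigh_diff i j p z \<ge> 0" unfolding p_def using region_derivatives(2)[OF g region \<beta>] ij by simp
    also have "rayleigh_diff i j p z = rayleigh_diff i j p (\<lambda>l. s * x l + x0 l)"
      unfolding rayleigh_diff_def using pm
      by (intro arg_cong2[where f = "(-)"] arg_cong2[where f = "(*)"] meval_cong[of _ m]) (auto intro: polys_pderiv_var simp: z_def)
    finally show ?case .
  qed
  then have "rayleigh_diff i j q x \<ge> 0" unfolding q_def using tp(4) r(2) by (intro rayleigh_diff_hom_part_nonneg)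
  then have le: "meval q x * meval (pderiv_var i (pderiv_var j q)) x \<le> meval (pderiv_var i q) x * meval (pderiv_var j q) x"
    by (simp add: rayleigh_diff_def)
  obtain e where e: "r = Suc (Suc e)" using r(2) by (metis add_2_eq_Suc le_Suc_ex)
  have hq: "homog (Suc e) (pderiv_var k q)" for k using tp(3) by (intro homog_pderiv_var) (simp add: e)
  then have hq2: "homog e (pderiv_var k (pderiv_var l q))" for k l by (rule homog_pderiv_var)
  have v0: "(contract m x ^^ r) (taylor q) 0 = fact r * meval q x"
    using meval_contract_pow[OF tp(2,3), where x = x] by simp
  have v1: "(contract m x ^^ (r - 1)) (taylor q) (unit_exp k) = fact (r - 1) * meval (pderiv_var k q) x" for k
    using meval_contract_pow[OF polys_pderiv_var[OF tp(2)] hq[of k], where x = x]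
    by (simp add: e taylor_pderiv_var contract_pow_shift del: funpow.simps)
  have v2: "(contract m x ^^ (r - 2)) (taylor q) (unit_exp i + unit_exp j) = fact (r - 2) * meval (pderiv_var i (pderiv_var j q)) x"
    using meval_contract_pow[OF polys_pderiv_var[OF polys_pderiv_var[OF tp(2)]] hq2, where x = x]
    by (simp add: e taylor_pderiv_var shift_shift contract_pow_shift)
  have fac: "(real r - 1) * (fact r * fact (r - 2)) = r * (fact (r - 1) * fact (r - 1))"
    by (simp add: e algebra_simps)
  have "(real r - 1) * (fact r * meval q x) * (fact (r - 2) * meval (pderiv_var i (pderiv_var j q)) x) =
     r * (fact (r - 1) * fact (r - 1)) * (meval q x * meval (pderiv_var i (pderiv_var j q)) x)"
    unfolding fac[symmetric] by (simp add: mult_ac)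
  also have "\<dots> \<le> r * (fact (r - 1) * fact (r - 1)) * (meval (pderiv_var i q) x * meval (pderiv_var j q) x)"
    by (intro mult_left_mono le) simp
  finally show "(real r - 1) * (contract m x ^^ r) (shift \<beta> (taylor h)) 0 * (contract m x ^^ (r - 2)) (shift \<beta> (taylor h)) (unit_exp i + unit_exp j)
     \<le> r * ((contract m x ^^ (r - 1)) (shift \<beta> (taylor h)) (unit_exp i) * (contract m x ^^ (r - 1)) (shift \<beta> (taylor h)) (unit_exp j))"
    unfolding tp(1) v0 v1 v2 by (simp add: mult_ac)
qed

text \<open>Since \<open>\<partial>\<^sub>i\<partial>\<^sub>j\<partial>\<^sup>\<beta>h \<noteq> 0\<close>, the monomial \<open>\<sigma> = \<beta> + e\<^sub>i + e\<^sub>j\<close> occurs in \<open>h\<close>, and \<open>g\<close> tends to infinity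
  in the direction \<open>w = 1\<^sub>\<sigma>\<close> from every starting point. A walk from a point of \<open>C\<close> to any \<open>y\<close>,
  translated by \<open>sw\<close> with \<open>s\<close> large, therefore stays in \<open>C\<close> and ends at \<open>y + sw\<close>. The Rayleigh difference of \<open>\<partial>\<^sup>\<beta>g\<close> in \<open>i\<close> and \<open>j\<close> does not depend
  on the variables of \<open>\<sigma>\<close>, so it is nonnegative at \<open>y\<close> as well.\<close>
lemma top_part_rayleigh_quadratic:
  assumes \<beta>: "keys \<beta> \<subseteq> {..<m}" "mdegree \<beta> + 2 = d" and ij: "i < m" "j < m"
    and pos: "hess (shift \<beta> (taylor h)) i j > 0"
  shows "bil m (hess (shift \<beta> (taylor h))) x x * hess (shift \<beta> (taylor h)) i j \<le>
     2 * ((\<Sum>k<m. x k * hess (shift \<beta> (taylor h)) i k) * (\<Sum>k<m. x k * hess (shift \<beta> (taylor h)) j k))"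
proof -
  obtain x0 where x0: "x0 \<in> C" using region_nonempty by blast
  define p where "p = pderiv_multi \<beta> g"
  define q where "q = hom_part 2 p"
  define \<sigma> where "\<sigma> = unit_exp i + unit_exp j + \<beta>"
  define w where "w k = (if k \<in> keys \<sigma> then 1 else 0 :: real)" for k
  note tp = top_part_derivative[OF \<beta>(2), folded p_def, folded q_def]
  have pm: "p \<in> polys m" unfolding p_def using g by (intro polys_pderiv_multi)
  have pa: "multi_affine p" unfolding p_def by (intro multi_affine_pderiv_multi g)
  have hs: "taylor h \<sigma> > 0" using pos by (simp add: hess_def shift_def \<sigma>_def)
  then have gs: "taylor g \<sigma> \<noteq> 0" by (auto simp: h taylor_hom_part split: if_splits)
  then have s1: "lookup \<sigma> k \<le> 1" for k using g by (simp add: multi_affine_iff_taylor)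
  have s1E: "(if i = k then 1 else 0) + (if j = k then 1 else 0) + lookup \<beta> k \<le> 1" for k
    using s1[of k] by (simp add: \<sigma>_def lookup_add lookup_unit_exp)
  have inej: "i \<noteq> j" using s1E[of i] by (auto split: if_splits)
  have hw: "meval h w > 0"
  proof -
    have "lookup h \<sigma> > 0" using hs mfact_pos[of \<sigma>] by (simp add: taylor_def zero_less_mult_iff)
    moreover have "monom_eval \<sigma> w = 1" by (simp add: monom_eval_def w_def)
    ultimately have "0 < lookup h \<sigma> * monom_eval \<sigma> w" by simp
    also have "\<dots> \<le> (\<Sum>\<alpha>\<in>keys h. lookup h \<alpha> * monom_eval \<alpha> w)"
      using \<open>lookup h \<sigma> > 0\<close> top_part_nonneg
      by (intro member_le_sum) (auto simp: in_keys_iff nonneg_coeffs_def monom_eval_def w_def intro!: mult_nonneg_nonneg prod_nonneg)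
    finally show ?thesis by (simp add: meval_monom)
  qed
  have shift_w: "rayleigh_diff i j p (z(k := z k + t)) = rayleigh_diff i j p z" if "k \<in> keys \<sigma>" for z k t
  proof -
    have "k \<in> keys \<beta> \<or> k = i \<or> k = j" using that by (auto simp: \<sigma>_def keys_add_nat)
    then consider "lookup \<beta> k > 0" | "k = i" | "k = j" by (auto simp: in_keys_iff)
    then show ?thesis
    proof cases
      case 1
      then have "pderiv_var k p = 0" unfolding p_def by (intro multi_affine_pderiv_twice g)
      then show ?thesis unfolding rayleigh_diff_update[OF pa]
        by (simp add: rayleigh_diff_def)
    next
      case 2
      have z1: "pderiv_var i (pderiv_var i p) = 0" using pa by (rule multi_affine_pderiv_var_twice)
      have z2: "pderiv_var i (pderiv_var j (pderiv_var i p)) = 0"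
        by (subst pderiv_var_commute) (simp add: z1)
      show ?thesis unfolding rayleigh_diff_update[OF pa] 2
        using z2 by (simp add: rayleigh_diff_def z1 pderiv_var_commute[of j i])
    next
      case 3
      have z1: "pderiv_var j (pderiv_var j p) = 0" using pa by (rule multi_affine_pderiv_var_twice)
      have z2: "pderiv_var i (pderiv_var j (pderiv_var j p)) = 0" by (simp add: z1)
      show ?thesis unfolding rayleigh_diff_update[OF pa] 3
        by (simp add: rayleigh_diff_def z1 z2)
    qed
  qed
  have shift_all: "rayleigh_diff i j p (\<lambda>k. s * w k + z k) = rayleigh_diff i j p z" for s z
  proof -
    have "rayleigh_diff i j p (\<lambda>k. (if k \<in> A then s else 0) + z k) = rayleigh_diff i j p z"
      if "finite A" "A \<subseteq> keys \<sigma>" for A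
      using that
    proof (induction A rule: finite_induct)
      case (insert a A)
      define y where "y = (\<lambda>k. (if k \<in> A then s else 0) + z k)"
      have "(\<lambda>k. (if k \<in> insert a A then s else 0) + z k) = y(a := y a + s)"
        using insert.hyps by (auto simp: y_def fun_eq_iff)
      then show ?case using insert shift_w[of a y s] by (simp add: y_def)
    qed simp
    from this[of "keys \<sigma>"] show ?thesis
      by (simp add: w_def if_distrib cong: if_cong)
  qed
  have all: "rayleigh_diff i j p y \<ge> 0" for y
  proof -
    (* the corners of a walk from x0 to y *)
    define V where "V k l = (if l < k then y l else x0 l)" for k l
    have "eventually (\<lambda>s. \<forall>k\<in>{..m}. meval g (\<lambda>l. s * w l + V k l) > 0) at_top"
    proof (rule eventually_ball_finite)
      show "\<forall>k\<in>{..m}. eventually (\<lambda>s. meval g (\<lambda>l. s * w l + V k l) > 0) at_top"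
      proof
        fix k
        have "((\<lambda>s. meval g (\<lambda>l. s * w l + V k l) / s ^ d) \<longlongrightarrow> meval h w) at_top"
          unfolding h using deg by (intro meval_hom_part_limit) (auto simp: degree_le_keys)
        then have "eventually (\<lambda>s. meval g (\<lambda>l. s * w l + V k l) / s ^ d > 0) at_top"
          using hw by (rule order_tendstoD)
        then show "eventually (\<lambda>s. meval g (\<lambda>l. s * w l + V k l) > 0) at_top"
          using eventually_gt_at_top[of 0] by eventually_elim (simp add: zero_less_divide_iff)
      qed
    qed simp
    then have "eventually (\<lambda>s. s \<ge> 0 \<and> (\<forall>k\<in>{..m}. meval g (\<lambda>l. s * w l + V k l) > 0)) at_top"
      using eventually_ge_at_top[of 0] by eventually_elim simp
    then obtain s where s: "s \<ge> 0" "\<And>k. k \<le> m \<Longrightarrow> meval g (\<lambda>l. s * w l + V k l) > 0"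
      by (auto dest: eventually_happens'[rotated] simp: trivial_limit_at_top_linorder)
    define x1 where "x1 = (\<lambda>l. if l < m then x0 l + s * w l else x0 l)"
    have x1: "x1 \<in> C" unfolding x1_def using s by (intro region_add[OF g region x0]) (simp add: w_def)
    have "(\<lambda>l. if l < m then s * w l + y l else x1 l) \<in> C"
    proof (rule region_walk[OF g region x1])
      fix k assume k: "k \<le> m"
      have "meval g (\<lambda>l. s * w l + V k l) = meval g (\<lambda>l. if l < k then s * w l + y l else x1 l)"
        by (intro meval_cong[OF g(1)]) (simp add: V_def x1_def)
      then show "meval g (\<lambda>l. if l < k then s * w l + y l else x1 l) > 0" using s(2)[OF k] by simp
    qed
    then have "rayleigh_diff i j p (\<lambda>l. if l < m then s * w l + y l else x1 l) \<ge> 0"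
      unfolding p_def using region_derivatives(2)[OF g region \<beta>(1)] ij by simp
    also have "rayleigh_diff i j p (\<lambda>l. if l < m then s * w l + y l else x1 l) = rayleigh_diff i j p (\<lambda>l. s * w l + y l)"
      unfolding rayleigh_diff_def using pm
      by (intro arg_cong2[where f = "(-)"] arg_cong2[where f = "(*)"] meval_cong[of _ m]) (auto intro: polys_pderiv_var)
    finally show ?thesis by (simp add: shift_all)
  qed
  then have "rayleigh_diff i j q x \<ge> 0" unfolding q_def using tp(4)
    by (intro rayleigh_diff_hom_part_nonneg[where b = "\<lambda>_. 0"]) auto
  then have le: "meval q x * meval (pderiv_var i (pderiv_var j q)) x \<le> meval (pderiv_var i q) x * meval (pderiv_var j q) x"
    by (simp add: rayleigh_diff_def)
  have hq: "homog (Suc 0) (pderiv_var k q)" for k using tp(3) by (intro homog_pderiv_var) (simp add: numeral_2_eq_2)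
  then have hq2: "homog 0 (pderiv_var k (pderiv_var l q))" for k l by (rule homog_pderiv_var)
  have v0: "bil m (hess (taylor q)) x x = 2 * meval q x"
    using meval_contract_pow[OF tp(2,3), where x = x] by (simp add: bil_hess numeral_2_eq_2)
  have v1: "(\<Sum>l<m. x l * hess (taylor q) k l) = meval (pderiv_var k q) x" for k
    using meval_contract_pow[OF polys_pderiv_var[OF tp(2)] hq[of k], where x = x]
    by (simp add: taylor_pderiv_var contract_shift) (simp add: hess_def contract_def shift_def add.commute)
  have v2: "hess (taylor q) i j = meval (pderiv_var i (pderiv_var j q)) x"
    by (simp add: meval_homog_0[OF hq2] taylor_at_0[symmetric] taylor_pderiv_var) (simp add: hess_def shift_def)
  show ?thesis unfolding tp(1) v0 v1 v2 using le by simp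
qed

theorem top_part_lorentz:
  assumes "\<forall>v\<in>set vs. \<forall>i. v i \<ge> 0" "length vs + 2 = d"
  shows "lorentz m (hess (contracts m vs (taylor h)))"
proof -
  have "lorentz m (hess (contracts m vs (shift 0 (taylor h))))"
    by (rule lorentz_contracts[OF top_part_nonneg_form top_part_rayleigh top_part_rayleigh_quadratic assms(1)])
      (use assms(2) in simp_all)
  then show ?thesis by (simp add: shift_def)
qed

end

section \<open>Homogeneous Garding polynomials are Lorentzian\<close>

lemma Euclidean_space_top_of_set: "Euclidean_space n = top_of_set {x. \<forall>i\<ge>n. x i = 0}"
  by (simp add: Euclidean_space_def euclidean_product_topology)

lemma subtopology_pos_set: "subtopology (Euclidean_space n) (pos_set n g) = top_of_set (pos_set n g)"
  unfolding Euclidean_space_top_of_set subtopology_subtopology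
  by (rule arg_cong2[where f = subtopology]) (auto simp: pos_set_def topspace_Euclidean_space)

lemma closed_nonneg_coordinates:
  "closed {x :: nat \<Rightarrow> real. (\<forall>i<n. x i \<ge> 0) \<and> (\<forall>i\<ge>n. x i = 0)}"
proof -
  have "{x :: nat \<Rightarrow> real. (\<forall>i<n. x i \<ge> 0) \<and> (\<forall>i\<ge>n. x i = 0)} =
    (\<Inter>i\<in>{..<n}. {x. 0 \<le> x i}) \<inter> (\<Inter>i\<in>{n..}. {x. x i = 0})" by auto
  also have "closed \<dots>"
    by (intro closed_Int closed_INT ballI closed_Collect_le closed_Collect_eq continuous_intros)
  finally show ?thesis .
qed

lemma continuous_on_line: "continuous_on S (\<lambda>t. (\<lambda>i. x i + t * v i) :: nat \<Rightarrow> real)"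
  by (intro continuous_on_coordinatewise_then_product) (auto intro!: continuous_intros)

lemma closure_pos_orthant:
  "Euclidean_space n closure_of pos_orthant n = {x. (\<forall>i<n. x i \<ge> 0) \<and> (\<forall>i\<ge>n. x i = 0)}"
proof (rule antisym)
  have "Euclidean_space n closure_of pos_orthant n \<subseteq> closure (pos_orthant n)"
    unfolding Euclidean_space_top_of_set closure_of_subtopology euclidean_closure_of
    using closure_mono[of "{x. \<forall>i\<ge>n. x i = 0} \<inter> pos_orthant n" "pos_orthant n"] by blast
  also have "\<dots> \<subseteq> {x. (\<forall>i<n. x i \<ge> 0) \<and> (\<forall>i\<ge>n. x i = 0)}"
    by (rule closure_minimal[OF _ closed_nonneg_coordinates])
      (auto simp: pos_orthant_def topspace_Euclidean_space less_imp_le)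
  finally show "Euclidean_space n closure_of pos_orthant n \<subseteq> {x. (\<forall>i<n. x i \<ge> 0) \<and> (\<forall>i\<ge>n. x i = 0)}" .
next
  have sub: "pos_orthant n \<subseteq> {x. \<forall>i\<ge>n. x i = 0}" by (auto simp: pos_orthant_def topspace_Euclidean_space)
  show "{x. (\<forall>i<n. x i \<ge> 0) \<and> (\<forall>i\<ge>n. x i = 0)} \<subseteq> Euclidean_space n closure_of pos_orthant n"
  proof
    fix x :: "nat \<Rightarrow> real" assume x: "x \<in> {x. (\<forall>i<n. x i \<ge> 0) \<and> (\<forall>i\<ge>n. x i = 0)}"
    define f where "f t = (\<lambda>i. x i + t * (if i < n then 1 else 0))" for t :: real
    have "f ` closure {0<..} \<subseteq> closure (pos_orthant n)"
    proof (rule image_closure_subset)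
      show "continuous_on (closure {0<..}) f" unfolding f_def
        by (rule continuous_on_line)
      have "f ` {0<..} \<subseteq> pos_orthant n"
        using x by (auto simp: f_def pos_orthant_def topspace_Euclidean_space intro: add_nonneg_pos)
      then show "f ` {0<..} \<subseteq> closure (pos_orthant n)" using closure_subset by blast
    qed simp
    moreover have "f 0 = x" by (auto simp: f_def)
    moreover have "(0::real) \<in> closure {0<..}" by simp
    ultimately have "x \<in> closure (pos_orthant n)" by (metis image_subset_iff)
    then show "x \<in> Euclidean_space n closure_of pos_orthant n"
      unfolding Euclidean_space_top_of_set closure_of_subtopology euclidean_closure_of
      using x sub by (simp add: Int_absorb1)
  qed
qed

text \<open>\<open>g\<close> is affine on a coordinate segment, so it is positive on the whole segment if it is
  positive at both ends. The segment then lies in the component of its starting point.\<close>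
lemma multi_affine_garding_region:
  assumes g: "g \<in> polys m" "multi_affine g"
    and C: "C \<in> connected_components_of (subtopology (Euclidean_space m) (pos_set m g))" "passes_PRT m C"
  shows "garding_region m g C" "\<And>x i. x \<in> C \<Longrightarrow> i \<ge> m \<Longrightarrow> x i = 0"
proof -
  have Csub: "C \<subseteq> pos_set m g"
    using connected_components_of_subset[OF C(1)] by (simp add: subtopology_pos_set)
  then show C0: "\<And>x i. x \<in> C \<Longrightarrow> i \<ge> m \<Longrightarrow> x i = 0" by (auto simp: pos_set_def topspace_Euclidean_space)
  show "garding_region m g C"
    unfolding garding_region_def
  proof (intro conjI ballI allI impI)
    show "C \<noteq> {}" using C(1) by (rule nonempty_connected_components_of)
    fix x assume x: "x \<in> C"
    show "meval g x > 0" using x Csub by (auto simp: pos_set_def)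
    fix k assume k: "k < m"
    {
      fix t :: real assume "t \<ge> 0"
      then have "(\<lambda>i. if i = k then t else 0) \<in> Euclidean_space m closure_of pos_orthant m"
        using k by (simp add: closure_pos_orthant)
      then have "(\<lambda>i. x i + (if i = k then t else 0)) \<in> C"
        using C(2) x unfolding passes_PRT_def by blast
      also have "(\<lambda>i. x i + (if i = k then t else 0)) = x(k := x k + t)" by auto
      finally show "x(k := x k + t) \<in> C" .
    }
    fix t assume pos: "meval g (x(k := x k + t)) > 0"
    define f where "f s = (\<lambda>i. x i + s * (if i = k then t else 0))" for s :: real
    have f: "f s = x(k := x k + s * t)" for s by (auto simp: f_def)
    have "connected (f ` {0..1})" unfolding f_def by (intro connected_continuous_image continuous_on_line) simp
    moreover have "f ` {0..1} \<subseteq> pos_set m g"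
    proof
      fix y assume "y \<in> f ` {0..1}"
      then obtain s where s: "0 \<le> s" "s \<le> 1" "y = f s" by auto
      have "meval g y = (1 - s) * meval g x + s * meval g (x(k := x k + t))"
        unfolding s(3) f multi_affine_meval_update[OF g(2)] by (simp add: algebra_simps)
      also have "\<dots> > 0"
        using s pos \<open>meval g x > 0\<close> by (cases "s = 0") (auto intro: add_nonneg_pos)
      finally have "meval g y > 0" .
      moreover have "y i = 0" if "i \<ge> m" for i using that k C0[OF x] by (simp add: s(3) f)
      ultimately show "y \<in> pos_set m g" by (simp add: pos_set_def topspace_Euclidean_space)
    qed
    ultimately have "connectedin (subtopology (Euclidean_space m) (pos_set m g)) (f ` {0..1})"
      by (simp add: subtopology_pos_set connectedin_subtopology)
    moreover have "x \<in> f ` {0..1}" using f[of 0] by (auto intro!: image_eqI[of _ _ 0])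
    then have "\<not> disjnt C (f ` {0..1})" using x by (auto simp: disjnt_def)
    ultimately have "f ` {0..1} \<subseteq> C" using connected_components_of_maximal[OF C(1)] by blast
    then have "f 1 \<in> C" by auto
    then show "x(k := x k + t) \<in> C" using f[of 1] by simp
  qed
qed

text \<open>The main point is that \<open>f(x) = h(Ax)\<close> when \<open>f\<close> does not vanish. Both sides of \<open>s\<^sup>d f(x) = g(sAx + b)\<close> are compared as
  \<open>s\<close> tends to infinity. As the rows of \<open>A\<close> have positive sums, \<open>A1\<close> is a positive vector and
  \<open>h(A1) > 0\<close>, which forces the degree of \<open>g\<close> to be \<open>d\<close>.\<close>
theorem garding_imp_lorentzian:
  assumes f: "homog d f" and gar: "garding n f"
  shows "lorentzian n d f"
proof -
  have fn: "f \<in> polys n" using gar by (simp add: garding_def)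
  obtain m g \<mu> where g: "multi_affine_garding m g" and mu: "strictly_positive_affine n m \<mu>"
    and fg: "\<And>x. x \<in> topspace (Euclidean_space n) \<Longrightarrow> meval f x = meval g (\<mu> x)"
    using gar unfolding garding_def by blast
  have gm: "g \<in> polys m" "multi_affine g" using g by (auto simp: multi_affine_garding_def)
  obtain A0 b0 where A0: "\<And>i j. i < m \<Longrightarrow> j < n \<Longrightarrow> A0 i j \<ge> 0" "\<And>i. i < m \<Longrightarrow> (\<Sum>j<n. A0 i j) > 0"
    and mu': "\<And>x. x \<in> topspace (Euclidean_space n) \<Longrightarrow>
      \<mu> x = (\<lambda>i. if i < m then (\<Sum>j<n. A0 i j * x j) + b0 i else 0)"
    using mu unfolding strictly_positive_affine_def by blast
  define A where "A i j = (if i < m \<and> j < n then A0 i j else 0)" for i j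
  have Ann: "A i j \<ge> 0" for i j using A0 by (simp add: A_def)
  have fA: "meval f x = meval g (\<lambda>i. lin_map n A x i + b0 i)" for x :: "nat \<Rightarrow> real"
  proof -
    define x' where "x' i = (if i < n then x i else 0)" for i
    have x': "x' \<in> topspace (Euclidean_space n)" by (simp add: x'_def topspace_Euclidean_space)
    have "meval f x = meval f x'" by (rule meval_cong[OF fn]) (simp add: x'_def)
    also have "\<dots> = meval g (\<mu> x')" by (rule fg[OF x'])
    also have "\<dots> = meval g (\<lambda>i. lin_map n A x i + b0 i)"
      unfolding mu'[OF x'] by (rule meval_cong[OF gm(1)]) (simp add: lin_map_def A_def x'_def)
    finally show ?thesis .
  qed
  have scaled: "s ^ d * meval f x = meval g (\<lambda>i. s * lin_map n A x i + b0 i)" for s and x :: "nat \<Rightarrow> real"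
  proof -
    have "lin_map n A (\<lambda>i. s * x i) = (\<lambda>i. s * lin_map n A x i)"
      by (simp add: lin_map_def sum_distrib_left mult_ac)
    then show ?thesis using fA[of "\<lambda>i. s * x i"] meval_homog_scale[OF f, of s x] by simp
  qed
  show ?thesis
  proof (cases "\<forall>x :: nat \<Rightarrow> real. meval f x = 0")
    case True
    have "hess (contracts m vs (taylor 0)) = (\<lambda>_ _. 0)" for vs
      unfolding hess_def by (intro ext contracts_eq_0I) (simp add: taylor_def)
    then have "lorentz m (hess (contracts m vs (taylor 0)))" for vs by (simp add: lorentz_def bil_def)
    moreover have "(0 :: mpoly) \<in> polys m" "homog d 0" "nonneg_coeffs 0"
      by (simp_all add: polys_def homog_def nonneg_coeffs_def)
    ultimately show ?thesis
      using True by (intro lorentzian_substitution[OF fn f, of 0 m A] Ann) auto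
  next
    case False
    have g0: "g \<noteq> 0" using False fA by auto
    then obtain C where C: "C \<in> connected_components_of (subtopology (Euclidean_space m) (pos_set m g))" "passes_PRT m C"
      using g by (auto simp: multi_affine_garding_def)
    note region = multi_affine_garding_region(1)[OF gm C]
    define D where "D = Max (mdegree ` keys g)"
    have degD: "degree_le D g" unfolding degree_le_keys D_def by auto
    obtain \<sigma> where \<sigma>: "\<sigma> \<in> keys g" "mdegree \<sigma> = D"
    proof -
      have "keys g \<noteq> {}" using g0 by simp
      then have "D \<in> mdegree ` keys g" unfolding D_def by (intro Max_in) auto
      then show ?thesis using that by auto
    qed
    define h where "h = hom_part D g"
    note nonneg = top_part_nonneg[OF gm region degD h_def]
    have hpos: "meval h y > 0" if y: "\<And>i. i < m \<Longrightarrow> y i > 0" for y :: "nat \<Rightarrow> real"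
    proof -
      have hm: "h \<in> polys m" unfolding h_def by (rule polys_hom_part[OF gm(1)])
      have \<sigma>h: "\<sigma> \<in> keys h" using \<sigma> by (simp add: h_def in_keys_iff lookup_hom_part)
      have mp: "monom_eval \<alpha> y > 0" if "\<alpha> \<in> keys h" for \<alpha>
      proof -
        have "keys \<alpha> \<subseteq> {..<m}" using that hm by (auto simp: polys_def)
        then show ?thesis unfolding monom_eval_def by (intro prod_pos ballI zero_less_power y) auto
      qed
      have "0 < lookup h \<sigma> * monom_eval \<sigma> y"
        using mp[OF \<sigma>h] nonneg \<sigma>h by (auto simp: nonneg_coeffs_def in_keys_iff less_le)
      also have "\<dots> \<le> meval h y" unfolding meval_monom of_real_eq_id id_apply
        using \<sigma>h nonneg mp by (intro member_le_sum) (auto simp: nonneg_coeffs_def less_imp_le)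
      finally show ?thesis .
    qed
    have lim: "((\<lambda>s. s ^ d * meval f x / s ^ D) \<longlongrightarrow> meval h (lin_map n A x)) at_top" for x :: "nat \<Rightarrow> real"
      unfolding scaled h_def using degD by (intro meval_hom_part_limit) (auto simp: degree_le_keys)
    have lim0: "((\<lambda>s. c / s) \<longlongrightarrow> 0) at_top" for c :: real
      by (intro tendsto_divide_0[OF tendsto_const] filterlim_at_top_imp_at_infinity filterlim_ident)
    define one where "one = (\<lambda>i::nat. 1 :: real)"
    have h1: "meval h (lin_map n A one) > 0"
      using A0(2) by (intro hpos) (simp add: lin_map_def one_def A_def)
    have dD: "d = D"
    proof (rule ccontr)
      assume "d \<noteq> D"
      then consider "d < D" | "D < d" by linarith
      then show False
      proof cases
        case 1
        then obtain e where e: "D = d + Suc e" using less_iff_Suc_add by auto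
        have "((\<lambda>s. meval f one / s * (1 / s) ^ e) \<longlongrightarrow> 0 * 0 ^ e) at_top"
          by (intro tendsto_intros lim0)
        moreover have "eventually (\<lambda>s. meval f one / s * (1 / s) ^ e = s ^ d * meval f one / s ^ D) at_top"
          using eventually_gt_at_top[of "0::real"] by eventually_elim (simp add: e power_add power_divide field_simps)
        ultimately have "((\<lambda>s. s ^ d * meval f one / s ^ D) \<longlongrightarrow> 0) at_top"
          using Lim_transform_eventually by fastforce
        then have "meval h (lin_map n A one) = 0"
          using lim tendsto_unique trivial_limit_at_top_linorder by blast
        then show False using h1 by simp
      next
        case 2
        then obtain e where e: "d = D + Suc e" using less_iff_Suc_add by auto
        have "((\<lambda>s. s ^ d * meval f one / s ^ D * (1 / s) ^ Suc e) \<longlongrightarrow> meval h (lin_map n A one) * 0 ^ Suc e) at_top"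
          by (intro tendsto_intros lim lim0)
        moreover have "eventually (\<lambda>s. s ^ d * meval f one / s ^ D * (1 / s) ^ Suc e = meval f one) at_top"
          using eventually_gt_at_top[of "0::real"] by eventually_elim (simp add: e power_add power_divide field_simps)
        ultimately have "((\<lambda>s::real. meval f one) \<longlongrightarrow> 0) at_top"
          using Lim_transform_eventually by fastforce
        then have "meval f one = 0" by (simp add: tendsto_const_iff trivial_limit_at_top_linorder)
        then have "((\<lambda>s::real. 0) \<longlongrightarrow> meval h (lin_map n A one)) at_top" using lim[of one] by simp
        then show False using h1 by (simp add: tendsto_const_iff trivial_limit_at_top_linorder)
      qed
    qed
    have fh: "meval f x = meval h (lin_map n A x)" for x :: "nat \<Rightarrow> real"
    proof -
      have "eventually (\<lambda>s. s ^ d * meval f x / s ^ D = meval f x) at_top"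
        using eventually_gt_at_top[of "0::real"] by eventually_elim (simp add: dD)
      then have "((\<lambda>s. s ^ d * meval f x / s ^ D) \<longlongrightarrow> meval f x) at_top" by (rule tendsto_eventually)
      then show ?thesis using lim tendsto_unique trivial_limit_at_top_linorder by blast
    qed
    have deg: "degree_le d g" and hd: "h = hom_part d g" using degD h_def dD by simp_all
    show ?thesis
      by (rule lorentzian_substitution[OF fn f top_part_polys[OF gm region deg hd] nonneg Ann fh
            top_part_lorentz[OF gm region deg hd]])
  qed
qed

section \<open>Polarization of stable polynomials\<close>

text \<open>The image of the closed lower half-plane, together with infinity, under \<open>a \<mapsto> 1 / (t - a)\<close>,
  where \<open>\<tau>\<close> is the imaginary part of \<open>t\<close>.\<close>

definition lower_disc :: "real \<Rightarrow> complex set"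
  where "lower_disc \<tau> = cball (- (\<i> / of_real (2 * \<tau>))) (1 / (2 * \<tau>))"

lemma lower_disc_iff:
  assumes "\<tau> > 0"
  shows "w \<in> lower_disc \<tau> \<longleftrightarrow> \<tau> * (cmod w)\<^sup>2 + Im w \<le> 0"
proof -
  have "w \<in> lower_disc \<tau> \<longleftrightarrow> cmod (w + \<i> / of_real (2 * \<tau>)) \<le> 1 / (2 * \<tau>)"
    unfolding lower_disc_def mem_cball dist_norm norm_minus_commute[of _ w] diff_minus_eq_add ..
  also have "\<dots> \<longleftrightarrow> (cmod (w + \<i> / of_real (2 * \<tau>)))\<^sup>2 \<le> (1 / (2 * \<tau>))\<^sup>2"
    using abs_le_square_iff[of "cmod (w + \<i> / of_real (2 * \<tau>))" "1 / (2 * \<tau>)"] assms by simp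
  also have "(cmod (w + \<i> / of_real (2 * \<tau>)))\<^sup>2 = (cmod w)\<^sup>2 + Im w / \<tau> + (1 / (2 * \<tau>))\<^sup>2"
  proof -
    have "\<i> / of_real (2 * \<tau>) = Complex 0 (1 / (2 * \<tau>))" by (simp add: complex_eq_iff)
    then have "(cmod (w + \<i> / of_real (2 * \<tau>)))\<^sup>2 = (Re w)\<^sup>2 + (Im w + 1 / (2 * \<tau>))\<^sup>2"
      by (simp only: cmod_power2) simp
    moreover have "(Im w + 1 / (2 * \<tau>))\<^sup>2 = (Im w)\<^sup>2 + Im w / \<tau> + (1 / (2 * \<tau>))\<^sup>2"
      using assms by (simp add: power2_eq_square field_simps)
    ultimately show ?thesis by (simp add: cmod_power2)
  qed
  finally have "w \<in> lower_disc \<tau> \<longleftrightarrow> (cmod w)\<^sup>2 + Im w / \<tau> \<le> 0" by simp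
  also have "\<dots> \<longleftrightarrow> \<tau> * (cmod w)\<^sup>2 + Im w \<le> 0"
    using assms by (simp add: field_simps)
  finally show ?thesis .
qed

lemma inverse_in_lower_disc_iff:
  assumes "Im t > 0" "t \<noteq> a"
  shows "1 / (t - a) \<in> lower_disc (Im t) \<longleftrightarrow> Im a \<le> 0"
proof -
  have pos: "(cmod (t - a))\<^sup>2 > 0" using assms by simp
  have "Im (1 / (t - a)) = - (Im t - Im a) / (cmod (t - a))\<^sup>2"
    by (simp add: Im_divide cmod_power2)
  then have "Im t * (cmod (1 / (t - a)))\<^sup>2 + Im (1 / (t - a)) = Im a / (cmod (t - a))\<^sup>2"
    by (simp add: norm_divide power_divide diff_divide_distrib)
  then show ?thesis unfolding lower_disc_iff[OF assms(1)] using pos by (simp add: divide_le_0_iff)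
qed

text \<open>\<open>p'(t) / p(t)\<close> is the sum of \<open>1 / (t - a)\<close> over the zeros \<open>a\<close> of \<open>p\<close>, so its quotient by
  the degree is an average of points of the disc.\<close>
lemma log_deriv_in_lower_disc:
  assumes "Im t > 0" "\<And>z. Im z > 0 \<Longrightarrow> poly p z \<noteq> 0"
  shows "\<exists>w\<in>lower_disc (Im t). poly (pderiv p) t = of_nat (degree p) * w * poly p t"
  using assms(2)
proof (induction "degree p" arbitrary: p)
  case 0
  then have "pderiv p = 0" by (simp add: pderiv_eq_0_iff)
  then show ?case using 0 assms(1) by (intro bexI[of _ 0]) (auto simp: lower_disc_iff)
next
  case (Suc n)
  then have "\<not> constant (poly p)" by (simp add: constant_degree)
  then obtain a where a: "poly p a = 0" using fundamental_theorem_of_algebra by blast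
  then obtain r where r: "p = [:- a, 1:] * r" using poly_eq_0_iff_dvd by (metis dvdE)
  have ima: "Im a \<le> 0" using Suc.prems[of a] a by (meson not_le)
  have r0: "r \<noteq> 0" using Suc.hyps(2) r by auto
  then have "degree p = Suc (degree r)" unfolding r by (subst degree_mult_eq) auto
  then have dr: "degree r = n" using Suc.hyps(2) by simp
  have "poly r z \<noteq> 0" if "Im z > 0" for z using Suc.prems[OF that] r by auto
  then obtain w where w: "w \<in> lower_disc (Im t)" "poly (pderiv r) t = of_nat n * w * poly r t"
    using Suc.hyps(1)[of r] dr by auto
  have ta: "t \<noteq> a" using ima assms(1) by auto
  define u where "u = 1 / (t - a)"
  have u: "u \<in> lower_disc (Im t)" unfolding u_def using inverse_in_lower_disc_iff[OF assms(1) ta] ima by simp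
  define v where "v = (1 / real (Suc n)) *\<^sub>R u + (n / real (Suc n)) *\<^sub>R w"
  have "v \<in> lower_disc (Im t)" unfolding v_def
    using u w(1) convex_cball unfolding lower_disc_def
    by (intro convexD[of "cball _ _"]) (auto simp: field_simps)
  moreover have "poly (pderiv p) t = of_nat (degree p) * v * poly p t"
  proof -
    have "of_nat (Suc n) * v = u + of_nat n * w"
      by (simp add: v_def scaleR_conv_of_real distrib_left del: of_nat_Suc)
    moreover have "poly (pderiv p) t = poly r t + (t - a) * (of_nat n * w * poly r t)"
      unfolding r pderiv_mult by (simp add: w(2) pderiv_pCons algebra_simps)
    moreover have "poly p t = (t - a) * poly r t" by (simp add: r algebra_simps)
    moreover have "(t - a) * u = 1" using ta by (simp add: u_def)
    ultimately show ?thesis using Suc.hyps(2)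
      by (metis (no_types, lifting) distrib_left distrib_right mult.assoc mult.commute mult.right_neutral)
  qed
  ultimately show ?case by blast
qed

text \<open>A zero would give \<open>1 / (t - y) = p'(t) / (k p(t))\<close>. The right side is an average of \<open>k\<close> points of
  the disc, where the missing zeros count as zeros at infinity and contribute the point \<open>0\<close>; the left side lies outside
  the disc, since \<open>y\<close> is in the upper half-plane.\<close>
lemma laguerre_nonvanishing:
  assumes p: "\<And>z. Im z > 0 \<Longrightarrow> poly p z \<noteq> 0" and k: "degree p \<le> k" "k > 0"
    and t: "Im t > 0" and y: "Im y > 0"
  shows "of_nat k * poly p t + (y - t) * poly (pderiv p) t \<noteq> 0"
proof
  assume z: "of_nat k * poly p t + (y - t) * poly (pderiv p) t = 0"
  obtain w where w: "w \<in> lower_disc (Im t)" "poly (pderiv p) t = of_nat (degree p) * w * poly p t"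
    using log_deriv_in_lower_disc[OF t p] by blast
  have "poly p t * (of_nat k + (y - t) * (of_nat (degree p) * w)) = 0"
    using z unfolding w(2) by (simp add: algebra_simps)
  then have "of_nat k + (y - t) * (of_nat (degree p) * w) = 0" using p[OF t] by simp
  moreover have "(t - y) * (of_nat (degree p) * w) = of_nat k - (of_nat k + (y - t) * (of_nat (degree p) * w))"
    by (simp add: algebra_simps)
  ultimately have e: "(t - y) * (of_nat (degree p) * w) = of_nat k" by simp
  define u where "u = (degree p / real k) *\<^sub>R w + (1 - degree p / real k) *\<^sub>R 0"
  have "0 \<in> lower_disc (Im t)" using t by (simp add: lower_disc_iff)
  then have u: "u \<in> lower_disc (Im t)" unfolding u_def
    using w(1) k convex_cball unfolding lower_disc_def
    by (intro convexD[of "cball _ _"]) (auto simp: field_simps)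
  have u1: "(t - y) * u = 1"
  proof -
    have "of_nat k * ((t - y) * u) = (t - y) * (of_nat (degree p) * w)"
      using k by (simp add: u_def scaleR_conv_of_real)
    then show ?thesis using e k by simp
  qed
  then have ty: "t \<noteq> y" by auto
  then have "u = 1 / (t - y)" using u1 by (simp add: field_simps)
  then show False using inverse_in_lower_disc_iff[OF t ty] u y by simp
qed

text \<open>The polynomial \<open>f + (x\<^sub>n - x\<^sub>i) \<partial>\<^sub>if / k\<close>. It is written monomial by monomial, because then the
  nonnegativity of the coefficients, homogeneity, and the drop of the degree in \<open>x\<^sub>i\<close> can be read off.\<close>
definition split_var :: "nat \<Rightarrow> nat \<Rightarrow> nat \<Rightarrow> mpoly \<Rightarrow> mpoly"
  where "split_var n i k f = (\<Sum>\<alpha>\<in>keys f.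
     Poly_Mapping.single \<alpha> (lookup f \<alpha> * (1 - lookup \<alpha> i / k)) +
     Poly_Mapping.single (\<alpha> - unit_exp i + unit_exp n) (lookup f \<alpha> * (lookup \<alpha> i / k)))"

lemma meval_split_var:
  assumes "k > 0"
  shows "of_nat k * meval (split_var n i k f) z = of_nat k * meval f z + (z n - z i) * meval (pderiv_var i f) z"
proof -
  have "of_nat k * meval (split_var n i k f) z = (\<Sum>\<alpha>\<in>keys f. of_real (lookup f \<alpha>) *
      (of_nat k * of_real (1 - lookup \<alpha> i / k) * monom_eval \<alpha> z +
       of_nat k * of_real (lookup \<alpha> i / k) * (monom_eval (\<alpha> - unit_exp i) z * z n)))"
    unfolding split_var_def meval_sum meval_add meval_single monom_eval_add monom_eval_unit_exp of_real_mult sum_distrib_left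
    by (intro sum.cong refl) (simp only: distrib_left mult_ac)
  also have "\<dots> = (\<Sum>\<alpha>\<in>keys f. of_real (lookup f \<alpha>) *
      (of_nat k * monom_eval \<alpha> z + (z n - z i) * (of_nat (lookup \<alpha> i) * monom_eval (\<alpha> - unit_exp i) z)))"
  proof (intro sum.cong refl arg_cong2[where f = "(*)"])
    fix \<alpha>
    have k1: "of_nat k * of_real (1 - lookup \<alpha> i / k) = (of_nat k - of_nat (lookup \<alpha> i) :: 'a)"
      "of_nat k * of_real (lookup \<alpha> i / k) = (of_nat (lookup \<alpha> i) :: 'a)"
      using assms by (simp_all add: right_diff_distrib)
    have L: "of_nat (lookup \<alpha> i) * monom_eval \<alpha> z = of_nat (lookup \<alpha> i) * (monom_eval (\<alpha> - unit_exp i) z * z i)"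
    proof (cases "lookup \<alpha> i = 0")
      case False
      then show ?thesis using minus_plus_unit_exp[of \<alpha> i] monom_eval_add[of "\<alpha> - unit_exp i" "unit_exp i" z] by simp
    qed simp
    show "of_nat k * of_real (1 - lookup \<alpha> i / k) * monom_eval \<alpha> z +
       of_nat k * of_real (lookup \<alpha> i / k) * (monom_eval (\<alpha> - unit_exp i) z * z n) =
      of_nat k * monom_eval \<alpha> z + (z n - z i) * (of_nat (lookup \<alpha> i) * monom_eval (\<alpha> - unit_exp i) z)"
      unfolding k1 left_diff_distrib L by (simp add: algebra_simps)
  qed
  also have "\<dots> = of_nat k * meval f z + (z n - z i) * meval (pderiv_var i f) z"
    unfolding meval_pderiv_var meval_monom[of f]
    by (simp add: sum_distrib_left sum.distrib sum_subtractf algebra_simps)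
  finally show ?thesis .
qed

lemma keys_sum_single_subset:
  "keys (\<Sum>a\<in>A. Poly_Mapping.single (f a) (c a) + Poly_Mapping.single (g a) (e a) :: mpoly) \<subseteq>
    {f a | a. a \<in> A \<and> c a \<noteq> 0} \<union> {g a | a. a \<in> A \<and> e a \<noteq> 0}"
proof (induction A rule: infinite_finite_induct)
  case (insert a A)
  have "keys (\<Sum>a\<in>insert a A. Poly_Mapping.single (f a) (c a) + Poly_Mapping.single (g a) (e a) :: mpoly)
    \<subseteq> keys (Poly_Mapping.single (f a) (c a)) \<union> keys (Poly_Mapping.single (g a) (e a)) \<union>
      keys (\<Sum>a\<in>A. Poly_Mapping.single (f a) (c a) + Poly_Mapping.single (g a) (e a) :: mpoly)"
    using insert.hyps
      Poly_Mapping.keys_add[of "Poly_Mapping.single (f a) (c a) + Poly_Mapping.single (g a) (e a)"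
        "\<Sum>a\<in>A. Poly_Mapping.single (f a) (c a) + Poly_Mapping.single (g a) (e a) :: mpoly"]
      Poly_Mapping.keys_add[of "Poly_Mapping.single (f a) (c a)" "Poly_Mapping.single (g a) (e a) :: mpoly"]
    by (subst sum.insert[OF insert.hyps]) blast
  then show ?case using insert.IH by (auto split: if_splits)
qed auto

lemma keys_split_var:
  assumes "\<beta> \<in> keys (split_var n i k f)" "k > 0"
  obtains (old) "\<beta> \<in> keys f" "lookup \<beta> i \<noteq> k"
    | (new) \<alpha> where "\<alpha> \<in> keys f" "lookup \<alpha> i > 0" "\<beta> = \<alpha> - unit_exp i + unit_exp n"
proof -
  have "\<beta> \<in> {\<alpha> | \<alpha>. \<alpha> \<in> keys f \<and> lookup f \<alpha> * (1 - lookup \<alpha> i / k) \<noteq> 0} \<union>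
    {\<alpha> - unit_exp i + unit_exp n | \<alpha>. \<alpha> \<in> keys f \<and> lookup f \<alpha> * (lookup \<alpha> i / k) \<noteq> 0}"
    by (rule subsetD[OF keys_sum_single_subset assms(1)[unfolded split_var_def]])
  then show ?thesis using old new assms(2) by fastforce
qed

lemma nonneg_split_var:
  assumes f: "nonneg_coeffs f" and k: "\<And>\<alpha>. \<alpha> \<in> keys f \<Longrightarrow> lookup \<alpha> i \<le> k" "k > 0"
  shows "nonneg_coeffs (split_var n i k f)"
  unfolding nonneg_coeffs_def split_var_def lookup_sum lookup_add
proof (intro allI sum_nonneg add_nonneg_nonneg)
  fix \<beta> \<alpha> assume a: "\<alpha> \<in> keys f"
  have c: "lookup f \<alpha> \<ge> 0" using f by (simp add: nonneg_coeffs_def)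
  have "lookup \<alpha> i / k \<le> 1" using k(1)[OF a] k(2) by simp
  then show "lookup (Poly_Mapping.single \<alpha> (lookup f \<alpha> * (1 - lookup \<alpha> i / k))) \<beta> \<ge> 0"
    using c by (auto simp: lookup_single when_def intro!: mult_nonneg_nonneg)
  show "lookup (Poly_Mapping.single (\<alpha> - unit_exp i + unit_exp n) (lookup f \<alpha> * (lookup \<alpha> i / k))) \<beta> \<ge> 0"
    using c by (simp add: lookup_single when_def)
qed

lemma homog_split_var:
  assumes "homog d f" "k > 0"
  shows "homog d (split_var n i k f)"
  unfolding homog_def
proof
  fix \<beta> assume "\<beta> \<in> keys (split_var n i k f)"
  then show "mdegree \<beta> = d" using assms(2)
  proof (cases rule: keys_split_var)
    case old
    then show ?thesis using assms(1) by (simp add: homog_def)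
  next
    case (new \<alpha>)
    have "mdegree \<alpha> = mdegree (\<alpha> - unit_exp i) + 1" using minus_plus_unit_exp[OF new(2)] by (metis mdegree_add mdegree_unit_exp)
    then show ?thesis using new assms(1) by (simp add: homog_def mdegree_add)
  qed
qed

text \<open>Real stability without the exceptional zero polynomial.\<close>
definition nonvanishing :: "nat \<Rightarrow> mpoly \<Rightarrow> bool"
  where "nonvanishing n f \<longleftrightarrow> (\<forall>z :: nat \<Rightarrow> complex. (\<forall>i<n. Im (z i) > 0) \<longrightarrow> meval f z \<noteq> 0)"

text \<open>With the other variables fixed in the upper half-plane, \<open>f\<close> is a polynomial in \<open>x\<^sub>i\<close> alone, to
  which Laguerre's theorem applies.\<close>
lemma nonvanishing_split_var:
  assumes f: "f \<in> polys n" "nonvanishing n f" and i: "i < n"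
    and k: "\<And>\<alpha>. \<alpha> \<in> keys f \<Longrightarrow> lookup \<alpha> i \<le> k" "k > 0"
  shows "nonvanishing (Suc n) (split_var n i k f)"
  unfolding nonvanishing_def
proof (intro allI impI)
  fix z :: "nat \<Rightarrow> complex" assume z: "\<forall>i<Suc n. Im (z i) > 0"
  define c where "c \<alpha> = of_real (lookup f \<alpha>) *
    (\<Prod>j\<in>keys \<alpha> - {i}. z j ^ lookup \<alpha> j)" for \<alpha>
  define P where "P = (\<Sum>\<alpha>\<in>keys f. Polynomial.monom (c \<alpha>) (lookup \<alpha> i))"
  have mon: "of_real (lookup f \<alpha>) * monom_eval \<alpha> (z(i := t)) = c \<alpha> * t ^ lookup \<alpha> i" for \<alpha> t
  proof -
    have "monom_eval \<alpha> (z(i := t)) = (\<Prod>j\<in>insert i (keys \<alpha>). (z(i := t)) j ^ lookup \<alpha> j)"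
      by (rule monom_eval_superset) auto
    also have "\<dots> = t ^ lookup \<alpha> i * (\<Prod>j\<in>keys \<alpha> - {i}. z j ^ lookup \<alpha> j)"
      by (subst prod.insert_remove) (auto intro!: prod.cong)
    finally show ?thesis by (simp add: c_def mult_ac)
  qed
  have P: "poly P t = meval f (z(i := t))" for t
    by (simp add: P_def poly_sum poly_monom meval_monom mon)
  have dP: "poly (pderiv P) t = meval (pderiv_var i f) (z(i := t))" if "t \<noteq> 0" for t
  proof -
    have term_eq: "of_nat (lookup \<alpha> i) * c \<alpha> * t ^ (lookup \<alpha> i - 1) =
      of_real (lookup f \<alpha>) * (of_nat (lookup \<alpha> i) * monom_eval (\<alpha> - unit_exp i) (z(i := t)))" for \<alpha>
    proof (cases "lookup \<alpha> i")
      case (Suc l)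
      then have "monom_eval \<alpha> (z(i := t)) = monom_eval (\<alpha> - unit_exp i) (z(i := t)) * t"
        using minus_plus_unit_exp[of \<alpha> i] monom_eval_add[of "\<alpha> - unit_exp i" "unit_exp i" "z(i := t)"] by simp
      then have "of_real (lookup f \<alpha>) * monom_eval (\<alpha> - unit_exp i) (z(i := t)) * t = c \<alpha> * t ^ l * t"
        using mon[of \<alpha> t] Suc by (simp add: mult_ac)
      then show ?thesis using that Suc by (simp add: mult_ac)
    qed simp
    have "pderiv P = (\<Sum>\<alpha>\<in>keys f. pderiv (Polynomial.monom (c \<alpha>) (lookup \<alpha> i)))"
      unfolding P_def by (rule higher_pderiv_sum[of "Suc 0", simplified])
    then show ?thesis
      by (simp only: pderiv_monom poly_sum poly_monom meval_pderiv_var term_eq)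
  qed
  have "poly P t \<noteq> 0" if "Im t > 0" for t
    unfolding P using f(2) z that by (auto simp: nonvanishing_def)
  moreover have "degree P \<le> k"
    unfolding P_def using k(1) by (intro degree_sum_le) (auto intro: order_trans[OF degree_monom_le])
  ultimately have "of_nat k * poly P (z i) + (z n - z i) * poly (pderiv P) (z i) \<noteq> 0"
    using k(2) z i by (intro laguerre_nonvanishing) auto
  moreover have "Im (z i) > 0" using z i by simp
  then have "z i \<noteq> 0" by auto
  ultimately have "of_nat k * meval (split_var n i k f) z \<noteq> 0"
    by (simp add: meval_split_var[OF k(2)] P dP)
  then show "meval (split_var n i k f) z \<noteq> 0" by auto
qed

text \<open>Splitting a variable of degree bound \<open>k \<ge> 2\<close> replaces it by one of bound \<open>k - 1\<close> and a new one of
  bound \<open>1\<close>. The induction is on the total excess of the bounds \<open>e j + 1\<close> over \<open>1\<close>.\<close>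
theorem stable_polarization:
  assumes "f \<in> polys n" "homog d f" "nonneg_coeffs f" "nonvanishing n f"
  obtains m \<sigma> g where "g \<in> polys m" "multi_affine g" "homog d g" "nonneg_coeffs g" "nonvanishing m g"
    "\<And>j. j < m \<Longrightarrow> \<sigma> j < n" "\<And>x :: nat \<Rightarrow> real. meval f x = meval g (\<lambda>j. x (\<sigma> j))"
proof -
  have "\<exists>m \<sigma> g. g \<in> polys m \<and> multi_affine g \<and> homog d g \<and> nonneg_coeffs g \<and> nonvanishing m g \<and>
      (\<forall>j<m. \<sigma> j < n) \<and> (\<forall>x :: nat \<Rightarrow> real. meval f x = meval g (\<lambda>j. x (\<sigma> j)))"
    if "f \<in> polys n" "homog d f" "nonneg_coeffs f" "nonvanishing n f"
      "\<And>\<alpha> j. \<alpha> \<in> keys f \<Longrightarrow> j < n \<Longrightarrow> lookup \<alpha> j \<le> Suc (e j)" "N = (\<Sum>j<n. e j)"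
    for N n f e
    using that
  proof (induction N arbitrary: n f e)
    case 0
    have "multi_affine f"
      unfolding multi_affine_def
    proof (intro ballI allI)
      fix \<alpha> j assume a: "\<alpha> \<in> keys f"
      show "lookup \<alpha> j \<le> 1"
      proof (cases "j < n")
        case True
        then have "e j = 0" using 0 by simp
        then show ?thesis using 0(5)[OF a True] by simp
      next
        case False
        then have "j \<notin> keys \<alpha>" using a 0(1) by (auto simp: polys_def)
        then show ?thesis by (simp add: in_keys_iff)
      qed
    qed
    then show ?case using 0 by (intro exI[of _ n] exI[of _ id] exI[of _ f]) auto
  next
    case (Suc N)
    have "\<exists>i<n. e i > 0"
    proof (rule ccontr)
      assume "\<not> ?thesis"
      then have "(\<Sum>j<n. e j) = 0" by simp
      then show False using Suc.prems(6) by simp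
    qed
    then obtain i where i: "i < n" "e i > 0" by blast
    define k where "k = Suc (e i)"
    have k: "k > 0" "\<And>\<alpha>. \<alpha> \<in> keys f \<Longrightarrow> lookup \<alpha> i \<le> k"
      using Suc.prems(5) i by (auto simp: k_def)
    define g where "g = split_var n i k f"
    define e' where "e' = e(i := e i - 1, n := 0)"
    have g1: "g \<in> polys (Suc n)"
      unfolding polys_def
    proof (intro CollectI ballI)
      fix \<beta> assume "\<beta> \<in> keys g"
      then show "keys \<beta> \<subseteq> {..<Suc n}" unfolding g_def using k(1)
      proof (cases rule: keys_split_var)
        case old
        then show ?thesis using Suc.prems(1) by (fastforce simp: polys_def)
      next
        case (new \<alpha>)
        have "keys (\<alpha> - unit_exp i) \<subseteq> keys \<alpha>" by (auto simp: in_keys_iff lookup_minus)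
        moreover have "keys \<alpha> \<subseteq> {..<n}" using new Suc.prems(1) by (auto simp: polys_def)
        ultimately show ?thesis unfolding new keys_add_nat by auto
      qed
    qed
    have g2: "homog d g" unfolding g_def by (rule homog_split_var[OF Suc.prems(2) k(1)])
    have g3: "nonneg_coeffs g" unfolding g_def by (rule nonneg_split_var[OF Suc.prems(3) k(2,1)])
    have g4: "nonvanishing (Suc n) g" unfolding g_def
      by (rule nonvanishing_split_var[OF Suc.prems(1,4) i(1) k(2,1)])
    have g5: "lookup \<beta> j \<le> Suc (e' j)" if b: "\<beta> \<in> keys g" and j: "j < Suc n" for \<beta> j
      using b[unfolded g_def] k(1)
    proof (cases rule: keys_split_var)
      case old
      have "lookup \<beta> n = 0" using old Suc.prems(1) by (force simp: polys_def in_keys_iff)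
      moreover have "lookup \<beta> i \<le> e i" using old k(2)[of \<beta>] by (simp add: k_def)
      moreover have "lookup \<beta> j \<le> Suc (e j)" if "j \<noteq> n" using Suc.prems(5)[OF old(1), of j] that j by simp
      ultimately show ?thesis using i by (auto simp: e'_def)
    next
      case (new \<alpha>)
      have "lookup \<alpha> n = 0" using new Suc.prems(1) by (force simp: polys_def in_keys_iff)
      moreover have "lookup \<alpha> i \<le> Suc (e i)" using new k(2)[of \<alpha>] by (simp add: k_def)
      moreover have "lookup \<alpha> j \<le> Suc (e j)" if "j \<noteq> n" using Suc.prems(5)[OF new(1), of j] that j by simp
      ultimately show ?thesis using i by (auto simp: e'_def new(3) lookup_add lookup_minus lookup_unit_exp)
    qed
    have "(\<Sum>j<Suc n. e' j) = (\<Sum>j<n. (e(i := e i - 1)) j)" by (simp add: e'_def)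
    also have "\<dots> + 1 = (\<Sum>j<n. e j)"
      using i by (simp add: sum.remove[of "{..<n}" i])
    finally have "N = (\<Sum>j<Suc n. e' j)" using Suc.prems(6) by simp
    from Suc.IH[OF g1 g2 g3 g4 g5 this]
    obtain m \<sigma> h where h: "h \<in> polys m" "multi_affine h" "homog d h" "nonneg_coeffs h" "nonvanishing m h"
      "\<forall>j<m. \<sigma> j < Suc n" "\<And>x :: nat \<Rightarrow> real. meval g x = meval h (\<lambda>j. x (\<sigma> j))" by blast
    have "meval f x = meval h (\<lambda>j. x (if \<sigma> j = n then i else \<sigma> j))" for x :: "nat \<Rightarrow> real"
    proof -
      define y where "y = x(n := x i)"
      have "meval f x = meval f y" by (rule meval_cong[OF Suc.prems(1)]) (simp add: y_def)
      also have "of_nat k * meval f y = of_nat k * meval g y"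
        unfolding g_def meval_split_var[OF k(1)] using i by (simp add: y_def)
      then have "meval f y = meval g y" using k(1) by simp
      also have "\<dots> = meval h (\<lambda>j. y (\<sigma> j))" by (rule h(7))
      also have "(\<lambda>j. y (\<sigma> j)) = (\<lambda>j. x (if \<sigma> j = n then i else \<sigma> j))" by (auto simp: y_def)
      finally show ?thesis .
    qed
    moreover have "\<forall>j<m. (if \<sigma> j = n then i else \<sigma> j) < n" using h(6) i(1) by (auto simp: less_Suc_eq)
    ultimately show ?case using h
      by (intro exI[of _ m] exI[of _ "\<lambda>j. if \<sigma> j = n then i else \<sigma> j"] exI[of _ h]) auto
  qed
  note * = this
  define e where "e j = d" for j :: nat
  have "lookup \<alpha> j \<le> Suc (e j)" if "\<alpha> \<in> keys f" "j < n" for \<alpha> j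
  proof -
    have "lookup \<alpha> j \<le> (\<Sum>i<n. lookup \<alpha> i)" using that by (intro member_le_sum) auto
    also have "\<dots> = d" using assms(1,2) that mdegree_superset[of "{..<n}" \<alpha>] by (auto simp: polys_def homog_def)
    finally show ?thesis by (simp add: e_def)
  qed
  from *[OF assms this refl] show ?thesis using that by blast
qed

section \<open>The component of the positive orthant of a stable polynomial\<close>

lemma continuous_on_meval [continuous_intros]:
  assumes "\<And>i. continuous_on S (\<lambda>s. x s i)"
  shows "continuous_on S (\<lambda>s. meval f (x s) :: real)"
  unfolding meval_def by (intro continuous_intros assms)

lemma meval_of_real: "meval f (\<lambda>i. of_real (x i)) = (of_real (meval f x) :: complex)"
  unfolding meval_def by simp

context
  fixes m d :: nat and g :: mpoly
  assumes g: "g \<in> polys m" "homog d g" "nonneg_coeffs g" "nonvanishing m g"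
begin

lemma nonvanishingD: "(\<And>i. i < m \<Longrightarrow> Im (z i) > 0) \<Longrightarrow> meval g z \<noteq> 0"
  using g(4) by (auto simp: nonvanishing_def)

lemma meval_positive:
  fixes e :: "nat \<Rightarrow> real"
  assumes e: "\<And>i. i < m \<Longrightarrow> e i > 0"
  shows "meval g e > 0"
proof -
  have "meval g (\<lambda>i. \<i> * of_real (e i)) \<noteq> 0" using g(4) e by (simp add: nonvanishing_def)
  then have "meval g e \<noteq> 0" unfolding meval_homog_scale[OF g(2)] meval_of_real by auto
  moreover have "meval g e \<ge> 0"
  proof -
    have "monom_eval \<alpha> e \<ge> 0" if "\<alpha> \<in> keys g" for \<alpha>
    proof -
      have "keys \<alpha> \<subseteq> {..<m}" using that g(1) by (auto simp: polys_def)
      then show ?thesis unfolding monom_eval_def using e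
        by (intro prod_nonneg ballI zero_le_power) (auto simp: less_imp_le subset_iff)
    qed
    then show ?thesis unfolding meval_monom of_real_eq_id id_apply
      using g(3) by (intro sum_nonneg mult_nonneg_nonneg) (auto simp: nonneg_coeffs_def)
  qed
  ultimately show ?thesis by simp
qed

text \<open>As a polynomial in \<open>t\<close>, \<open>g(x + te)\<close> has leading coefficient \<open>g(e)\<close> and, by stability, only real
  zeros; positivity for \<open>t \<ge> 0\<close> makes them negative. Each of the \<open>d\<close> linear factors is then at least \<open>t\<close>.
  This uniform bound is what makes the cone below closed in \<open>{g > 0}\<close>.\<close>
lemma line_growth:
  assumes e: "\<And>i. i < m \<Longrightarrow> e i > 0" and pos: "\<And>t. t \<ge> 0 \<Longrightarrow> meval g (\<lambda>i. x i + t * e i) > (0::real)"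
    and t: "t \<ge> 0"
  shows "meval g (\<lambda>i. x i + t * e i) \<ge> meval g e * t ^ d"
proof -
  define q where "q \<alpha> = (\<Prod>i\<in>keys \<alpha>. [:of_real (x i), of_real (e i):] ^ lookup \<alpha> i :: complex poly)" for \<alpha>
  define P where "P = (\<Sum>\<alpha>\<in>keys g. smult (of_real (lookup g \<alpha>)) (q \<alpha>))"
  have P: "poly P r = meval g (\<lambda>i. of_real (x i) + r * of_real (e i))" for r
    by (simp add: P_def q_def poly_sum poly_prod meval_def)
  have q: "degree (q \<alpha>) = d" "coeff (q \<alpha>) d = of_real (monom_eval \<alpha> e)" if a: "\<alpha> \<in> keys g" for \<alpha>
  proof -
    have k: "keys \<alpha> \<subseteq> {..<m}" "mdegree \<alpha> = d" using a g by (auto simp: polys_def homog_def)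
    have e0: "e i \<noteq> 0" if "i \<in> keys \<alpha>" for i using e[of i] that k by auto
    have "degree (q \<alpha>) = (\<Sum>i\<in>keys \<alpha>. degree ([:of_real (x i), of_real (e i):] ^ lookup \<alpha> i :: complex poly))"
      unfolding q_def using e0 by (intro degree_prod_eq_sum_degree) auto
    also have "\<dots> = mdegree \<alpha>" unfolding mdegree_def using e0 by (intro sum.cong refl) (simp add: degree_power_eq)
    finally show d: "degree (q \<alpha>) = d" using k by simp
    have "lead_coeff (q \<alpha>) = (\<Prod>i\<in>keys \<alpha>. of_real (e i) ^ lookup \<alpha> i)"
      unfolding q_def lead_coeff_prod lead_coeff_power using e0 by (intro prod.cong) auto
    then show "coeff (q \<alpha>) d = of_real (monom_eval \<alpha> e)" unfolding d by (simp add: monom_eval_def)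
  qed
  have cP: "coeff P d = of_real (meval g e)"
    by (simp add: P_def coeff_sum q meval_monom)
  have "degree P \<le> d" unfolding P_def using q by (intro degree_sum_le) (auto intro: order_trans[OF degree_smult_le])
  then have dP: "degree P = d" using cP meval_positive[of e, OF e] by (intro antisym le_degree) auto
  obtain root where root: "smult (lead_coeff P) (\<Prod>i<degree P. [:- root i, 1:]) = P"
    by (rule complex_poly_decompose')
  have factored: "poly P r = of_real (meval g e) * (\<Prod>i<d. (r - root i))" for r
    by (subst root[symmetric]) (simp add: dP cP poly_prod)
  have real_root: "Re (root i) < 0 \<and> root i = of_real (Re (root i))" if "i < d" for i
  proof -
    have "poly P (root i) = 0" unfolding factored using that by (auto intro!: prod_zero)
    then have z: "meval g (\<lambda>j. of_real (x j) + root i * of_real (e j)) = 0" by (simp add: P)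
    have "Im (root i) = 0"
    proof (rule ccontr)
      assume "Im (root i) \<noteq> 0"
      then consider "Im (root i) > 0" | "Im (root i) < 0" by linarith
      then show False
      proof cases
        case 1
        then show False using z g(4) e by (auto simp: nonvanishing_def)
      next
        case 2
        (* the negative of the point lies in the product of upper half-planes *)
        have "meval g (\<lambda>j. (-1) * (of_real (x j) + root i * of_real (e j))) = 0"
          unfolding meval_homog_scale[OF g(2)] z by simp
        moreover have "meval g (\<lambda>j. (-1) * (of_real (x j) + root i * of_real (e j))) \<noteq> 0"
        proof (rule nonvanishingD)
          fix j assume "j < m"
          then show "Im ((-1) * (of_real (x j) + root i * of_real (e j))) > 0"
            using 2 e[of j] by (simp add: mult_neg_pos)
        qed
        ultimately show False by simp
      qed
    qed
    then have r: "root i = of_real (Re (root i))" by (simp add: complex_eq_iff)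
    have "Re (root i) < 0"
    proof (rule ccontr)
      assume "\<not> Re (root i) < 0"
      then have "meval g (\<lambda>j. x j + Re (root i) * e j) > 0" by (intro pos) simp
      moreover have "of_real (meval g (\<lambda>j. x j + Re (root i) * e j)) = (0 :: complex)"
        unfolding meval_of_real[symmetric] using z by (subst (asm) r) simp
      ultimately show False by simp
    qed
    then show ?thesis using r by blast
  qed
  define \<rho> where "\<rho> i = Re (root i)" for i
  have \<rho>: "\<rho> i < 0" "root i = of_real (\<rho> i)" if "i < d" for i
    using real_root[OF that] by (simp_all add: \<rho>_def)
  have "of_real (meval g (\<lambda>i. x i + t * e i)) = poly P (of_real t)"
    unfolding P meval_of_real[symmetric] by simp
  also have "\<dots> = of_real (meval g e * (\<Prod>i<d. t - \<rho> i))"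
    unfolding factored using \<rho> by simp
  finally have eq: "meval g (\<lambda>i. x i + t * e i) = meval g e * (\<Prod>i<d. t - \<rho> i)"
    by (simp only: of_real_eq_iff)
  have "t ^ d = (\<Prod>i<d. t)" by simp
  also have "\<dots> \<le> (\<Prod>i<d. t - \<rho> i)" using t \<rho> by (intro prod_mono) (auto simp: less_imp_le)
  finally show ?thesis unfolding eq using meval_positive[of e, OF e] by (intro mult_left_mono) auto
qed

text \<open>The hyperbolicity cone of \<open>g\<close> in direction \<open>e\<close>.\<close>
definition ray_cone :: "(nat \<Rightarrow> real) \<Rightarrow> (nat \<Rightarrow> real) set"
  where "ray_cone e = {x. (\<forall>i\<ge>m. x i = 0) \<and> (\<forall>t\<ge>0. meval g (\<lambda>i. x i + t * e i) > 0)}"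

lemma ray_cone_subset: "ray_cone e \<subseteq> pos_set m g"
proof
  fix x assume x: "x \<in> ray_cone e"
  then have "meval g (\<lambda>i. x i + 0 * e i) > 0" unfolding ray_cone_def by blast
  then show "x \<in> pos_set m g" using x by (simp add: ray_cone_def pos_set_def topspace_Euclidean_space)
qed

lemma orthant_subset_ray_cone:
  assumes "e \<in> pos_orthant m" "x \<in> pos_orthant m"
  shows "x \<in> ray_cone e"
  using assms unfolding ray_cone_def pos_orthant_def topspace_Euclidean_space
  by (auto intro!: meval_positive add_pos_nonneg)

lemma segment_connected: "connected ((\<lambda>t. (\<lambda>i. x i + t * v i) :: nat \<Rightarrow> real) ` S)" if "connected S" for S :: "real set"
  using that by (intro connected_continuous_image continuous_on_line)

text \<open>From every point of the cone the ray in direction \<open>e\<close> leads to the convex positive orthant.\<close>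
lemma ray_cone_connected:
  assumes e: "e \<in> pos_orthant m"
  shows "connected (ray_cone e)"
proof -
  have ep: "e i > 0" if "i < m" for i using e that by (simp add: pos_orthant_def)
  have e0: "e i = 0" if "i \<ge> m" for i using e that by (simp add: pos_orthant_def topspace_Euclidean_space)
  have "\<exists>T\<subseteq>ray_cone e. connected T \<and> e \<in> T \<and> x \<in> T" if x: "x \<in> ray_cone e" for x
  proof -
    define s where "s = 1 + (\<Sum>i<m. \<bar>x i\<bar> / e i)"
    have "(\<Sum>i<m. \<bar>x i\<bar> / e i) \<ge> 0" using ep by (intro sum_nonneg divide_nonneg_nonneg) (auto simp: less_imp_le)
    then have s: "s \<ge> 0" by (simp add: s_def)
    define y where "y = (\<lambda>i. x i + s * e i)"
    have y: "y \<in> pos_orthant m"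
    proof -
      have "y i > 0" if "i < m" for i
      proof -
        have "\<bar>x i\<bar> / e i \<le> (\<Sum>i<m. \<bar>x i\<bar> / e i)" using that ep by (intro member_le_sum) (auto simp: less_imp_le)
        then have "\<bar>x i\<bar> / e i < s" by (simp add: s_def)
        then show ?thesis using ep[OF that] by (simp add: y_def field_simps abs_if split: if_splits)
      qed
      moreover have "y i = 0" if "i \<ge> m" for i using that x e0 by (simp add: y_def ray_cone_def)
      ultimately show ?thesis by (simp add: pos_orthant_def topspace_Euclidean_space)
    qed
    define T1 where "T1 = (\<lambda>t. (\<lambda>i. x i + t * e i)) ` {0..s}"
    define T2 where "T2 = (\<lambda>t. (\<lambda>i. y i + t * (e i - y i))) ` {0..1}"
    have "T1 \<subseteq> ray_cone e"
    proof
      fix z assume "z \<in> T1"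
      then obtain t where t: "0 \<le> t" "z = (\<lambda>i. x i + t * e i)" by (auto simp: T1_def)
      have "(\<lambda>i. z i + r * e i) = (\<lambda>i. x i + (t + r) * e i)" for r by (simp add: t algebra_simps)
      then show "z \<in> ray_cone e" using x t e0 by (auto simp: ray_cone_def)
    qed
    moreover have "T2 \<subseteq> ray_cone e"
    proof
      fix z assume "z \<in> T2"
      then obtain t where t: "0 \<le> t" "t \<le> 1" "z = (\<lambda>i. y i + t * (e i - y i))" by (auto simp: T2_def)
      have "z = (\<lambda>i. (1 - t) * y i + t * e i)" unfolding t(3) by (simp add: algebra_simps)
      moreover have "(1 - t) * y i + t * e i > 0" if "i < m" for i
      proof (cases "t = 0")
        case True
        then show ?thesis using y that by (simp add: pos_orthant_def)
      next
        case False
        then have "t * e i > 0" using t ep[OF that] by simp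
        moreover have "(1 - t) * y i \<ge> 0" using t y that by (simp add: pos_orthant_def less_imp_le)
        ultimately show ?thesis by simp
      qed
      ultimately have "z \<in> pos_orthant m"
        using y e0 by (auto simp: pos_orthant_def topspace_Euclidean_space)
      then show "z \<in> ray_cone e" by (rule orthant_subset_ray_cone[OF e])
    qed
    moreover have "connected (T1 \<union> T2)"
    proof (rule connected_Un)
      show "connected T1" "connected T2" unfolding T1_def T2_def by (intro segment_connected; simp)+
      have "y \<in> T1" unfolding T1_def y_def using s by auto
      moreover have "y \<in> T2" unfolding T2_def by (rule image_eqI[of _ _ 0]) auto
      ultimately show "T1 \<inter> T2 \<noteq> {}" by blast
    qed
    moreover have "x \<in> T1" unfolding T1_def using s by (intro image_eqI[of _ _ 0]) auto
    moreover have "e \<in> T2" unfolding T2_def by (rule image_eqI[of _ _ 1]) auto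
    ultimately show ?thesis by (intro exI[of _ "T1 \<union> T2"]) auto
  qed
  then have "connected_component (ray_cone e) e x" if "x \<in> ray_cone e" for x
    using that by (auto simp: connected_component_def)
  then show ?thesis
    unfolding connected_iff_connected_component
    by (meson connected_component_sym connected_component_trans)
qed

lemma ray_cone_closedin:
  assumes e: "e \<in> pos_orthant m"
  shows "closedin (top_of_set (pos_set m g)) (ray_cone e)"
proof -
  have ep: "e i > 0" if "i < m" for i using e that by (simp add: pos_orthant_def)
  define K where "K = (\<Inter>t\<in>{0..}. {x. meval g e * t ^ d \<le> meval g (\<lambda>i. x i + t * e i)})"
  have "closed K" unfolding K_def by (intro closed_INT ballI closed_Collect_le continuous_intros)
  moreover have "ray_cone e = pos_set m g \<inter> K"
  proof (intro antisym subsetI)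
    fix x assume x: "x \<in> ray_cone e"
    then have "x \<in> K" unfolding K_def ray_cone_def using line_growth[OF ep] by auto
    then show "x \<in> pos_set m g \<inter> K" using x ray_cone_subset by blast
  next
    fix x assume x: "x \<in> pos_set m g \<inter> K"
    have "meval g (\<lambda>i. x i + t * e i) > 0" if "t \<ge> 0" for t
    proof (cases "t = 0")
      case True
      then show ?thesis using x by (simp add: pos_set_def)
    next
      case False
      then have "meval g e * t ^ d > 0" using that meval_positive[of e, OF ep] by simp
      also have "\<dots> \<le> meval g (\<lambda>i. x i + t * e i)" using x that by (auto simp: K_def)
      finally show ?thesis .
    qed
    then show "x \<in> ray_cone e" using x by (simp add: ray_cone_def pos_set_def topspace_Euclidean_space)
  qed
  ultimately show ?thesis by (auto simp: closedin_closed)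
qed

text \<open>Positivity for large \<open>t\<close> is automatic near \<open>x\<close>, because the points \<open>y + te\<close> lie in the positive
  orthant; for \<open>t\<close> in a compact interval it persists near \<open>x\<close> by the tube lemma.\<close>
lemma ray_cone_openin:
  assumes e: "e \<in> pos_orthant m"
  shows "openin (top_of_set (pos_set m g)) (ray_cone e)"
proof -
  have ep: "e i > 0" if "i < m" for i using e that by (simp add: pos_orthant_def)
  have "\<exists>U. open U \<and> x \<in> U \<and> pos_set m g \<inter> U \<subseteq> ray_cone e" if x: "x \<in> ray_cone e" for x
  proof -
    define s where "s = 1 + (\<Sum>i<m. \<bar>x i\<bar> / e i)"
    define W where "W = {p :: (nat \<Rightarrow> real) \<times> real. 0 < meval g (\<lambda>i. fst p i + snd p * e i)}"
    have cont: "continuous_on UNIV (\<lambda>p :: (nat \<Rightarrow> real) \<times> real. fst p i)" for i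
      by (rule continuous_on_compose2[OF continuous_on_coordinate[of UNIV] continuous_on_fst]) (auto intro: continuous_intros)
    have "open W" unfolding W_def by (intro open_Collect_less continuous_intros cont)
    then have "openin (prod_topology euclidean euclidean) W"
      by simp
    moreover have "compactin euclidean {0..s}" by simp
    moreover have "{x} \<times> {0..s} \<subseteq> W" using x by (auto simp: W_def ray_cone_def)
    ultimately obtain U V where UV: "open U" "x \<in> U" "{0..s} \<subseteq> V" "U \<times> V \<subseteq> W"
      using tube_lemma_right[of euclidean euclidean W "{0..s}" x] by auto
    define U' where "U' = U \<inter> (\<Inter>i\<in>{..<m}. {y. 0 < y i + s * e i})"
    have "open U'" unfolding U'_def using UV(1)
      by (intro open_Int open_INT ballI open_Collect_less continuous_intros) auto
    moreover have "x \<in> U'"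
    proof -
      have "x i + s * e i > 0" if "i < m" for i
      proof -
        have "\<bar>x i\<bar> / e i \<le> (\<Sum>i<m. \<bar>x i\<bar> / e i)" using that ep by (intro member_le_sum) (auto simp: less_imp_le)
        then have "\<bar>x i\<bar> / e i < s" by (simp add: s_def)
        then show ?thesis using ep[OF that] by (simp add: field_simps abs_if split: if_splits)
      qed
      then show ?thesis using UV(2) by (simp add: U'_def)
    qed
    moreover have "pos_set m g \<inter> U' \<subseteq> ray_cone e"
    proof
      fix y assume y: "y \<in> pos_set m g \<inter> U'"
      have "meval g (\<lambda>i. y i + t * e i) > 0" if t: "t \<ge> 0" for t
      proof (cases "t \<le> s")
        case True
        then have "(y, t) \<in> W" using y UV t by (auto simp: U'_def)
        then show ?thesis by (simp add: W_def)
      next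
        case False
        have "y i + t * e i > 0" if "i < m" for i
        proof -
          have "0 < y i + s * e i" using y that by (auto simp: U'_def)
          also have "\<dots> \<le> y i + t * e i" using False ep[OF that] by simp
          finally show ?thesis .
        qed
        then show ?thesis by (rule meval_positive)
      qed
      then show "y \<in> ray_cone e" using y by (simp add: ray_cone_def pos_set_def topspace_Euclidean_space)
    qed
    ultimately show ?thesis by blast
  qed
  then show ?thesis
    by (subst openin_subopen) (meson ray_cone_subset openin_open_Int inf_le1 inf.boundedI subsetD IntI inf_commute)
qed

lemma connected_subset_ray_cone:
  assumes e: "e \<in> pos_orthant m" and T: "connected T" "T \<subseteq> pos_set m g" "T \<inter> ray_cone e \<noteq> {}"
  shows "T \<subseteq> ray_cone e"
proof -
  have "connectedin (top_of_set (pos_set m g)) T" using T by (simp add: connectedin_subtopology)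
  then have "T \<subseteq> ray_cone e \<or> disjnt T (ray_cone e)"
    using connectedin_clopen_cases ray_cone_closedin[OF e] ray_cone_openin[OF e] by blast
  then show ?thesis using T(3) by (auto simp: disjnt_def)
qed

text \<open>Both cones contain the positive orthant and are connected, and each is open and closed in
  \<open>{g > 0}\<close>.\<close>
lemma ray_cone_independent:
  assumes e: "e \<in> pos_orthant m" and e': "e' \<in> pos_orthant m"
  shows "ray_cone e = ray_cone e'"
proof -
  have "ray_cone a \<subseteq> ray_cone b" if a: "a \<in> pos_orthant m" and b: "b \<in> pos_orthant m" for a b
  proof (rule connected_subset_ray_cone[OF b ray_cone_connected[OF a] ray_cone_subset])
    show "ray_cone a \<inter> ray_cone b \<noteq> {}" using orthant_subset_ray_cone[OF a a] orthant_subset_ray_cone[OF b a] by blast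
  qed
  then show ?thesis using e e' by blast
qed

lemma ray_cone_component:
  assumes e: "e \<in> pos_orthant m"
  shows "ray_cone e \<in> connected_components_of (subtopology (Euclidean_space m) (pos_set m g))"
proof -
  have ee: "e \<in> ray_cone e" using e by (intro orthant_subset_ray_cone)
  have "ray_cone e = connected_component_of_set (top_of_set (pos_set m g)) e"
  proof (intro antisym subsetI)
    fix x assume "x \<in> ray_cone e"
    then show "x \<in> connected_component_of_set (top_of_set (pos_set m g)) e"
      unfolding connected_component_of_def mem_Collect_eq
      using ee ray_cone_connected[OF e] ray_cone_subset by (intro exI[of _ "ray_cone e"]) (simp add: connectedin_subtopology)
  next
    fix x assume "x \<in> connected_component_of_set (top_of_set (pos_set m g)) e"
    then obtain T where "connected T" "T \<subseteq> pos_set m g" "e \<in> T" "x \<in> T"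
      by (auto simp: connected_component_of_def connectedin_subtopology)
    then show "x \<in> ray_cone e" using connected_subset_ray_cone[OF e, of T] ee by blast
  qed
  then show ?thesis unfolding subtopology_pos_set connected_components_of_def
    using ee ray_cone_subset by auto
qed

text \<open>Step back from \<open>x\<close> to \<open>x' = x - \<epsilon>e\<close>, still in the cone. For \<open>y\<close> in the closed orthant,
  \<open>e' = y + \<epsilon>e\<close> is a positive direction with \<open>x + y = x' + e'\<close>, and \<open>x'\<close> belongs to the cone in
  direction \<open>e'\<close> as well.\<close>
lemma ray_cone_PRT:
  assumes e: "e \<in> pos_orthant m"
  shows "passes_PRT m (ray_cone e)"
proof -
  have ep: "e i > 0" if "i < m" for i using e that by (simp add: pos_orthant_def)
  have e0: "e i = 0" if "i \<ge> m" for i using e that by (simp add: pos_orthant_def topspace_Euclidean_space)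
  have "(\<lambda>i. x i + y i) \<in> ray_cone e"
    if x: "x \<in> ray_cone e" and y: "\<forall>i<m. y i \<ge> 0" "\<forall>i\<ge>m. y i = 0" for x y
  proof -
    define \<phi> where "\<phi> t = meval g (\<lambda>i. x i + t * e i)" for t
    have "continuous_on UNIV \<phi>" unfolding \<phi>_def by (intro continuous_intros)
    then have "isCont \<phi> 0" by (simp add: continuous_on_eq_continuous_at)
    moreover have "\<phi> 0 > 0" using x unfolding ray_cone_def \<phi>_def by blast
    ultimately have "eventually (\<lambda>t. \<phi> t > 0) (at 0)" by (simp add: isCont_def order_tendstoD(1))
    then obtain \<delta> where \<delta>: "\<delta> > 0" "\<And>t. t \<noteq> 0 \<Longrightarrow> \<bar>t\<bar> < \<delta> \<Longrightarrow> \<phi> t > 0"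
      by (auto simp: eventually_at dist_real_def)
    define \<epsilon> where "\<epsilon> = \<delta> / 2"
    have eps: "\<epsilon> > 0" using \<delta> by (simp add: \<epsilon>_def)
    define x' where "x' = (\<lambda>i. x i + (- \<epsilon>) * e i)"
    have x': "x' \<in> ray_cone e"
    proof -
      have "meval g (\<lambda>i. x' i + t * e i) > 0" if "t \<ge> 0" for t
      proof -
        have "meval g (\<lambda>i. x' i + t * e i) = \<phi> (t - \<epsilon>)" unfolding \<phi>_def x'_def
          by (rule arg_cong[where f = "meval g"]) (simp add: algebra_simps)
        moreover have "\<phi> (t - \<epsilon>) > 0"
        proof (cases "t - \<epsilon> \<ge> 0")
          case True
          then show ?thesis using x by (simp add: ray_cone_def \<phi>_def)
        next
          case False
          then show ?thesis using that \<delta>(1) by (intro \<delta>(2)) (auto simp: \<epsilon>_def)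
        qed
        ultimately show ?thesis by simp
      qed
      moreover have "x' i = 0" if "i \<ge> m" for i using that x e0 by (simp add: x'_def ray_cone_def)
      ultimately show ?thesis by (simp add: ray_cone_def)
    qed
    define e' where "e' = (\<lambda>i. y i + \<epsilon> * e i)"
    have e': "e' \<in> pos_orthant m"
      using y ep e0 eps by (auto simp: e'_def pos_orthant_def topspace_Euclidean_space intro: add_nonneg_pos)
    have ind: "ray_cone e = ray_cone e'" by (rule ray_cone_independent[OF e e'])
    have "meval g (\<lambda>i. (x i + y i) + t * e' i) > 0" if "t \<ge> 0" for t
    proof -
      have "(\<lambda>i. (x i + y i) + t * e' i) = (\<lambda>i. x' i + (1 + t) * e' i)"
        by (simp add: x'_def e'_def algebra_simps)
      moreover have "meval g (\<lambda>i. x' i + (1 + t) * e' i) > 0"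
      proof -
        have "x' \<in> ray_cone e'" using x' ind by simp
        then show ?thesis using that unfolding ray_cone_def by simp
      qed
      ultimately show ?thesis by simp
    qed
    then show ?thesis unfolding ind using x y by (simp add: ray_cone_def)
  qed
  then show ?thesis unfolding passes_PRT_def closure_pos_orthant by blast
qed

theorem nonvanishing_imp_garding:
  assumes "multi_affine g"
  shows "multi_affine_garding m g"
proof -
  define e where "e = (\<lambda>i. if i < m then 1 else 0 :: real)"
  have e: "e \<in> pos_orthant m" by (simp add: e_def pos_orthant_def topspace_Euclidean_space)
  have "ray_cone e \<noteq> {}" using orthant_subset_ray_cone[OF e e] by blast
  then show ?thesis unfolding multi_affine_garding_def
    using g(1) assms ray_cone_component[OF e] ray_cone_PRT[OF e] by blast
qed

end

section \<open>The inclusions\<close>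

theorem real_stable_imp_garding:
  assumes f: "homog d f" "real_stable n f" "nonneg_coeffs f"
  shows "garding n f"
proof (cases "f = 0")
  case True
  have "multi_affine_garding 0 0" by (simp add: multi_affine_garding_def polys_def multi_affine_def)
  moreover have "strictly_positive_affine n 0 (\<lambda>_ _. 0)" by (simp add: strictly_positive_affine_def)
  ultimately show ?thesis unfolding garding_def True
    by (intro conjI exI[of _ 0] exI[of _ "0::mpoly"] exI[of _ "\<lambda>_ _. 0"]) (auto simp: polys_def)
next
  case False
  have fn: "f \<in> polys n" "nonvanishing n f" using f(2) False by (auto simp: real_stable_def nonvanishing_def)
  obtain m \<sigma> g where g: "g \<in> polys m" "multi_affine g" "homog d g" "nonneg_coeffs g" "nonvanishing m g"
    and \<sigma>: "\<And>j. j < m \<Longrightarrow> \<sigma> j < n" and fg: "\<And>x :: nat \<Rightarrow> real. meval f x = meval g (\<lambda>j. x (\<sigma> j))"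
    by (rule stable_polarization[OF fn(1) f(1,3) fn(2)]) blast
  define \<mu> where "\<mu> x = (\<lambda>i. if i < m then x (\<sigma> i) else 0 :: real)" for x
  have delta: "(\<Sum>j<n. (if j = \<sigma> i then 1 else 0) * c j) = c (\<sigma> i)" if "i < m" for i and c :: "nat \<Rightarrow> real"
  proof -
    have "(\<Sum>j<n. (if j = \<sigma> i then 1 else 0) * c j) = (\<Sum>j<n. if j = \<sigma> i then c j else 0)"
      by (intro sum.cong) auto
    then show ?thesis using \<sigma>[OF that] by simp
  qed
  have "strictly_positive_affine n m \<mu>"
    unfolding strictly_positive_affine_def
  proof (intro exI[of _ "\<lambda>i j. if j = \<sigma> i then 1 else 0"] exI[of _ "\<lambda>_. 0"] conjI allI impI ballI)
    fix i assume "i < m"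
    then show "0 < (\<Sum>j<n. (if j = \<sigma> i then 1 else 0 :: real))" using delta[of i "\<lambda>_. 1"] by simp
  next
    fix x show "\<mu> x = (\<lambda>i. if i < m then (\<Sum>j<n. (if j = \<sigma> i then 1 else 0) * x j) + 0 else 0)"
      unfolding \<mu>_def using delta by (intro ext) simp
  qed simp
  moreover have "meval f x = meval g (\<mu> x)" for x :: "nat \<Rightarrow> real"
    unfolding fg \<mu>_def by (rule meval_cong[OF g(1)]) simp
  moreover have "multi_affine_garding m g" by (rule nonvanishing_imp_garding[OF g(1,3,4,5,2)])
  ultimately show ?thesis unfolding garding_def using fn(1) by blast
qed

theorem theorem11p2:
  shows "(\<forall>n d f. homog d f \<and> garding n f \<longrightarrow> lorentzian n d f) \<and>
         (\<forall>n d. d \<ge> 2 \<longrightarrow>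
            stable_class n d \<subseteq> garding_class n d \<and> garding_class n d \<subseteq> lorentzian_class n d)"
  unfolding stable_class_def garding_class_def lorentzian_class_def
  using garding_imp_lorentzian real_stable_imp_garding by blast

end
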